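(* Let $\mathcal A$ be a $C^*$-algebra with identity $1$ and let $\delta:\mathcal A\to\mathcal A$ be a monomorphism with hereditary range. Then the mapping $$\varphi:\mathcal U(\mathcal A,\delta)\to\mathcal A\times_\delta\mathbb Z$$ such that $\varphi(T)=\hat U$ and $\varphi(a)=\hat a$ for all $a\in\mathcal A$, where $\hat a$ and $\hat U$ are the canonical images of $a\in\mathcal A$ and $U$ in $\mathcal A\times_\delta\mathbb Z$, is a $*$-isomorphism.
   Context: A monomorphism is an injective $*$-endomorphism, not necessarily unital; "hereditary range" means that $\delta(\mathcal A)$ is a hereditary $C^*$-subalgebra of $\mathcal A$. $\mathcal U(\mathcal A,\delta)$ is the universal unital $C^*$-algebra generated by $\mathcal A$ and an isometry $T$ subject to the relation $\delta(a)=TaT^*$ for all $a\in\mathcal A$. A transfer operator for $(\mathcal A,\delta)$ is a continuous positive linear map $\delta_*:\mathcal A\to\mathcal A$ with $\delta_*(\delta(a)b)=a\delta_*(b)$ for all $a,b\in\mathcal A$. It is complete if $\delta\delta_*(a)=\delta(1)a\delta(1)$ for all $a\in\mathcal A$. A complete transfer operator, if it exists, is unique. For $\delta$ as in the statement a complete transfer operator exists, namely $\delta_*(a)=\delta^{-1}(\delta(1)a\delta(1))$. If a complete transfer operator $\delta_*$ exists, the crossed product $\mathcal A\times_\delta\mathbb Z$ is the universal unital $C^*$-algebra generated by a copy of $\mathcal A$ and a partial isometry $U$ subject to $\delta(a)=UaU^*$, $\delta_*(a)=U^*aU$ for $a\in\mathcal A$. *)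

theory Defs
  imports Complex_Main "HOL-Library.FuncSet" "HOL-Library.Poly_Mapping" "HOL-Algebra.Ring"
begin

section \<open>Unital C*-algebras\<close>

record 'a cstar = "'a ring" +
  cscale :: "complex \<Rightarrow> 'a \<Rightarrow> 'a"  (infixr \<open>*\<^sub>C\<index>\<close> 75)
  adj :: "'a \<Rightarrow> 'a"  (\<open>_\<^sup>\<star>\<index>\<close> [1000] 999)
  cnorm :: "'a \<Rightarrow> real"  (\<open>\<parallel>_\<parallel>\<index>\<close>)

text \<open>The zero algebra is included: \<open>1 \<noteq> 0\<close> is not required.\<close>

locale unital_cstar_algebra = ring A for A :: "'a cstar" (structure) +
  assumes scale_closed: "x \<in> carrier A \<Longrightarrow> c *\<^sub>C x \<in> carrier A"
    and scale_right_distrib: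
      "x \<in> carrier A \<Longrightarrow> y \<in> carrier A \<Longrightarrow> c *\<^sub>C (x \<oplus> y) = c *\<^sub>C x \<oplus> c *\<^sub>C y"
    and scale_left_distrib: "x \<in> carrier A \<Longrightarrow> (c + d) *\<^sub>C x = c *\<^sub>C x \<oplus> d *\<^sub>C x"
    and scale_scale: "x \<in> carrier A \<Longrightarrow> c *\<^sub>C d *\<^sub>C x = (c * d) *\<^sub>C x"
    and scale_one: "x \<in> carrier A \<Longrightarrow> 1 *\<^sub>C x = x"
    and mult_scale_left:
      "x \<in> carrier A \<Longrightarrow> y \<in> carrier A \<Longrightarrow> (c *\<^sub>C x) \<otimes> y = c *\<^sub>C (x \<otimes> y)"
    and mult_scale_right:
      "x \<in> carrier A \<Longrightarrow> y \<in> carrier A \<Longrightarrow> x \<otimes> (c *\<^sub>C y) = c *\<^sub>C (x \<otimes> y)"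
    and adj_closed: "x \<in> carrier A \<Longrightarrow> x\<^sup>\<star> \<in> carrier A"
    and adj_adj: "x \<in> carrier A \<Longrightarrow> (x\<^sup>\<star>)\<^sup>\<star> = x"
    and adj_add: "x \<in> carrier A \<Longrightarrow> y \<in> carrier A \<Longrightarrow> (x \<oplus> y)\<^sup>\<star> = x\<^sup>\<star> \<oplus> y\<^sup>\<star>"
    and adj_scale: "x \<in> carrier A \<Longrightarrow> (c *\<^sub>C x)\<^sup>\<star> = cnj c *\<^sub>C x\<^sup>\<star>"
    and adj_mult: "x \<in> carrier A \<Longrightarrow> y \<in> carrier A \<Longrightarrow> (x \<otimes> y)\<^sup>\<star> = y\<^sup>\<star> \<otimes> x\<^sup>\<star>"
    and norm_eq_zero: "x \<in> carrier A \<Longrightarrow> \<parallel>x\<parallel> = 0 \<longleftrightarrow> x = \<zero>"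
    and norm_triangle: "x \<in> carrier A \<Longrightarrow> y \<in> carrier A \<Longrightarrow> \<parallel>x \<oplus> y\<parallel> \<le> \<parallel>x\<parallel> + \<parallel>y\<parallel>"
    and norm_scale: "x \<in> carrier A \<Longrightarrow> \<parallel>c *\<^sub>C x\<parallel> = cmod c * \<parallel>x\<parallel>"
    and norm_mult: "x \<in> carrier A \<Longrightarrow> y \<in> carrier A \<Longrightarrow> \<parallel>x \<otimes> y\<parallel> \<le> \<parallel>x\<parallel> * \<parallel>y\<parallel>"
    and cstar_identity: "x \<in> carrier A \<Longrightarrow> \<parallel>x\<^sup>\<star> \<otimes> x\<parallel> = \<parallel>x\<parallel>\<^sup>2"
    and complete:
      "range s \<subseteq> carrier A \<Longrightarrow> \<forall>e>0. \<exists>N::nat. \<forall>m\<ge>N. \<forall>n\<ge>N. \<parallel>s m \<ominus> s n\<parallel> < e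
        \<Longrightarrow> \<exists>l\<in>carrier A. (\<lambda>n. \<parallel>s n \<ominus> l\<parallel>) \<longlonglongrightarrow> 0"

text \<open>A \<open>*\<close>-homomorphism need not be unital.\<close>

definition star_hom :: "'a cstar \<Rightarrow> 'b cstar \<Rightarrow> ('a \<Rightarrow> 'b) \<Rightarrow> bool" where
  "star_hom A B f \<longleftrightarrow>
     f \<in> carrier A \<rightarrow> carrier B \<and>
     (\<forall>x\<in>carrier A. \<forall>y\<in>carrier A. f (x \<oplus>\<^bsub>A\<^esub> y) = f x \<oplus>\<^bsub>B\<^esub> f y) \<and>
     (\<forall>c. \<forall>x\<in>carrier A. f (c *\<^sub>C\<^bsub>A\<^esub> x) = c *\<^sub>C\<^bsub>B\<^esub> f x) \<and>
     (\<forall>x\<in>carrier A. \<forall>y\<in>carrier A. f (x \<otimes>\<^bsub>A\<^esub> y) = f x \<otimes>\<^bsub>B\<^esub> f y) \<and>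
     (\<forall>x\<in>carrier A. f (x\<^sup>\<star>\<^bsub>A\<^esub>) = (f x)\<^sup>\<star>\<^bsub>B\<^esub>)"

definition star_iso :: "'a cstar \<Rightarrow> 'b cstar \<Rightarrow> ('a \<Rightarrow> 'b) \<Rightarrow> bool" where
  "star_iso A B f \<longleftrightarrow> star_hom A B f \<and> bij_betw f (carrier A) (carrier B)"

definition monomorphism :: "'a cstar \<Rightarrow> ('a \<Rightarrow> 'a) \<Rightarrow> bool" where
  "monomorphism A \<delta> \<longleftrightarrow> star_hom A A \<delta> \<and> inj_on \<delta> (carrier A)"

definition positive :: "'a cstar \<Rightarrow> 'a \<Rightarrow> bool" where
  "positive A x \<longleftrightarrow> (\<exists>y\<in>carrier A. x = y\<^sup>\<star>\<^bsub>A\<^esub> \<otimes>\<^bsub>A\<^esub> y)"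

definition cstar_subalgebra :: "'a set \<Rightarrow> 'a cstar \<Rightarrow> bool" where
  "cstar_subalgebra B A \<longleftrightarrow>
     B \<subseteq> carrier A \<and> \<zero>\<^bsub>A\<^esub> \<in> B \<and>
     (\<forall>x\<in>B. \<forall>y\<in>B. x \<oplus>\<^bsub>A\<^esub> y \<in> B) \<and>
     (\<forall>c. \<forall>x\<in>B. c *\<^sub>C\<^bsub>A\<^esub> x \<in> B) \<and>
     (\<forall>x\<in>B. \<forall>y\<in>B. x \<otimes>\<^bsub>A\<^esub> y \<in> B) \<and>
     (\<forall>x\<in>B. x\<^sup>\<star>\<^bsub>A\<^esub> \<in> B) \<and>
     (\<forall>s l. range s \<subseteq> B \<and> l \<in> carrier A \<and> (\<lambda>n::nat. \<parallel>s n \<ominus>\<^bsub>A\<^esub> l\<parallel>\<^bsub>A\<^esub>) \<longlonglongrightarrow> 0 \<longrightarrow> l \<in> B)"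

definition hereditary_subalgebra :: "'a set \<Rightarrow> 'a cstar \<Rightarrow> bool" where
  "hereditary_subalgebra B A \<longleftrightarrow> cstar_subalgebra B A \<and>
     (\<forall>a\<in>carrier A. \<forall>b\<in>B. positive A a \<and> positive A (b \<ominus>\<^bsub>A\<^esub> a) \<longrightarrow> a \<in> B)"


section \<open>Transfer operators\<close>

definition transfer_operator :: "'a cstar \<Rightarrow> ('a \<Rightarrow> 'a) \<Rightarrow> ('a \<Rightarrow> 'a) \<Rightarrow> bool" where
  "transfer_operator A \<delta> \<tau> \<longleftrightarrow>
     \<tau> \<in> carrier A \<rightarrow> carrier A \<and>
     (\<forall>x\<in>carrier A. \<forall>y\<in>carrier A. \<tau> (x \<oplus>\<^bsub>A\<^esub> y) = \<tau> x \<oplus>\<^bsub>A\<^esub> \<tau> y) \<and>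
     (\<forall>c. \<forall>x\<in>carrier A. \<tau> (c *\<^sub>C\<^bsub>A\<^esub> x) = c *\<^sub>C\<^bsub>A\<^esub> \<tau> x) \<and>
     (\<forall>x\<in>carrier A. \<forall>e>0. \<exists>d>0. \<forall>y\<in>carrier A.
        \<parallel>y \<ominus>\<^bsub>A\<^esub> x\<parallel>\<^bsub>A\<^esub> < d \<longrightarrow> \<parallel>\<tau> y \<ominus>\<^bsub>A\<^esub> \<tau> x\<parallel>\<^bsub>A\<^esub> < e) \<and>
     (\<forall>x\<in>carrier A. positive A x \<longrightarrow> positive A (\<tau> x)) \<and>
     (\<forall>a\<in>carrier A. \<forall>b\<in>carrier A. \<tau> (\<delta> a \<otimes>\<^bsub>A\<^esub> b) = a \<otimes>\<^bsub>A\<^esub> \<tau> b)"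

definition complete_transfer_operator :: "'a cstar \<Rightarrow> ('a \<Rightarrow> 'a) \<Rightarrow> ('a \<Rightarrow> 'a) \<Rightarrow> bool" where
  "complete_transfer_operator A \<delta> \<tau> \<longleftrightarrow> transfer_operator A \<delta> \<tau> \<and>
     (\<forall>a\<in>carrier A. \<delta> (\<tau> a) = \<delta> \<one>\<^bsub>A\<^esub> \<otimes>\<^bsub>A\<^esub> a \<otimes>\<^bsub>A\<^esub> \<delta> \<one>\<^bsub>A\<^esub>)"

text \<open>The choice is harmless: a complete transfer operator is unique on the carrier.\<close>

definition the_complete_transfer :: "'a cstar \<Rightarrow> ('a \<Rightarrow> 'a) \<Rightarrow> 'a \<Rightarrow> 'a" where
  "the_complete_transfer A \<delta> = (SOME \<tau>. complete_transfer_operator A \<delta> \<tau>)"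


section \<open>The free unital \<open>*\<close>-algebra on a type of generators\<close>

datatype 'g letter = Gen 'g | Gen_adj 'g

fun letter_adj :: "'g letter \<Rightarrow> 'g letter" where
  "letter_adj (Gen g) = Gen_adj g"
| "letter_adj (Gen_adj g) = Gen g"

datatype 'g word = Word (letters: "'g letter list")

instantiation word :: (type) monoid_add
begin
definition zero_word :: "'a word" where "0 = Word []"
definition plus_word :: "'a word \<Rightarrow> 'a word \<Rightarrow> 'a word" where
  "v + w = Word (letters v @ letters w)"
instance
  by standard (simp_all add: zero_word_def plus_word_def)
end

text \<open>Concatenation is written additively because the multiplication of \<open>\<Rightarrow>\<^sub>0\<close> is the
  convolution with respect to \<open>+\<close> on the keys; thus \<open>*\<close> below is the noncommutative product
  of \<open>*\<close>-polynomials, with unit \<open>1\<close>.\<close>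

type_synonym 'g star_poly = "'g word \<Rightarrow>\<^sub>0 complex"

definition word_adj :: "'g word \<Rightarrow> 'g word" where
  "word_adj w = Word (rev (map letter_adj (letters w)))"

lemma letter_adj_letter_adj [simp]: "letter_adj (letter_adj l) = l"
  by (cases l) simp_all

lemma word_adj_word_adj [simp]: "word_adj (word_adj w) = w"
  by (cases w) (simp add: word_adj_def rev_map o_def)

lift_definition poly_adj :: "'g star_poly \<Rightarrow> 'g star_poly" is "\<lambda>f w. cnj (f (word_adj w))"
proof -
  fix f :: "'g word \<Rightarrow> complex" assume "finite {w. f w \<noteq> 0}"
  then have "finite (word_adj ` {w. f w \<noteq> 0})" by simp
  moreover have "{w. cnj (f (word_adj w)) \<noteq> 0} \<subseteq> word_adj ` {w. f w \<noteq> 0}"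
    by (auto intro!: image_eqI[of _ _ "word_adj _"])
  ultimately show "finite {w. cnj (f (word_adj w)) \<noteq> 0}" by (rule rev_finite_subset)
qed

definition poly_scale :: "complex \<Rightarrow> 'g star_poly \<Rightarrow> 'g star_poly" where
  "poly_scale c x = Poly_Mapping.single 0 c * x"

definition gen :: "'g \<Rightarrow> 'g star_poly" where
  "gen g = Poly_Mapping.single (Word [Gen g]) 1"


section \<open>The universal unital C*-algebra given by generators and relations\<close>

text \<open>A set \<open>R\<close> of \<open>*\<close>-polynomials encodes the relations \<open>r = 0\<close> for \<open>r \<in> R\<close>. The universal
  algebra is the separated completion of the free \<open>*\<close>-algebra with respect to the largest
  C*-seminorm annihilating \<open>R\<close>.\<close>

definition cstar_seminorm :: "('g star_poly \<Rightarrow> real) \<Rightarrow> bool" where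
  "cstar_seminorm p \<longleftrightarrow>
     (\<forall>x y. p (x + y) \<le> p x + p y) \<and>
     (\<forall>c x. p (poly_scale c x) = cmod c * p x) \<and>
     (\<forall>x y. p (x * y) \<le> p x * p y) \<and>
     (\<forall>x. p (poly_adj x * x) = (p x)\<^sup>2)"

definition rel_seminorms :: "'g star_poly set \<Rightarrow> ('g star_poly \<Rightarrow> real) set" where
  "rel_seminorms R = {p. cstar_seminorm p \<and> (\<forall>r\<in>R. p r = 0)}"

definition univ_norm :: "'g star_poly set \<Rightarrow> 'g star_poly \<Rightarrow> real" where
  "univ_norm R x = (SUP p\<in>rel_seminorms R. p x)"

definition cauchy_seqs :: "'g star_poly set \<Rightarrow> (nat \<Rightarrow> 'g star_poly) set" where
  "cauchy_seqs R = {x. \<forall>e>0. \<exists>N. \<forall>m\<ge>N. \<forall>n\<ge>N. univ_norm R (x m - x n) < e}"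

definition seq_class :: "'g star_poly set \<Rightarrow> (nat \<Rightarrow> 'g star_poly) \<Rightarrow> (nat \<Rightarrow> 'g star_poly) set" where
  "seq_class R x = {y \<in> cauchy_seqs R. (\<lambda>n. univ_norm R (x n - y n)) \<longlonglongrightarrow> 0}"

definition rep :: "(nat \<Rightarrow> 'g star_poly) set \<Rightarrow> nat \<Rightarrow> 'g star_poly" where
  "rep X = (SOME x. x \<in> X)"

definition univ_cstar :: "'g star_poly set \<Rightarrow> (nat \<Rightarrow> 'g star_poly) set cstar" where
  "univ_cstar R = \<lparr>
     carrier = seq_class R ` cauchy_seqs R,
     mult = (\<lambda>X Y. seq_class R (\<lambda>n. rep X n * rep Y n)),
     one = seq_class R (\<lambda>n. 1),
     zero = seq_class R (\<lambda>n. 0),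
     add = (\<lambda>X Y. seq_class R (\<lambda>n. rep X n + rep Y n)),
     cscale = (\<lambda>c X. seq_class R (\<lambda>n. poly_scale c (rep X n))),
     adj = (\<lambda>X. seq_class R (\<lambda>n. poly_adj (rep X n))),
     cnorm = (\<lambda>X. lim (\<lambda>n. univ_norm R (rep X n))) \<rparr>"

definition univ_gen :: "'g star_poly set \<Rightarrow> 'g \<Rightarrow> (nat \<Rightarrow> 'g star_poly) set" where
  "univ_gen R g = seq_class R (\<lambda>n. gen g)"


section \<open>The algebras \<open>\<U>(A,\<delta>)\<close> and \<open>A \<times>\<^sub>\<delta> \<int>\<close>\<close>

text \<open>Both algebras are generated by (an image of) \<open>A\<close> and one further element.\<close>

datatype 'a generator = Coeff 'a | Extra

abbreviation coeff :: "'a \<Rightarrow> 'a generator star_poly" where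
  "coeff a \<equiv> gen (Coeff a)"

abbreviation extra :: "'a generator star_poly" where
  "extra \<equiv> gen Extra"

text \<open>These relations say that \<open>Coeff\<close> is a unital \<open>*\<close>-homomorphism on \<open>A\<close>. Elements of the type
  outside the carrier are not generators; the last set removes them.\<close>

definition coeff_relations :: "'a cstar \<Rightarrow> 'a generator star_poly set" where
  "coeff_relations A =
     {coeff (a \<oplus>\<^bsub>A\<^esub> b) - (coeff a + coeff b) | a b. a \<in> carrier A \<and> b \<in> carrier A} \<union>
     {coeff (c *\<^sub>C\<^bsub>A\<^esub> a) - poly_scale c (coeff a) | c a. a \<in> carrier A} \<union>
     {coeff (a \<otimes>\<^bsub>A\<^esub> b) - coeff a * coeff b | a b. a \<in> carrier A \<and> b \<in> carrier A} \<union>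
     {coeff (a\<^sup>\<star>\<^bsub>A\<^esub>) - poly_adj (coeff a) | a. a \<in> carrier A} \<union>
     {coeff \<one>\<^bsub>A\<^esub> - 1} \<union>
     {coeff a | a. a \<notin> carrier A}"

definition isometry_relations :: "'a cstar \<Rightarrow> ('a \<Rightarrow> 'a) \<Rightarrow> 'a generator star_poly set" where
  "isometry_relations A \<delta> =
     {poly_adj extra * extra - 1} \<union>
     {coeff (\<delta> a) - extra * coeff a * poly_adj extra | a. a \<in> carrier A}"

definition crossed_relations :: "'a cstar \<Rightarrow> ('a \<Rightarrow> 'a) \<Rightarrow> ('a \<Rightarrow> 'a) \<Rightarrow> 'a generator star_poly set" where
  "crossed_relations A \<delta> \<tau> =
     {extra * poly_adj extra * extra - extra} \<union>
     {coeff (\<delta> a) - extra * coeff a * poly_adj extra | a. a \<in> carrier A} \<union>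
     {coeff (\<tau> a) - poly_adj extra * coeff a * extra | a. a \<in> carrier A}"

type_synonym 'a univ = "(nat \<Rightarrow> 'a generator star_poly) set"

definition isometry_algebra :: "'a cstar \<Rightarrow> ('a \<Rightarrow> 'a) \<Rightarrow> 'a univ cstar" where
  "isometry_algebra A \<delta> = univ_cstar (coeff_relations A \<union> isometry_relations A \<delta>)"

definition isometry_algebra_coeff :: "'a cstar \<Rightarrow> ('a \<Rightarrow> 'a) \<Rightarrow> 'a \<Rightarrow> 'a univ" where
  "isometry_algebra_coeff A \<delta> a = univ_gen (coeff_relations A \<union> isometry_relations A \<delta>) (Coeff a)"

definition isometry_algebra_T :: "'a cstar \<Rightarrow> ('a \<Rightarrow> 'a) \<Rightarrow> 'a univ" where
  "isometry_algebra_T A \<delta> = univ_gen (coeff_relations A \<union> isometry_relations A \<delta>) Extra"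

definition crossed_product_relations :: "'a cstar \<Rightarrow> ('a \<Rightarrow> 'a) \<Rightarrow> 'a generator star_poly set" where
  "crossed_product_relations A \<delta> =
     coeff_relations A \<union> crossed_relations A \<delta> (the_complete_transfer A \<delta>)"

definition crossed_product :: "'a cstar \<Rightarrow> ('a \<Rightarrow> 'a) \<Rightarrow> 'a univ cstar" where
  "crossed_product A \<delta> = univ_cstar (crossed_product_relations A \<delta>)"

definition crossed_product_coeff :: "'a cstar \<Rightarrow> ('a \<Rightarrow> 'a) \<Rightarrow> 'a \<Rightarrow> 'a univ" where
  "crossed_product_coeff A \<delta> a = univ_gen (crossed_product_relations A \<delta>) (Coeff a)"

definition crossed_product_U :: "'a cstar \<Rightarrow> ('a \<Rightarrow> 'a) \<Rightarrow> 'a univ" where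
  "crossed_product_U A \<delta> = univ_gen (crossed_product_relations A \<delta>) Extra"


section \<open>Adequacy of the construction\<close>

text \<open>The rest of the theory shows that, for admissible relations, \<^const>\<open>univ_cstar\<close> is a unital
  C*-algebra with the expected universal property, and spells this out for \<open>\<U>(A,\<delta>)\<close> and
  \<open>A \<times>\<^sub>\<delta> \<int>\<close> (final four theorems).\<close>


subsection \<open>Calculations in the free algebra\<close>

lemma poly_induct [case_names single add]:
  assumes single: "\<And>w c. P (Poly_Mapping.single w c)"
    and add: "\<And>x y. P x \<Longrightarrow> P y \<Longrightarrow> P (x + y)"
  shows "P (x :: 'g star_poly)"
proof (induction "card (Poly_Mapping.keys x)" arbitrary: x)
  case 0
  then have "x = 0" by simp
  then show ?case using single[of 0 0] by simp
next
  case (Suc n)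
  then obtain w where w: "w \<in> Poly_Mapping.keys x" by fastforce
  let ?s = "Poly_Mapping.single w (Poly_Mapping.lookup x w)"
  have "Poly_Mapping.keys (x - ?s) = Poly_Mapping.keys x - {w}"
    by (auto simp: in_keys_iff lookup_minus lookup_single when_def split: if_splits)
  then have "n = card (Poly_Mapping.keys (x - ?s))" using Suc(2) w by simp
  from add[OF Suc(1)[OF this] single[of w "Poly_Mapping.lookup x w"]] show ?case by simp
qed

lemma single_diff: "Poly_Mapping.single w (a - b :: complex) = Poly_Mapping.single w a - Poly_Mapping.single w b"
  by (rule poly_mapping_eqI) (simp add: lookup_minus lookup_single when_def)

lemma poly_scale_single: "poly_scale c (Poly_Mapping.single w d) = Poly_Mapping.single w (c * d)"
  by (simp add: poly_scale_def mult_single)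

lemma poly_scale_add: "poly_scale c (x + y) = poly_scale c x + poly_scale c y"
  by (simp add: poly_scale_def distrib_left)

lemma poly_scale_diff: "poly_scale c (x - y) = poly_scale c x - poly_scale c y"
  by (simp add: poly_scale_def right_diff_distrib)

lemma poly_scale_add_left: "poly_scale (c + d) x = poly_scale c x + poly_scale d x"
  by (simp add: poly_scale_def distrib_right single_add)

lemma poly_scale_scale: "poly_scale c (poly_scale d x) = poly_scale (c * d) x"
  by (simp add: poly_scale_def mult_single flip: mult.assoc)

lemma poly_scale_one [simp]: "poly_scale 1 x = x"
  by (simp add: poly_scale_def)

lemma poly_scale_zero [simp]: "poly_scale 0 x = 0"
  by (simp add: poly_scale_def)

lemma poly_scale_minus_one: "poly_scale (- 1) x = - x"
  using poly_scale_add_left[of 1 "- 1" x] by (simp add: add_eq_0_iff)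

lemma poly_scale_mult_left: "poly_scale c x * y = poly_scale c (x * y)"
  by (simp add: poly_scale_def mult.assoc)

lemma poly_scale_mult_right: "x * poly_scale c y = poly_scale c (x * y)"
proof -
  have "x * Poly_Mapping.single 0 c = Poly_Mapping.single 0 c * x"
    by (induction x rule: poly_induct) (simp_all add: mult_single algebra_simps)
  then show ?thesis by (simp add: poly_scale_def flip: mult.assoc)
qed

lemma poly_adj_add: "poly_adj (x + y) = poly_adj x + poly_adj y"
  by (rule poly_mapping_eqI) (simp add: poly_adj.rep_eq lookup_add)

lemma poly_adj_diff: "poly_adj (x - y) = poly_adj x - poly_adj y"
  by (rule poly_mapping_eqI) (simp add: poly_adj.rep_eq lookup_minus)

lemma poly_adj_adj [simp]: "poly_adj (poly_adj x) = x"
  by (rule poly_mapping_eqI) (simp add: poly_adj.rep_eq)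

lemma poly_adj_single: "poly_adj (Poly_Mapping.single w c) = Poly_Mapping.single (word_adj w) (cnj c)"
  by (rule poly_mapping_eqI) (auto simp: poly_adj.rep_eq lookup_single when_def)

lemma word_adj_add: "word_adj (v + w) = word_adj w + word_adj v"
  by (simp add: word_adj_def plus_word_def)

lemma word_adj_zero [simp]: "word_adj 0 = 0"
  by (simp add: word_adj_def zero_word_def)

lemma poly_adj_one [simp]: "poly_adj 1 = 1"
  by (metis poly_adj_single single_one word_adj_zero complex_cnj_one)

lemma poly_adj_mult: "poly_adj (x * y) = poly_adj y * poly_adj x"
proof (induction x rule: poly_induct)
  case (single w c)
  show ?case
    by (induction y rule: poly_induct)
      (simp_all add: mult_single poly_adj_single word_adj_add poly_adj_add algebra_simps)
qed (simp add: poly_adj_add algebra_simps)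

lemma poly_adj_scale: "poly_adj (poly_scale c x) = poly_scale (cnj c) (poly_adj x)"
  unfolding poly_scale_def poly_adj_mult
  using poly_scale_mult_right[of "poly_adj x" "cnj c" 1]
  by (simp add: poly_adj_single poly_scale_def)


subsection \<open>C*-seminorms on the free algebra\<close>

lemma
  assumes "cstar_seminorm p"
  shows seminorm_add: "p (x + y) \<le> p x + p y"
    and seminorm_scale: "p (poly_scale c x) = cmod c * p x"
    and seminorm_mult: "p (x * y) \<le> p x * p y"
    and seminorm_adj_mult: "p (poly_adj x * x) = (p x)\<^sup>2"
    and seminorm_zero: "p 0 = 0"
    and seminorm_minus: "p (- x) = p x"
    and seminorm_nonneg: "p x \<ge> 0"
    and seminorm_diff: "p (x - y) \<le> p x + p y"
    and seminorm_commute: "p (x - y) = p (y - x)"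
    and seminorm_triangle: "p (x - z) \<le> p (x - y) + p (y - z)"
    and seminorm_reverse: "\<bar>p x - p y\<bar> \<le> p (x - y)"
proof -
  have add: "p (x + y) \<le> p x + p y" for x y
    using assms unfolding cstar_seminorm_def by blast
  show scale: "p (poly_scale c x) = cmod c * p x" for c x
    using assms unfolding cstar_seminorm_def by blast
  show "p (x * y) \<le> p x * p y" "p (poly_adj x * x) = (p x)\<^sup>2"
    using assms unfolding cstar_seminorm_def by blast+
  show zero: "p 0 = 0" using scale[of 0 0] by simp
  have minus: "p (- x) = p x" for x using scale[of "-1" x] by (simp add: poly_scale_minus_one)
  have nn: "p x \<ge> 0" for x using add[of x "- x"] by (simp add: zero minus)
  show "p (x + y) \<le> p x + p y" "p (- x) = p x" "p x \<ge> 0" using add minus nn by auto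
  show comm: "p (x - y) = p (y - x)" for x y using minus[of "x - y"] by simp
  show "p (x - y) \<le> p x + p y" using add[of x "- y"] by (simp add: minus)
  show "p (x - z) \<le> p (x - y) + p (y - z)" using add[of "x - y" "y - z"] by simp
  have "p x - p y \<le> p (x - y)" for x y using add[of "x - y" y] by simp
  from this[of x y] this[of y x] show "\<bar>p x - p y\<bar> \<le> p (x - y)"
    using comm[of x y] by linarith
qed

lemma seminorm_adj:
  assumes "cstar_seminorm p" shows "p (poly_adj x) = p x"
proof -
  have le: "p y \<le> p (poly_adj y)" for y
  proof (cases "p y = 0")
    case True then show ?thesis using seminorm_nonneg[OF assms] by simp
  next
    case False
    have "p y * p y \<le> p (poly_adj y) * p y"
      using seminorm_mult[OF assms, of "poly_adj y" y] seminorm_adj_mult[OF assms, of y]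
      by (simp add: power2_eq_square)
    then show ?thesis using False seminorm_nonneg[OF assms, of y] by (simp add: mult_le_cancel_right)
  qed
  from le[of x] le[of "poly_adj x"] show ?thesis by simp
qed

text \<open>The relations are admissible if every generator is bounded; the universal seminorm is then finite.\<close>

definition admissible :: "'g star_poly set \<Rightarrow> bool" where
  "admissible R \<longleftrightarrow> (\<forall>g. \<exists>K. \<forall>p\<in>rel_seminorms R. p (gen g) \<le> K)"

lemma seminorm_one: assumes "cstar_seminorm p" shows "p 1 \<le> 1"
proof -
  have "p 1 * p 1 = p 1" using seminorm_adj_mult[OF assms, of 1] by (simp add: power2_eq_square)
  then have "p 1 = 0 \<or> p 1 = 1" by simp
  then show ?thesis by auto
qed

lemma single_Word_Cons: "Poly_Mapping.single (Word (l # ls)) (1::complex) =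
    Poly_Mapping.single (Word [l]) 1 * Poly_Mapping.single (Word ls) 1"
  by (simp add: mult_single plus_word_def)

lemma gen_adj: "poly_adj (gen g) = Poly_Mapping.single (Word [Gen_adj g]) 1"
  by (simp add: gen_def poly_adj_single word_adj_def)

lemma admissible_bdd:
  assumes "admissible R" shows "\<exists>K. \<forall>p\<in>rel_seminorms R. p x \<le> K"
proof (induction x rule: poly_induct)
  case (single w c)
  have letter: "\<exists>K. \<forall>p\<in>rel_seminorms R. p (Poly_Mapping.single (Word [l]) 1) \<le> K" for l
  proof (cases l)
    case (Gen g) then show ?thesis using assms by (simp add: admissible_def gen_def)
  next
    case (Gen_adj g)
    from assms obtain K where K: "\<And>p. p \<in> rel_seminorms R \<Longrightarrow> p (gen g) \<le> K"
      unfolding admissible_def by blast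
    have "p (poly_adj (gen g)) \<le> K" if "p \<in> rel_seminorms R" for p
      using K[OF that] that by (simp add: rel_seminorms_def seminorm_adj)
    then show ?thesis unfolding Gen_adj gen_adj by blast
  qed
  have word: "\<exists>K. \<forall>p\<in>rel_seminorms R. p (Poly_Mapping.single (Word ls) 1) \<le> K" for ls
  proof (induction ls)
    case Nil
    have "Poly_Mapping.single (Word []) 1 = (1 :: 'a star_poly)" by (metis zero_word_def single_one)
    then show ?case using seminorm_one unfolding rel_seminorms_def by auto
  next
    case (Cons l ls)
    obtain K where K: "\<forall>p\<in>rel_seminorms R. p (Poly_Mapping.single (Word [l]) 1) \<le> K" using letter by blast
    obtain L where L: "\<forall>p\<in>rel_seminorms R. p (Poly_Mapping.single (Word ls) 1) \<le> L" using Cons by blast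
    have "p (Poly_Mapping.single (Word (l # ls)) 1) \<le> K * L" if p: "p \<in> rel_seminorms R" for p
    proof -
      have sp: "cstar_seminorm p" using p by (simp add: rel_seminorms_def)
      have "p (Poly_Mapping.single (Word (l # ls)) 1)
          \<le> p (Poly_Mapping.single (Word [l]) 1) * p (Poly_Mapping.single (Word ls) 1)"
        unfolding single_Word_Cons[of l ls] by (rule seminorm_mult[OF sp])
      also have "\<dots> \<le> K * L"
        using K L p seminorm_nonneg[OF sp] by (intro mult_mono) (blast intro: order_trans)+
      finally show ?thesis .
    qed
    then show ?case by blast
  qed
  obtain K where K: "\<And>p. p \<in> rel_seminorms R \<Longrightarrow> p (Poly_Mapping.single w 1) \<le> K"
    using word[of "letters w"] by auto
  have "p (Poly_Mapping.single w c) \<le> cmod c * K" if "p \<in> rel_seminorms R" for p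
    using seminorm_scale[of p c "Poly_Mapping.single w 1"] K[OF that] that
    by (simp add: poly_scale_single rel_seminorms_def mult_left_mono)
  then show ?case by blast
next
  case (add x y)
  then obtain K L where "\<forall>p\<in>rel_seminorms R. p x \<le> K" "\<forall>p\<in>rel_seminorms R. p y \<le> L" by blast
  then have "p (x + y) \<le> K + L" if "p \<in> rel_seminorms R" for p
    using that seminorm_add[of p x y] by (fastforce simp: rel_seminorms_def)
  then show ?case by blast
qed

lemma rel_seminorms_nonempty: "(\<lambda>_. 0) \<in> rel_seminorms R"
  by (simp add: rel_seminorms_def cstar_seminorm_def)

lemma
  assumes "admissible R"
  shows univ_norm_upper: "p \<in> rel_seminorms R \<Longrightarrow> p x \<le> univ_norm R x"
    and univ_norm_least: "(\<And>p. p \<in> rel_seminorms R \<Longrightarrow> p x \<le> K) \<Longrightarrow> univ_norm R x \<le> K"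
proof -
  have "bdd_above ((\<lambda>p. p x) ` rel_seminorms R)"
    using admissible_bdd[OF assms, of x] by (auto simp: bdd_above_def)
  then show "p \<in> rel_seminorms R \<Longrightarrow> p x \<le> univ_norm R x"
    unfolding univ_norm_def by (rule cSUP_upper[rotated])
  show "(\<And>p. p \<in> rel_seminorms R \<Longrightarrow> p x \<le> K) \<Longrightarrow> univ_norm R x \<le> K"
    unfolding univ_norm_def using rel_seminorms_nonempty by (intro cSUP_least) auto
qed

text \<open>The universal seminorm is itself a C*-seminorm annihilating the relations.\<close>

lemma univ_norm_rel_seminorms:
  assumes adm: "admissible R" shows "univ_norm R \<in> rel_seminorms R"
proof -
  note up = univ_norm_upper[OF adm] and le = univ_norm_least[OF adm]
  have sp: "p \<in> rel_seminorms R \<Longrightarrow> cstar_seminorm p" for p by (simp add: rel_seminorms_def)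
  have nn: "univ_norm R x \<ge> 0" for x using up[OF rel_seminorms_nonempty] .
  have add: "univ_norm R (x + y) \<le> univ_norm R x + univ_norm R y" for x y
    by (rule le, rule order_trans[OF seminorm_add[OF sp]]) (auto intro: add_mono up)
  have mult: "univ_norm R (x * y) \<le> univ_norm R x * univ_norm R y" for x y
    by (rule le, rule order_trans[OF seminorm_mult[OF sp]])
      (auto intro!: mult_mono up nn seminorm_nonneg sp)
  have scale_le: "univ_norm R (poly_scale c x) \<le> cmod c * univ_norm R x" for c x
    by (rule le) (simp add: seminorm_scale[OF sp] mult_left_mono up)
  have scale: "univ_norm R (poly_scale c x) = cmod c * univ_norm R x" for c x
  proof (cases "c = 0")
    case True
    have "univ_norm R 0 \<le> 0" by (rule le) (simp add: seminorm_zero[OF sp])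
    then show ?thesis using True nn[of 0] by simp
  next
    case False
    have "cmod c * univ_norm R x \<le> univ_norm R (poly_scale c x)"
      using scale_le[of "1 / c" "poly_scale c x"] False
      by (simp add: poly_scale_scale norm_divide field_simps)
    then show ?thesis using scale_le[of c x] by simp
  qed
  have star: "univ_norm R (poly_adj x * x) = (univ_norm R x)\<^sup>2" for x
  proof (rule antisym)
    show "univ_norm R (poly_adj x * x) \<le> (univ_norm R x)\<^sup>2"
      by (rule le) (simp add: seminorm_adj_mult[OF sp] power_mono up seminorm_nonneg[OF sp])
    have "univ_norm R x \<le> sqrt (univ_norm R (poly_adj x * x))"
      by (rule le, rule real_le_rsqrt) (use up seminorm_adj_mult[OF sp] in metis)
    then show "(univ_norm R x)\<^sup>2 \<le> univ_norm R (poly_adj x * x)"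
      using nn by (metis real_sqrt_ge_0_iff real_sqrt_pow2 power_mono)
  qed
  have "univ_norm R r = 0" if "r \<in> R" for r
    using nn[of r] le[of r 0] that by (fastforce simp: rel_seminorms_def)
  with add mult scale star show ?thesis unfolding rel_seminorms_def cstar_seminorm_def by blast
qed

lemma univ_norm_seminorm: "admissible R \<Longrightarrow> cstar_seminorm (univ_norm R)"
  using univ_norm_rel_seminorms by (auto simp: rel_seminorms_def)


subsection \<open>Elementary facts on unital C*-algebras\<close>

context unital_cstar_algebra
begin

lemmas cl = scale_closed adj_closed

lemma scale_zero_left: "x \<in> carrier A \<Longrightarrow> 0 *\<^sub>C x = \<zero>"
  using scale_left_distrib[of x 0 0] by (metis add.r_cancel_one' add_0 scale_closed)

lemma scale_minus_one: "x \<in> carrier A \<Longrightarrow> (- 1) *\<^sub>C x = \<ominus> x"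
proof -
  assume x: "x \<in> carrier A"
  then have "(- 1) *\<^sub>C x \<oplus> x = \<zero>"
    using scale_left_distrib[of x "- 1" 1] by (simp add: scale_zero_left scale_one)
  then show ?thesis using minus_equality[of "(- 1) *\<^sub>C x" x] x scale_closed by simp
qed

lemma minus_eq_scale: "x \<in> carrier A \<Longrightarrow> y \<in> carrier A \<Longrightarrow> x \<ominus> y = x \<oplus> (- 1) *\<^sub>C y"
  by (simp add: minus_eq scale_minus_one)

lemma scale_diff: "x \<in> carrier A \<Longrightarrow> y \<in> carrier A \<Longrightarrow> c *\<^sub>C (x \<ominus> y) = c *\<^sub>C x \<ominus> c *\<^sub>C y"
  by (simp add: minus_eq_scale scale_right_distrib scale_scale scale_closed mult.commute)

lemma adj_diff: "x \<in> carrier A \<Longrightarrow> y \<in> carrier A \<Longrightarrow> (x \<ominus> y)\<^sup>\<star> = x\<^sup>\<star> \<ominus> y\<^sup>\<star>"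
  by (simp add: minus_eq_scale adj_add adj_scale cl)

lemma adj_one [simp]: "\<one>\<^sup>\<star> = \<one>"
  by (metis adj_adj adj_closed adj_mult l_one one_closed)

lemma adj_zero [simp]: "\<zero>\<^sup>\<star> = \<zero>"
  by (metis adj_closed adj_scale complex_cnj_zero scale_zero_left zero_closed)

lemma norm_zero [simp]: "\<parallel>\<zero>\<parallel> = 0" by (simp add: norm_eq_zero)

lemma norm_minus: "x \<in> carrier A \<Longrightarrow> \<parallel>\<ominus> x\<parallel> = \<parallel>x\<parallel>"
  using norm_scale[of x "- 1"] by (simp add: scale_minus_one)

lemma norm_nonneg: "x \<in> carrier A \<Longrightarrow> \<parallel>x\<parallel> \<ge> 0"
  using norm_triangle[of x "\<ominus> x"] by (simp add: norm_minus r_neg)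

lemma norm_diff: "x \<in> carrier A \<Longrightarrow> y \<in> carrier A \<Longrightarrow> \<parallel>x \<ominus> y\<parallel> \<le> \<parallel>x\<parallel> + \<parallel>y\<parallel>"
  using norm_triangle[of x "\<ominus> y"] by (simp add: minus_eq norm_minus)

lemma norm_commute: "x \<in> carrier A \<Longrightarrow> y \<in> carrier A \<Longrightarrow> \<parallel>x \<ominus> y\<parallel> = \<parallel>y \<ominus> x\<parallel>"
  using norm_minus[of "x \<ominus> y"] by (simp add: minus_eq minus_add a_comm)

lemma norm_diff_triangle:
  assumes "x \<in> carrier A" "y \<in> carrier A" "z \<in> carrier A"
  shows "\<parallel>x \<ominus> z\<parallel> \<le> \<parallel>x \<ominus> y\<parallel> + \<parallel>y \<ominus> z\<parallel>"
proof -
  have "x \<ominus> z = (x \<ominus> y) \<oplus> (y \<ominus> z)" using assms by algebra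
  then show ?thesis using assms norm_triangle[of "x \<ominus> y" "y \<ominus> z"] by simp
qed

lemma norm_le_diff: "x \<in> carrier A \<Longrightarrow> y \<in> carrier A \<Longrightarrow> \<parallel>x\<parallel> \<le> \<parallel>x \<ominus> y\<parallel> + \<parallel>y\<parallel>"
  using norm_diff_triangle[of x y \<zero>] by (simp add: minus_eq)

lemma norm_adj_le: "x \<in> carrier A \<Longrightarrow> \<parallel>x\<parallel> \<le> \<parallel>x\<^sup>\<star>\<parallel>"
proof (cases "\<parallel>x\<parallel> = 0")
  case False assume x: "x \<in> carrier A"
  have "\<parallel>x\<parallel> * \<parallel>x\<parallel> \<le> \<parallel>x\<^sup>\<star>\<parallel> * \<parallel>x\<parallel>"
    using norm_mult[of "x\<^sup>\<star>" x] cstar_identity[of x] x by (simp add: power2_eq_square adj_closed)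
  then show ?thesis using False norm_nonneg[OF x] by (simp add: mult_le_cancel_right)
qed (simp add: adj_closed norm_nonneg)

lemma norm_adj: "x \<in> carrier A \<Longrightarrow> \<parallel>x\<^sup>\<star>\<parallel> = \<parallel>x\<parallel>"
  using norm_adj_le[of x] norm_adj_le[of "x\<^sup>\<star>"] by (simp add: adj_closed adj_adj)

lemma norm_one_le: "\<parallel>\<one>\<parallel> \<le> 1"
proof -
  have "\<parallel>\<one>\<parallel> = \<parallel>\<one>\<parallel>\<^sup>2" using cstar_identity[of \<one>] by simp
  then have "\<parallel>\<one>\<parallel> = 0 \<or> \<parallel>\<one>\<parallel> = 1" by (simp add: power2_eq_square)
  then show ?thesis by auto
qed

lemma limit_unique:
  assumes "range s \<subseteq> carrier A" "l \<in> carrier A" "m \<in> carrier A"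
    and "(\<lambda>n::nat. \<parallel>s n \<ominus> l\<parallel>) \<longlonglongrightarrow> 0" "(\<lambda>n. \<parallel>s n \<ominus> m\<parallel>) \<longlonglongrightarrow> 0"
  shows "l = m"
proof -
  have s: "s n \<in> carrier A" for n using assms(1) by blast
  have "(\<lambda>n. \<parallel>s n \<ominus> l\<parallel> + \<parallel>s n \<ominus> m\<parallel>) \<longlonglongrightarrow> 0 + 0" using assms(4,5) by (rule tendsto_add)
  moreover have "\<parallel>l \<ominus> m\<parallel> \<le> \<parallel>s n \<ominus> l\<parallel> + \<parallel>s n \<ominus> m\<parallel>" for n
    using norm_diff_triangle[of l "s n" m] s assms(2,3) norm_commute[of l "s n"] by simp
  ultimately have "\<parallel>l \<ominus> m\<parallel> \<le> 0 + 0" by (intro LIMSEQ_le_const) auto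
  then have "l \<ominus> m = \<zero>" using norm_eq_zero[of "l \<ominus> m"] norm_nonneg[of "l \<ominus> m"] assms by simp
  moreover have "l = (l \<ominus> m) \<oplus> m" using assms(2,3) by algebra
  ultimately show ?thesis using assms(3) by simp
qed

text \<open>If \<open>x\<close> is a self-adjoint contraction, then \<open>1 - x\<close> is the square of \<open>1 - z\<close>, where \<open>z\<close> is the
  limit of the iteration \<open>z\<^sub>0 = 0\<close>, \<open>z\<^sub>n\<^sub>+\<^sub>1 = (x + z\<^sub>n\<^sup>2) / 2\<close>. Its increments are dominated by
  those of the scalar iteration with \<open>x = 1\<close>.\<close>

lemma sqrt_one_minus:
  assumes x: "x \<in> carrier A" and sa: "x\<^sup>\<star> = x" and le: "\<parallel>x\<parallel> \<le> 1"
  obtains z where "z \<in> carrier A" "z\<^sup>\<star> = z" "\<parallel>z\<parallel> \<le> 1" "2 *\<^sub>C z = x \<oplus> z \<otimes> z"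
    "\<And>c. c \<in> carrier A \<Longrightarrow> c \<otimes> x = x \<otimes> c \<Longrightarrow> c \<otimes> z = z \<otimes> c"
proof -
  define y where "y = rec_nat \<zero> (\<lambda>_ u. (1/2) *\<^sub>C (x \<oplus> u \<otimes> u))"
  define t where "t = rec_nat (0::real) (\<lambda>_ u. (1 + u\<^sup>2) / 2)"
  have y0: "y 0 = \<zero>" and yS: "\<And>n. y (Suc n) = (1/2) *\<^sub>C (x \<oplus> y n \<otimes> y n)"
    by (simp_all add: y_def)
  have t0: "t 0 = 0" and tS: "\<And>n. t (Suc n) = (1 + (t n)\<^sup>2) / 2" by (simp_all add: t_def)
  have y [simp]: "y n \<in> carrier A" for n by (induction n) (simp_all add: y0 yS x cl)
  have t: "0 \<le> t n \<and> t n \<le> 1" for n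
    by (induction n) (auto simp: t0 tS power_le_one)
  have ysa: "(y n)\<^sup>\<star> = y n" for n
    by (induction n) (simp_all add: y0 yS x sa adj_scale adj_add adj_mult cl)
  have yt: "\<parallel>y n\<parallel> \<le> t n" for n
  proof (induction n)
    case (Suc n)
    have "\<parallel>x \<oplus> y n \<otimes> y n\<parallel> \<le> \<parallel>x\<parallel> + \<parallel>y n \<otimes> y n\<parallel>" by (rule norm_triangle) (simp_all add: x)
    also have "\<parallel>y n \<otimes> y n\<parallel> \<le> t n * t n"
      by (rule order_trans[OF norm_mult mult_mono]) (use Suc t in \<open>auto intro: norm_nonneg\<close>)
    finally show ?case using le by (simp add: yS tS norm_scale x power2_eq_square)
  qed (simp add: y0 t0)
  have step: "\<parallel>y (Suc n) \<ominus> y n\<parallel> \<le> t (Suc n) - t n" for n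
  proof (induction n)
    case 0
    show ?case using le by (simp add: y0 yS t0 tS minus_eq cl x norm_scale)
  next
    case (Suc n)
    let ?a = "y (Suc n)" and ?b = "y n"
    define P where "P = t (Suc n) * (t (Suc n) - t n)"
    define Q where "Q = (t (Suc n) - t n) * t n"
    have "y (Suc (Suc n)) \<ominus> y (Suc n) = (1/2) *\<^sub>C ((x \<oplus> ?a \<otimes> ?a) \<ominus> (x \<oplus> ?b \<otimes> ?b))"
      unfolding yS[of "Suc n"] yS[of n] by (subst scale_diff) (simp_all add: x cl)
    also have "(x \<oplus> ?a \<otimes> ?a) \<ominus> (x \<oplus> ?b \<otimes> ?b) = ?a \<otimes> (?a \<ominus> ?b) \<oplus> (?a \<ominus> ?b) \<otimes> ?b"
      using x y[of "Suc n"] y[of n] by algebra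
    finally have "\<parallel>y (Suc (Suc n)) \<ominus> y (Suc n)\<parallel> = \<parallel>?a \<otimes> (?a \<ominus> ?b) \<oplus> (?a \<ominus> ?b) \<otimes> ?b\<parallel> / 2"
      by (simp add: norm_scale)
    moreover have "\<parallel>?a \<otimes> (?a \<ominus> ?b) \<oplus> (?a \<ominus> ?b) \<otimes> ?b\<parallel>
        \<le> \<parallel>?a \<otimes> (?a \<ominus> ?b)\<parallel> + \<parallel>(?a \<ominus> ?b) \<otimes> ?b\<parallel>" by (rule norm_triangle) simp_all
    moreover have "\<parallel>?a \<otimes> (?a \<ominus> ?b)\<parallel> \<le> P"
      unfolding P_def by (rule order_trans[OF norm_mult mult_mono]) (use Suc t yt in \<open>auto intro: norm_nonneg\<close>)
    moreover have "\<parallel>(?a \<ominus> ?b) \<otimes> ?b\<parallel> \<le> Q"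
      unfolding Q_def using Suc t[of n] yt[of n] norm_nonneg[of "?a \<ominus> ?b"]
      by (intro order_trans[OF norm_mult mult_mono]) (auto intro: norm_nonneg)
    moreover have "t (Suc (Suc n)) - t (Suc n) =
        (P + Q) / 2"
      unfolding P_def Q_def tS[of "Suc n"] using tS[of n] by (simp add: field_simps power2_eq_square)
    ultimately show ?case by argo
  qed
  have tmono: "t n \<le> t (Suc n)" for n using step[of n] norm_nonneg[of "y (Suc n) \<ominus> y n"] by simp
  have dist: "\<parallel>y (n + k) \<ominus> y n\<parallel> \<le> t (n + k) - t n" for n k
  proof (induction k)
    case 0 then show ?case by (simp add: minus_eq r_neg)
  next
    case (Suc k)
    then show ?case using norm_diff_triangle[of "y (n + Suc k)" "y (n + k)" "y n"] step[of "n + k"] by simp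
  qed
  have dist': "\<parallel>y m \<ominus> y n\<parallel> \<le> \<bar>t m - t n\<bar>" for m n
  proof (cases "n \<le> m")
    case True then show ?thesis using dist[of n "m - n"] by simp
  next
    case False then show ?thesis using dist[of m "n - m"] norm_commute[of "y m" "y n"] by simp
  qed
  have "incseq t" using tmono by (simp add: incseq_SucI)
  then obtain L where "t \<longlonglongrightarrow> L" using t by (metis incseq_convergent)
  then have "Cauchy t" by (rule LIMSEQ_imp_Cauchy)
  then have "\<exists>N. \<forall>m\<ge>N. \<forall>n\<ge>N. \<parallel>y m \<ominus> y n\<parallel> < e" if "e > 0" for e
    using CauchyD[of t e] that dist' by (metis order_le_less_trans real_norm_def)
  then obtain z where z: "z \<in> carrier A" and lim: "(\<lambda>n. \<parallel>y n \<ominus> z\<parallel>) \<longlonglongrightarrow> 0"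
    using complete[of y] by (auto simp: image_subset_iff)
  have lim0: "(\<lambda>n. K * \<parallel>y n \<ominus> z\<parallel>) \<longlonglongrightarrow> 0" for K using tendsto_mult[OF tendsto_const lim] by simp
  have zsa: "z\<^sup>\<star> = z"
  proof (rule limit_unique[of y])
    have "\<parallel>y n \<ominus> z\<^sup>\<star>\<parallel> = \<parallel>y n \<ominus> z\<parallel>" for n
      using norm_adj[of "y n \<ominus> z"] z by (simp add: adj_diff ysa)
    then show "(\<lambda>n. \<parallel>y n \<ominus> z\<^sup>\<star>\<parallel>) \<longlonglongrightarrow> 0" using lim by simp
  qed (use z lim in \<open>auto simp: cl\<close>)
  have zle: "\<parallel>z\<parallel> \<le> 1"
  proof (rule LIMSEQ_le_const)
    show "(\<lambda>n. \<parallel>y n \<ominus> z\<parallel> + 1) \<longlonglongrightarrow> 1" using tendsto_add[OF lim tendsto_const[of 1]] by simp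
    have "\<parallel>z\<parallel> \<le> \<parallel>y n \<ominus> z\<parallel> + 1" for n
      using norm_le_diff[of z "y n"] norm_commute[of z "y n"] z yt[of n] t[of n] y[of n] by linarith
    then show "\<exists>N. \<forall>n\<ge>N. \<parallel>z\<parallel> \<le> \<parallel>y n \<ominus> z\<parallel> + 1" by blast
  qed
  have fix2: "2 *\<^sub>C z = x \<oplus> z \<otimes> z"
  proof -
    have "(1/2) *\<^sub>C (x \<oplus> z \<otimes> z) = z"
    proof (rule limit_unique[of "\<lambda>n. y (Suc n)"])
      have "\<parallel>y (Suc n) \<ominus> (1/2) *\<^sub>C (x \<oplus> z \<otimes> z)\<parallel> \<le> 1 * \<parallel>y n \<ominus> z\<parallel>" for n
      proof -
        have "y (Suc n) \<ominus> (1/2) *\<^sub>C (x \<oplus> z \<otimes> z) = (1/2) *\<^sub>C ((x \<oplus> y n \<otimes> y n) \<ominus> (x \<oplus> z \<otimes> z))"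
          unfolding yS by (subst scale_diff) (simp_all add: x z)
        also have "(x \<oplus> y n \<otimes> y n) \<ominus> (x \<oplus> z \<otimes> z) = y n \<otimes> (y n \<ominus> z) \<oplus> (y n \<ominus> z) \<otimes> z"
          using x z y[of n] by algebra
        finally have "\<parallel>y (Suc n) \<ominus> (1/2) *\<^sub>C (x \<oplus> z \<otimes> z)\<parallel>
            = \<parallel>y n \<otimes> (y n \<ominus> z) \<oplus> (y n \<ominus> z) \<otimes> z\<parallel> / 2" using z by (simp add: norm_scale)
        moreover have "\<parallel>y n \<otimes> (y n \<ominus> z) \<oplus> (y n \<ominus> z) \<otimes> z\<parallel>
            \<le> \<parallel>y n \<otimes> (y n \<ominus> z)\<parallel> + \<parallel>(y n \<ominus> z) \<otimes> z\<parallel>" using z by (intro norm_triangle) simp_all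
        moreover have "\<parallel>y n \<otimes> (y n \<ominus> z)\<parallel> \<le> 1 * \<parallel>y n \<ominus> z\<parallel>"
          by (rule order_trans[OF norm_mult mult_mono])
            (use yt[of n] t[of n] z in \<open>auto intro: norm_nonneg\<close>)
        moreover have "\<parallel>(y n \<ominus> z) \<otimes> z\<parallel> \<le> \<parallel>y n \<ominus> z\<parallel> * 1"
          by (rule order_trans[OF norm_mult mult_mono]) (use z zle in \<open>auto intro: norm_nonneg\<close>)
        ultimately show ?thesis by simp
      qed
      then show "(\<lambda>n. \<parallel>y (Suc n) \<ominus> (1/2) *\<^sub>C (x \<oplus> z \<otimes> z)\<parallel>) \<longlonglongrightarrow> 0"
        by (intro tendsto_sandwich[OF _ _ tendsto_const lim0[of 1]])
          (auto intro!: always_eventually norm_nonneg minus_closed simp: cl x z simp del: mult_1)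
      show "(\<lambda>n. \<parallel>y (Suc n) \<ominus> z\<parallel>) \<longlonglongrightarrow> 0" using lim by (rule LIMSEQ_Suc)
    qed (use z x in \<open>auto simp: cl\<close>)
    then have "2 *\<^sub>C z = 2 *\<^sub>C (1/2) *\<^sub>C (x \<oplus> z \<otimes> z)" by simp
    also have "\<dots> = x \<oplus> z \<otimes> z" using x z by (subst scale_scale) (simp_all add: scale_one)
    finally show ?thesis .
  qed
  have "c \<otimes> z = z \<otimes> c" if c: "c \<in> carrier A" and cx: "c \<otimes> x = x \<otimes> c" for c
  proof (rule limit_unique[of "\<lambda>n. c \<otimes> y n"])
    have cy: "c \<otimes> y n = y n \<otimes> c" for n
    proof (induction n)
      case (Suc n)
      have "c \<otimes> (y n \<otimes> y n) = (y n \<otimes> y n) \<otimes> c"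
        using Suc c y[of n] by (metis m_assoc)
      then show ?case using c x cx
        by (simp add: yS mult_scale_left mult_scale_right l_distr r_distr)
    qed (simp add: y0 c)
    have "\<parallel>c \<otimes> y n \<ominus> c \<otimes> z\<parallel> \<le> \<parallel>c\<parallel> * \<parallel>y n \<ominus> z\<parallel>" for n
    proof -
      have "c \<otimes> y n \<ominus> c \<otimes> z = c \<otimes> (y n \<ominus> z)" using c z y[of n] by algebra
      then show ?thesis using norm_mult[of c "y n \<ominus> z"] c z by simp
    qed
    then show "(\<lambda>n. \<parallel>c \<otimes> y n \<ominus> c \<otimes> z\<parallel>) \<longlonglongrightarrow> 0"
      by (intro tendsto_sandwich[OF _ _ tendsto_const lim0[of "\<parallel>c\<parallel>"]])
        (auto intro!: always_eventually norm_nonneg minus_closed simp: c z)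
    have "\<parallel>c \<otimes> y n \<ominus> z \<otimes> c\<parallel> \<le> \<parallel>c\<parallel> * \<parallel>y n \<ominus> z\<parallel>" for n
    proof -
      have "c \<otimes> y n \<ominus> z \<otimes> c = (y n \<ominus> z) \<otimes> c" unfolding cy using c z y[of n] by algebra
      then show ?thesis using norm_mult[of "y n \<ominus> z" c] c z by (simp add: mult.commute)
    qed
    then show "(\<lambda>n. \<parallel>c \<otimes> y n \<ominus> z \<otimes> c\<parallel>) \<longlonglongrightarrow> 0"
      by (intro tendsto_sandwich[OF _ _ tendsto_const lim0[of "\<parallel>c\<parallel>"]])
        (auto intro!: always_eventually norm_nonneg minus_closed simp: c z)
  qed (use c z in auto)
  with that z zsa zle fix2 show thesis by blast
qed

text \<open>Every C*-seminorm on a C*-algebra is dominated by the norm.\<close>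

lemma seminorm_le_norm:
  assumes q_add: "\<And>x y. x \<in> carrier A \<Longrightarrow> y \<in> carrier A \<Longrightarrow> q (x \<oplus> y) \<le> q x + q y"
    and q_scale: "\<And>c x. x \<in> carrier A \<Longrightarrow> q (c *\<^sub>C x) = cmod c * q x"
    and q_mult: "\<And>x y. x \<in> carrier A \<Longrightarrow> y \<in> carrier A \<Longrightarrow> q (x \<otimes> y) \<le> q x * q y"
    and q_star: "\<And>x. x \<in> carrier A \<Longrightarrow> q (x\<^sup>\<star> \<otimes> x) = (q x)\<^sup>2"
    and x: "x \<in> carrier A"
  shows "q x \<le> \<parallel>x\<parallel>"
proof -
  have q0: "q \<zero> = 0" using q_scale[of \<zero> 0] by (simp add: scale_zero_left)
  have qn: "q u \<ge> 0" if "u \<in> carrier A" for u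
    using q_add[of u "\<ominus> u"] q_scale[of u "- 1"] that by (simp add: r_neg q0 scale_minus_one)
  have q1: "q \<one> \<le> 1"
  proof -
    have "q \<one> * q \<one> = q \<one>" using q_star[of \<one>] by (simp add: power2_eq_square)
    then have "q \<one> = 0 \<or> q \<one> = 1" by simp
    then show ?thesis by auto
  qed
  have q_unit: "q u \<le> 1" if "u \<in> carrier A" "u\<^sup>\<star> \<otimes> u = \<one>" for u
  proof -
    have "(q u)\<^sup>2 \<le> 1" using q_star[OF that(1)] that(2) q1 by simp
    then show ?thesis by (simp add: abs_square_le_1)
  qed
  have sa1: "q h \<le> 1" if h: "h \<in> carrier A" "h\<^sup>\<star> = h" "\<parallel>h\<parallel> \<le> 1" for h
  proof -
    have "\<parallel>h \<otimes> h\<parallel> \<le> 1" using norm_mult[OF h(1) h(1)] h(3) norm_nonneg[OF h(1)]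
      by (meson mult_le_one order_trans)
    moreover have "h \<otimes> h \<in> carrier A" "(h \<otimes> h)\<^sup>\<star> = h \<otimes> h" using h by (simp_all add: adj_mult)
    ultimately obtain z where z: "z \<in> carrier A" "z\<^sup>\<star> = z" "2 *\<^sub>C z = h \<otimes> h \<oplus> z \<otimes> z"
      and comm: "\<And>c. c \<in> carrier A \<Longrightarrow> c \<otimes> (h \<otimes> h) = (h \<otimes> h) \<otimes> c \<Longrightarrow> c \<otimes> z = z \<otimes> c"
      using sqrt_one_minus[of "h \<otimes> h"] by metis
    have hz: "h \<otimes> z = z \<otimes> h" using comm[of h] h by (simp add: m_assoc)
    define k where "k = \<one> \<ominus> z"
    have k: "k \<in> carrier A" "k\<^sup>\<star> = k" using z by (simp_all add: k_def adj_diff)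
    have hk: "h \<otimes> k = k \<otimes> h"
    proof -
      have "h \<otimes> k = h \<ominus> h \<otimes> z" unfolding k_def using h z by (simp add: ring_simprules)
      also have "\<dots> = h \<ominus> z \<otimes> h" by (simp add: hz)
      also have "\<dots> = k \<otimes> h" unfolding k_def using h z by (simp add: ring_simprules)
      finally show ?thesis .
    qed
    have "k \<otimes> k = (\<one> \<oplus> z \<otimes> z) \<ominus> (z \<oplus> z)" unfolding k_def using z(1) by (simp add: ring_simprules)
    also have "z \<oplus> z = h \<otimes> h \<oplus> z \<otimes> z"
      using scale_left_distrib[of z 1 1] z by (simp add: scale_one)
    finally have sq: "h \<otimes> h \<oplus> k \<otimes> k = \<one>" using h z(1) by algebra
    have unit: "(h \<oplus> c *\<^sub>C k)\<^sup>\<star> \<otimes> (h \<oplus> c *\<^sub>C k) = \<one>" if c: "cnj c = - c" "c * c = - 1" for c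
    proof -
      let ?w = "c *\<^sub>C k"
      have w: "?w \<in> carrier A" using k by (simp add: cl)
      have ws: "?w\<^sup>\<star> = \<ominus> ?w"
        using k c by (simp add: adj_scale scale_scale cl flip: scale_minus_one)
      have ww: "?w \<otimes> ?w = \<ominus> (k \<otimes> k)"
        using k c by (simp add: mult_scale_left mult_scale_right scale_scale cl flip: scale_minus_one)
      have hw: "h \<otimes> ?w = ?w \<otimes> h" using h k hk by (simp add: mult_scale_left mult_scale_right)
      have "(h \<oplus> ?w)\<^sup>\<star> \<otimes> (h \<oplus> ?w) = (h \<ominus> ?w) \<otimes> (h \<oplus> ?w)"
        using h w ws by (simp add: adj_add minus_eq)
      also have "\<dots> = (h \<otimes> h \<ominus> ?w \<otimes> ?w) \<oplus> (h \<otimes> ?w \<ominus> ?w \<otimes> h)" using h w by algebra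
      also have "\<dots> = h \<otimes> h \<oplus> k \<otimes> k" unfolding hw ww using h k w by algebra
      finally show ?thesis using sq by simp
    qed
    have "2 *\<^sub>C h = (h \<oplus> \<i> *\<^sub>C k) \<oplus> (h \<oplus> (- \<i>) *\<^sub>C k)"
    proof -
      have "(h \<oplus> \<i> *\<^sub>C k) \<oplus> (h \<oplus> (- \<i>) *\<^sub>C k) = (h \<oplus> h) \<oplus> (\<i> *\<^sub>C k \<oplus> (- \<i>) *\<^sub>C k)"
        using h k scale_closed[of k \<i>] scale_closed[of k "- \<i>"] by algebra
      also have "\<i> *\<^sub>C k \<oplus> (- \<i>) *\<^sub>C k = \<zero>"
        using k by (simp add: scale_zero_left flip: scale_left_distrib)
      finally show ?thesis using h scale_left_distrib[of h 1 1] by (simp add: scale_one)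
    qed
    then have "2 * q h \<le> q (h \<oplus> \<i> *\<^sub>C k) + q (h \<oplus> (- \<i>) *\<^sub>C k)"
      using q_add[of "h \<oplus> \<i> *\<^sub>C k" "h \<oplus> (- \<i>) *\<^sub>C k"] q_scale[of h 2] h k by (simp add: cl)
    moreover have "q (h \<oplus> \<i> *\<^sub>C k) \<le> 1" "q (h \<oplus> (- \<i>) *\<^sub>C k) \<le> 1"
      using h k by (auto intro!: q_unit unit simp: cl)
    ultimately show ?thesis by linarith
  qed
  have sa: "q h \<le> \<parallel>h\<parallel>" if h: "h \<in> carrier A" "h\<^sup>\<star> = h" for h
  proof (cases "\<parallel>h\<parallel> = 0")
    case True then show ?thesis using h q0 by (simp add: norm_eq_zero)
  next
    case False
    then have pos: "\<parallel>h\<parallel> > 0" using norm_nonneg[OF h(1)] by simp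
    let ?c = "complex_of_real (1 / \<parallel>h\<parallel>)"
    have "q (?c *\<^sub>C h) \<le> 1"
      by (rule sa1) (use h pos in \<open>auto simp: cl adj_scale norm_scale norm_divide\<close>)
    then show ?thesis using pos by (simp add: q_scale h norm_divide field_simps)
  qed
  have "(q x)\<^sup>2 \<le> \<parallel>x\<parallel>\<^sup>2"
    using sa[of "x\<^sup>\<star> \<otimes> x"] x by (simp add: q_star cstar_identity adj_mult adj_adj cl)
  then show ?thesis using norm_nonneg[OF x] by (rule power2_le_imp_le)
qed

end

lemma star_hom_contractive:
  assumes A: "unital_cstar_algebra A" and B: "unital_cstar_algebra B" and f: "star_hom A B f"
    and x: "x \<in> carrier A"
  shows "\<parallel>f x\<parallel>\<^bsub>B\<^esub> \<le> \<parallel>x\<parallel>\<^bsub>A\<^esub>"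
proof -
  interpret A: unital_cstar_algebra A by (rule A)
  interpret B: unital_cstar_algebra B by (rule B)
  have c: "f u \<in> carrier B" if "u \<in> carrier A" for u using f that by (auto simp: star_hom_def)
  show ?thesis
  proof (rule A.seminorm_le_norm[where q = "\<lambda>u. \<parallel>f u\<parallel>\<^bsub>B\<^esub>", OF _ _ _ _ x])
    fix u v assume uv: "u \<in> carrier A" "v \<in> carrier A"
    then show "\<parallel>f (u \<oplus>\<^bsub>A\<^esub> v)\<parallel>\<^bsub>B\<^esub> \<le> \<parallel>f u\<parallel>\<^bsub>B\<^esub> + \<parallel>f v\<parallel>\<^bsub>B\<^esub>"
      and "\<parallel>f (u \<otimes>\<^bsub>A\<^esub> v)\<parallel>\<^bsub>B\<^esub> \<le> \<parallel>f u\<parallel>\<^bsub>B\<^esub> * \<parallel>f v\<parallel>\<^bsub>B\<^esub>"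
      using f c by (auto simp: star_hom_def B.norm_triangle B.norm_mult)
  next
    fix u assume u: "u \<in> carrier A"
    then have "f (u\<^sup>\<star>\<^bsub>A\<^esub> \<otimes>\<^bsub>A\<^esub> u) = (f u)\<^sup>\<star>\<^bsub>B\<^esub> \<otimes>\<^bsub>B\<^esub> f u"
      using f A.adj_closed[OF u] by (simp add: star_hom_def)
    then show "\<parallel>f (u\<^sup>\<star>\<^bsub>A\<^esub> \<otimes>\<^bsub>A\<^esub> u)\<parallel>\<^bsub>B\<^esub> = \<parallel>f u\<parallel>\<^bsub>B\<^esub>\<^sup>2" using c[OF u] by (simp add: B.cstar_identity)
    show "\<parallel>f (k *\<^sub>C\<^bsub>A\<^esub> u)\<parallel>\<^bsub>B\<^esub> = cmod k * \<parallel>f u\<parallel>\<^bsub>B\<^esub>" for k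
      using f u c by (simp add: star_hom_def B.norm_scale)
  qed
qed


subsection \<open>The universal algebra is a unital C*-algebra\<close>

lemma null_comparison: "(\<And>n. \<bar>g n\<bar> \<le> f n) \<Longrightarrow> f \<longlonglongrightarrow> 0 \<Longrightarrow> g \<longlonglongrightarrow> (0::real)"
  for f g :: "nat \<Rightarrow> real"
  by (rule tendsto_0_le[of f _ g 1]) (auto intro!: always_eventually order_trans[OF _ abs_ge_self])

locale admissible_relations =
  fixes R :: "'g star_poly set"
  assumes admissible: "admissible R"
begin

abbreviation N where "N \<equiv> univ_norm R"
abbreviation cls where "cls \<equiv> seq_class R"
abbreviation U where "U \<equiv> univ_cstar R"

lemmas sn = univ_norm_seminorm[OF admissible]
lemmas N_add = seminorm_add[OF sn] and N_scale = seminorm_scale[OF sn] and N_mult = seminorm_mult[OF sn]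
  and N_star = seminorm_adj_mult[OF sn] and N_zero [simp] = seminorm_zero[OF sn]
  and N_minus = seminorm_minus[OF sn] and N_nonneg [simp] = seminorm_nonneg[OF sn]
  and N_commute = seminorm_commute[OF sn] and N_triangle = seminorm_triangle[OF sn]
  and N_reverse = seminorm_reverse[OF sn] and N_adj = seminorm_adj[OF sn]

lemma N_mult_diff: "N (a * b - c * d) \<le> N a * N (b - d) + N (a - c) * N d"
proof -
  have "a * b - c * d = a * (b - d) + (a - c) * d" by (simp add: algebra_simps)
  then show ?thesis using N_add[of "a * (b - d)" "(a - c) * d"] N_mult[of a "b - d"] N_mult[of "a - c" d]
    by simp
qed

definition null :: "(nat \<Rightarrow> 'g star_poly) \<Rightarrow> (nat \<Rightarrow> 'g star_poly) \<Rightarrow> bool" where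
  "null x y \<longleftrightarrow> (\<lambda>n. N (x n - y n)) \<longlonglongrightarrow> 0"

lemma nullI: "(\<And>n. N (x n - y n) \<le> f n) \<Longrightarrow> f \<longlonglongrightarrow> 0 \<Longrightarrow> null x y"
  unfolding null_def by (rule null_comparison[of _ f]) simp_all

lemma null_refl [simp]: "null x x" by (simp add: null_def)

lemma null_sym: "null x y \<Longrightarrow> null y x" by (simp add: null_def N_commute)

lemma null_trans: assumes "null x y" "null y z" shows "null x z"
proof (rule nullI)
  show "(\<lambda>n. N (x n - y n) + N (y n - z n)) \<longlonglongrightarrow> 0"
    using tendsto_add[OF assms[unfolded null_def]] by simp
qed (rule N_triangle)

lemma cauchy_iff: "x \<in> cauchy_seqs R \<longleftrightarrow> (\<forall>e>0. \<exists>M. \<forall>m\<ge>M. \<forall>n\<ge>M. N (x m - x n) < e)"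
  by (simp add: cauchy_seqs_def)

lemma cauchy_const [simp]: "(\<lambda>n. c) \<in> cauchy_seqs R" by (simp add: cauchy_iff)

lemma cauchy_norm: assumes "x \<in> cauchy_seqs R" shows "convergent (\<lambda>n. N (x n))"
proof -
  have "Cauchy (\<lambda>n. N (x n))"
  proof (rule CauchyI)
    fix e :: real assume "e > 0"
    then obtain M where "\<forall>m\<ge>M. \<forall>n\<ge>M. N (x m - x n) < e" using assms cauchy_iff by blast
    then show "\<exists>M. \<forall>m\<ge>M. \<forall>n\<ge>M. norm (N (x m) - N (x n)) < e"
      using N_reverse by (metis order_le_less_trans real_norm_def)
  qed
  then show ?thesis by (rule Cauchy_convergent)
qed

lemma cauchy_bounded: assumes "x \<in> cauchy_seqs R" obtains K where "K > 0" "\<And>n. N (x n) \<le> K"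
proof -
  have "Bseq (\<lambda>n. N (x n))" using cauchy_norm[OF assms] by (rule convergent_imp_Bseq)
  then obtain K where "K > 0" "\<forall>n. norm (N (x n)) \<le> K" by (rule BseqE)
  then show thesis using that by simp
qed

lemma cauchy_add: assumes x: "x \<in> cauchy_seqs R" and y: "y \<in> cauchy_seqs R"
  shows "(\<lambda>n. x n + y n) \<in> cauchy_seqs R"
  unfolding cauchy_iff
proof (intro allI impI)
  fix e :: real assume e: "e > 0"
  obtain M where M: "\<And>m n. m \<ge> M \<Longrightarrow> n \<ge> M \<Longrightarrow> N (x m - x n) < e / 2"
    using x e unfolding cauchy_iff by (meson half_gt_zero)
  obtain M' where M': "\<And>m n. m \<ge> M' \<Longrightarrow> n \<ge> M' \<Longrightarrow> N (y m - y n) < e / 2"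
    using y e unfolding cauchy_iff by (meson half_gt_zero)
  have "N (x m + y m - (x n + y n)) < e" if "m \<ge> max M M'" "n \<ge> max M M'" for m n
  proof -
    have "x m + y m - (x n + y n) = (x m - x n) + (y m - y n)" by simp
    then have "N (x m + y m - (x n + y n)) \<le> N (x m - x n) + N (y m - y n)" by (simp only: N_add)
    then show ?thesis using M[of m n] M'[of m n] that by simp
  qed
  then show "\<exists>M. \<forall>m\<ge>M. \<forall>n\<ge>M. N (x m + y m - (x n + y n)) < e" by blast
qed

lemma cauchy_mult: assumes x: "x \<in> cauchy_seqs R" and y: "y \<in> cauchy_seqs R"
  shows "(\<lambda>n. x n * y n) \<in> cauchy_seqs R"
  unfolding cauchy_iff
proof (intro allI impI)
  fix e :: real assume e: "e > 0"
  obtain K where K: "K > 0" "\<And>n. N (x n) \<le> K" using cauchy_bounded[OF x] by metis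
  obtain L where L: "L > 0" "\<And>n. N (y n) \<le> L" using cauchy_bounded[OF y] by metis
  have "e / (2 * L) > 0" using e L by simp
  then obtain M where M: "\<And>m n. m \<ge> M \<Longrightarrow> n \<ge> M \<Longrightarrow> N (x m - x n) < e / (2 * L)"
    using x unfolding cauchy_iff by meson
  have "e / (2 * K) > 0" using e K by simp
  then obtain M' where M': "\<And>m n. m \<ge> M' \<Longrightarrow> n \<ge> M' \<Longrightarrow> N (y m - y n) < e / (2 * K)"
    using y unfolding cauchy_iff by meson
  have "N (x m * y m - x n * y n) < e" if "m \<ge> max M M'" "n \<ge> max M M'" for m n
  proof -
    have "N (x m) * N (y m - y n) \<le> K * N (y m - y n)" using K by (intro mult_right_mono) auto
    moreover have "K * N (y m - y n) < e / 2" using M'[of m n] that K by (simp add: field_simps)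
    moreover have "N (x m - x n) * N (y n) \<le> N (x m - x n) * L" using L by (intro mult_left_mono) auto
    moreover have "N (x m - x n) * L < e / 2" using M[of m n] that L by (simp add: field_simps)
    ultimately show ?thesis using N_mult_diff[of "x m" "y m" "x n" "y n"] by linarith
  qed
  then show "\<exists>M. \<forall>m\<ge>M. \<forall>n\<ge>M. N (x m * y m - x n * y n) < e" by blast
qed

lemma cauchy_scale: assumes x: "x \<in> cauchy_seqs R" shows "(\<lambda>n. poly_scale c (x n)) \<in> cauchy_seqs R"
  using cauchy_mult[OF cauchy_const[of "Poly_Mapping.single 0 c"] x] by (simp add: poly_scale_def)

lemma cauchy_adj: assumes x: "x \<in> cauchy_seqs R" shows "(\<lambda>n. poly_adj (x n)) \<in> cauchy_seqs R"
  using x by (simp add: cauchy_iff N_adj flip: poly_adj_diff)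

lemma null_add: assumes "null x x'" "null y y'" shows "null (\<lambda>n. x n + y n) (\<lambda>n. x' n + y' n)"
proof (rule nullI)
  fix n
  have "x n + y n - (x' n + y' n) = (x n - x' n) + (y n - y' n)" by simp
  then show "N (x n + y n - (x' n + y' n)) \<le> N (x n - x' n) + N (y n - y' n)" by (simp only: N_add)
next
  show "(\<lambda>n. N (x n - x' n) + N (y n - y' n)) \<longlonglongrightarrow> 0"
    using tendsto_add[OF assms[unfolded null_def]] by simp
qed

lemma null_mult:
  assumes x: "x \<in> cauchy_seqs R" and y: "y' \<in> cauchy_seqs R" and n: "null x x'" "null y y'"
  shows "null (\<lambda>n. x n * y n) (\<lambda>n. x' n * y' n)"
proof -
  obtain K where K: "\<And>n. N (x n) \<le> K" using cauchy_bounded[OF x] by metis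
  obtain L where L: "\<And>n. N (y' n) \<le> L" using cauchy_bounded[OF y] by metis
  show ?thesis
  proof (rule nullI)
    fix n
    show "N (x n * y n - x' n * y' n) \<le> K * N (y n - y' n) + N (x n - x' n) * L"
      by (rule order_trans[OF N_mult_diff add_mono[OF mult_right_mono mult_left_mono]]) (auto simp: K L)
  next
    show "(\<lambda>n. K * N (y n - y' n) + N (x n - x' n) * L) \<longlonglongrightarrow> 0"
      using tendsto_add[OF tendsto_mult[OF tendsto_const n(2)[unfolded null_def]]
          tendsto_mult[OF n(1)[unfolded null_def] tendsto_const], of K L] by simp
  qed
qed

lemma null_scale: "null x x' \<Longrightarrow> null (\<lambda>n. poly_scale c (x n)) (\<lambda>n. poly_scale c (x' n))"
proof -
  assume n: "null x x'"
  have "(\<lambda>n. cmod c * N (x n - x' n)) \<longlonglongrightarrow> 0"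
    using tendsto_mult[OF tendsto_const n[unfolded null_def], of "cmod c"] by simp
  then show ?thesis by (simp add: null_def N_scale flip: poly_scale_diff)
qed

lemma null_adj: "null x x' \<Longrightarrow> null (\<lambda>n. poly_adj (x n)) (\<lambda>n. poly_adj (x' n))"
  by (simp add: null_def N_adj flip: poly_adj_diff)

lemma cls_eq_iff:
  assumes x: "x \<in> cauchy_seqs R" and y: "y \<in> cauchy_seqs R"
  shows "cls x = cls y \<longleftrightarrow> null x y"
proof
  assume "cls x = cls y"
  moreover have "y \<in> cls y" using y by (simp add: seq_class_def)
  ultimately have "y \<in> cls x" by simp
  then show "null x y" by (simp add: seq_class_def null_def)
next
  assume n: "null x y"
  have "null x z \<longleftrightarrow> null y z" for z using n null_trans null_sym by blast
  then show "cls x = cls y" by (simp add: seq_class_def null_def)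
qed

lemma rep_cls:
  assumes x: "x \<in> cauchy_seqs R" shows "rep (cls x) \<in> cauchy_seqs R" "null (rep (cls x)) x"
proof -
  have "x \<in> cls x" using x by (simp add: seq_class_def)
  then have "rep (cls x) \<in> cls x" using someI[of "\<lambda>y. y \<in> cls x" x] by (simp add: rep_def)
  then show "rep (cls x) \<in> cauchy_seqs R" "null (rep (cls x)) x"
    by (simp_all add: seq_class_def null_def N_commute)
qed

lemma carrier_univ: "carrier U = cls ` cauchy_seqs R" by (simp add: univ_cstar_def)

lemma cls_closed [simp]: "x \<in> cauchy_seqs R \<Longrightarrow> cls x \<in> carrier U" by (simp add: carrier_univ)

lemma univ_mult: "x \<in> cauchy_seqs R \<Longrightarrow> y \<in> cauchy_seqs R \<Longrightarrow>
    cls x \<otimes>\<^bsub>U\<^esub> cls y = cls (\<lambda>n. x n * y n)"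
  by (simp add: univ_cstar_def cls_eq_iff cauchy_mult rep_cls null_mult)

lemma univ_add: "x \<in> cauchy_seqs R \<Longrightarrow> y \<in> cauchy_seqs R \<Longrightarrow>
    cls x \<oplus>\<^bsub>U\<^esub> cls y = cls (\<lambda>n. x n + y n)"
  by (simp add: univ_cstar_def cls_eq_iff cauchy_add rep_cls null_add)

lemma univ_scale: "x \<in> cauchy_seqs R \<Longrightarrow> c *\<^sub>C\<^bsub>U\<^esub> cls x = cls (\<lambda>n. poly_scale c (x n))"
  by (simp add: univ_cstar_def cls_eq_iff cauchy_scale rep_cls null_scale)

lemma univ_adj: "x \<in> cauchy_seqs R \<Longrightarrow> (cls x)\<^sup>\<star>\<^bsub>U\<^esub> = cls (\<lambda>n. poly_adj (x n))"
  by (simp add: univ_cstar_def cls_eq_iff cauchy_adj rep_cls null_adj)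

lemma univ_one: "\<one>\<^bsub>U\<^esub> = cls (\<lambda>n. 1)" and univ_zero: "\<zero>\<^bsub>U\<^esub> = cls (\<lambda>n. 0)"
  by (simp_all add: univ_cstar_def)

lemma univ_norm_tendsto:
  assumes x: "x \<in> cauchy_seqs R" shows "(\<lambda>n. N (x n)) \<longlonglongrightarrow> \<parallel>cls x\<parallel>\<^bsub>U\<^esub>"
proof -
  let ?r = "rep (cls x)"
  have "(\<lambda>n. N (?r n)) \<longlonglongrightarrow> \<parallel>cls x\<parallel>\<^bsub>U\<^esub>"
    using cauchy_norm[OF rep_cls(1)[OF x]] by (simp add: univ_cstar_def convergent_LIMSEQ_iff)
  moreover have "(\<lambda>n. N (x n) - N (?r n)) \<longlonglongrightarrow> 0"
  proof (rule null_comparison)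
    show "(\<lambda>n. N (?r n - x n)) \<longlonglongrightarrow> 0" using rep_cls(2)[OF x] by (simp add: null_def)
    show "\<bar>N (x n) - N (?r n)\<bar> \<le> N (?r n - x n)" for n
      using N_reverse[of "x n" "?r n"] by (simp add: N_commute[of "?r _"])
  qed
  ultimately show ?thesis using tendsto_add[of "\<lambda>n. N (x n) - N (?r n)" 0 _ "\<lambda>n. N (?r n)"] by simp
qed

lemma univ_norm_eqI: "x \<in> cauchy_seqs R \<Longrightarrow> (\<lambda>n. N (x n)) \<longlonglongrightarrow> l \<Longrightarrow> \<parallel>cls x\<parallel>\<^bsub>U\<^esub> = l"
  using univ_norm_tendsto LIMSEQ_unique by blast

lemma univ_ring: "ring U"
proof (intro ring.intro ring_axioms.intro abelian_groupI)
  show "Group.monoid U"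
    by (rule monoidI) (auto simp: carrier_univ univ_mult univ_one cauchy_mult mult.assoc)
  show "\<exists>y\<in>carrier U. y \<oplus>\<^bsub>U\<^esub> x = \<zero>\<^bsub>U\<^esub>" if x: "x \<in> carrier U" for x
  proof -
    obtain s where s: "s \<in> cauchy_seqs R" "x = cls s" using x by (auto simp: carrier_univ)
    then show ?thesis using cauchy_scale[OF s(1), of "- 1"]
      by (intro bexI[of _ "cls (\<lambda>n. poly_scale (- 1) (s n))"])
        (simp_all add: univ_add univ_zero poly_scale_minus_one)
  qed
qed (auto simp: carrier_univ univ_mult univ_add univ_zero cauchy_mult cauchy_add algebra_simps)

lemma univ_minus:
  assumes x: "x \<in> cauchy_seqs R" and y: "y \<in> cauchy_seqs R"
  shows "cls x \<ominus>\<^bsub>U\<^esub> cls y = cls (\<lambda>n. x n - y n)"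
proof -
  interpret ring U by (rule univ_ring)
  have m: "(\<lambda>n. - y n) \<in> cauchy_seqs R" using cauchy_scale[OF y, of "- 1"] by (simp add: poly_scale_minus_one)
  have "cls (\<lambda>n. - y n) \<oplus>\<^bsub>U\<^esub> cls y = \<zero>\<^bsub>U\<^esub>" using m y by (simp add: univ_add univ_zero)
  then have "\<ominus>\<^bsub>U\<^esub> cls y = cls (\<lambda>n. - y n)" using m y by (intro minus_equality) auto
  then show ?thesis using x m by (simp add: minus_eq univ_add)
qed

lemma cauchy_diff: "x \<in> cauchy_seqs R \<Longrightarrow> y \<in> cauchy_seqs R \<Longrightarrow> (\<lambda>n. x n - y n) \<in> cauchy_seqs R"
  using cauchy_add[OF _ cauchy_scale[of y "- 1"], of x] by (simp add: poly_scale_minus_one)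

lemma univ_norm_const: "\<parallel>cls (\<lambda>n. c)\<parallel>\<^bsub>U\<^esub> = N c"
  by (rule univ_norm_eqI) simp_all

text \<open>Constant sequences are dense.\<close>

lemma const_dense:
  assumes s: "s \<in> cauchy_seqs R" and e: "e > 0"
  shows "\<exists>c. \<parallel>cls s \<ominus>\<^bsub>U\<^esub> cls (\<lambda>n. c)\<parallel>\<^bsub>U\<^esub> \<le> e"
proof -
  obtain M where M: "\<And>m n. m \<ge> M \<Longrightarrow> n \<ge> M \<Longrightarrow> N (s m - s n) < e" using s e unfolding cauchy_iff by meson
  have "\<parallel>cls (\<lambda>n. s n - s M)\<parallel>\<^bsub>U\<^esub> \<le> e"
    by (rule LIMSEQ_le_const2[OF univ_norm_tendsto[OF cauchy_diff[OF s cauchy_const]]])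
      (use M in \<open>auto intro!: exI[of _ M] less_imp_le\<close>)
  then show ?thesis using s by (intro exI[of _ "s M"]) (simp add: univ_minus)
qed

lemma univ_norm_diff_const:
  assumes c: "c \<in> cauchy_seqs R"
  shows "(\<lambda>k. \<parallel>cls (\<lambda>n. c k) \<ominus>\<^bsub>U\<^esub> cls c\<parallel>\<^bsub>U\<^esub>) \<longlonglongrightarrow> 0"
proof (rule LIMSEQ_I)
  fix e :: real assume e: "e > 0"
  obtain M where M: "\<And>m n. m \<ge> M \<Longrightarrow> n \<ge> M \<Longrightarrow> N (c m - c n) < e / 2"
    using c e unfolding cauchy_iff by (meson half_gt_zero)
  have "norm (\<parallel>cls (\<lambda>n. c k) \<ominus>\<^bsub>U\<^esub> cls c\<parallel>\<^bsub>U\<^esub> - 0) < e" if "k \<ge> M" for k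
  proof -
    have t: "(\<lambda>n. N (c k - c n)) \<longlonglongrightarrow> \<parallel>cls (\<lambda>n. c k) \<ominus>\<^bsub>U\<^esub> cls c\<parallel>\<^bsub>U\<^esub>"
      using univ_norm_tendsto[OF cauchy_diff[OF cauchy_const c]] c by (simp add: univ_minus)
    have "\<parallel>cls (\<lambda>n. c k) \<ominus>\<^bsub>U\<^esub> cls c\<parallel>\<^bsub>U\<^esub> \<le> e / 2"
      by (rule LIMSEQ_le_const2[OF t]) (use M that in \<open>auto intro!: exI[of _ M] less_imp_le\<close>)
    moreover have "\<parallel>cls (\<lambda>n. c k) \<ominus>\<^bsub>U\<^esub> cls c\<parallel>\<^bsub>U\<^esub> \<ge> 0"
      by (rule LIMSEQ_le_const[OF t]) auto
    ultimately show ?thesis using e by simp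
  qed
  then show "\<exists>M. \<forall>k\<ge>M. norm (\<parallel>cls (\<lambda>n. c k) \<ominus>\<^bsub>U\<^esub> cls c\<parallel>\<^bsub>U\<^esub> - 0) < e" by blast
qed

theorem univ_cstar_algebra: "unital_cstar_algebra U"
proof (rule unital_cstar_algebra.intro[OF univ_ring], unfold_locales)
  interpret ring U by (rule univ_ring)
  let ?C = "cauchy_seqs R"
  have obt: "\<exists>s\<in>?C. X = cls s" if "X \<in> carrier U" for X using that by (auto simp: carrier_univ)
  have triangle: "\<parallel>X \<oplus>\<^bsub>U\<^esub> Y\<parallel>\<^bsub>U\<^esub> \<le> \<parallel>X\<parallel>\<^bsub>U\<^esub> + \<parallel>Y\<parallel>\<^bsub>U\<^esub>"
    if X: "X \<in> carrier U" and Y: "Y \<in> carrier U" for X Y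
  proof -
    obtain x y where xy: "x \<in> ?C" "X = cls x" "y \<in> ?C" "Y = cls y" using obt[OF X] obt[OF Y] by blast
    have "(\<lambda>n. N (x n + y n)) \<longlonglongrightarrow> \<parallel>X \<oplus>\<^bsub>U\<^esub> Y\<parallel>\<^bsub>U\<^esub>"
      using univ_norm_tendsto[OF cauchy_add[of x y]] xy by (simp add: univ_add)
    then show ?thesis
      using tendsto_add[OF univ_norm_tendsto[of x] univ_norm_tendsto[of y]] xy
      by (intro LIMSEQ_le[of "\<lambda>n. N (x n + y n)"]) (auto simp: N_add)
  qed
  have scale: "\<parallel>c *\<^sub>C\<^bsub>U\<^esub> X\<parallel>\<^bsub>U\<^esub> = cmod c * \<parallel>X\<parallel>\<^bsub>U\<^esub>" if X: "X \<in> carrier U" for c X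
  proof -
    obtain x where x: "x \<in> ?C" "X = cls x" using obt[OF X] by blast
    then show ?thesis
      by (simp add: univ_scale)
        (rule univ_norm_eqI, simp_all add: cauchy_scale N_scale tendsto_mult univ_norm_tendsto)
  qed
  show "\<parallel>X \<oplus>\<^bsub>U\<^esub> Y\<parallel>\<^bsub>U\<^esub> \<le> \<parallel>X\<parallel>\<^bsub>U\<^esub> + \<parallel>Y\<parallel>\<^bsub>U\<^esub>" if "X \<in> carrier U" "Y \<in> carrier U" for X Y
    using triangle that .
  show "\<parallel>c *\<^sub>C\<^bsub>U\<^esub> X\<parallel>\<^bsub>U\<^esub> = cmod c * \<parallel>X\<parallel>\<^bsub>U\<^esub>" if "X \<in> carrier U" for c X using scale that .
  show "\<parallel>X \<otimes>\<^bsub>U\<^esub> Y\<parallel>\<^bsub>U\<^esub> \<le> \<parallel>X\<parallel>\<^bsub>U\<^esub> * \<parallel>Y\<parallel>\<^bsub>U\<^esub>"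
    if X: "X \<in> carrier U" and Y: "Y \<in> carrier U" for X Y
  proof -
    obtain x y where xy: "x \<in> ?C" "X = cls x" "y \<in> ?C" "Y = cls y" using obt[OF X] obt[OF Y] by blast
    have "(\<lambda>n. N (x n * y n)) \<longlonglongrightarrow> \<parallel>X \<otimes>\<^bsub>U\<^esub> Y\<parallel>\<^bsub>U\<^esub>"
      using univ_norm_tendsto[OF cauchy_mult[of x y]] xy by (simp add: univ_mult)
    then show ?thesis
      using tendsto_mult[OF univ_norm_tendsto[of x] univ_norm_tendsto[of y]] xy
      by (intro LIMSEQ_le[of "\<lambda>n. N (x n * y n)"]) (auto simp: N_mult)
  qed
  show "\<parallel>X\<^sup>\<star>\<^bsub>U\<^esub> \<otimes>\<^bsub>U\<^esub> X\<parallel>\<^bsub>U\<^esub> = \<parallel>X\<parallel>\<^bsub>U\<^esub>\<^sup>2" if X: "X \<in> carrier U" for X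
  proof -
    obtain x where x: "x \<in> ?C" "X = cls x" using obt[OF X] by blast
    then show ?thesis
      by (simp add: univ_adj univ_mult cauchy_adj)
        (rule univ_norm_eqI, simp_all add: cauchy_mult cauchy_adj N_star tendsto_power univ_norm_tendsto)
  qed
  show "\<parallel>X\<parallel>\<^bsub>U\<^esub> = 0 \<longleftrightarrow> X = \<zero>\<^bsub>U\<^esub>" if X: "X \<in> carrier U" for X
  proof -
    obtain x where x: "x \<in> ?C" "X = cls x" using obt[OF X] by blast
    have "X = \<zero>\<^bsub>U\<^esub> \<longleftrightarrow> (\<lambda>n. N (x n)) \<longlonglongrightarrow> 0" using x by (simp add: univ_zero cls_eq_iff null_def)
    also have "\<dots> \<longleftrightarrow> \<parallel>X\<parallel>\<^bsub>U\<^esub> = 0" using univ_norm_tendsto[OF x(1)] x(2) LIMSEQ_unique by force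
    finally show ?thesis by simp
  qed
  show "\<exists>l\<in>carrier U. (\<lambda>n. \<parallel>s n \<ominus>\<^bsub>U\<^esub> l\<parallel>\<^bsub>U\<^esub>) \<longlonglongrightarrow> 0"
    if s: "range s \<subseteq> carrier U"
      and cauchy: "\<forall>e>0. \<exists>M::nat. \<forall>m\<ge>M. \<forall>n\<ge>M. \<parallel>s m \<ominus>\<^bsub>U\<^esub> s n\<parallel>\<^bsub>U\<^esub> < e" for s
  proof -
    have sc: "s k \<in> carrier U" for k using s by blast
    have "\<exists>c. \<parallel>s k \<ominus>\<^bsub>U\<^esub> cls (\<lambda>n. c)\<parallel>\<^bsub>U\<^esub> \<le> 1 / real (Suc k)" for k
      using obt[OF sc[of k]] const_dense[of _ "1 / real (Suc k)"] by auto
    then obtain c where c: "\<And>k. \<parallel>s k \<ominus>\<^bsub>U\<^esub> cls (\<lambda>n. c k)\<parallel>\<^bsub>U\<^esub> \<le> 1 / real (Suc k)" by metis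
    let ?c = "\<lambda>k. cls (\<lambda>n. c k)"
    have cc: "?c k \<in> carrier U" for k by simp
    have neg: "\<parallel>X \<ominus>\<^bsub>U\<^esub> Y\<parallel>\<^bsub>U\<^esub> = \<parallel>Y \<ominus>\<^bsub>U\<^esub> X\<parallel>\<^bsub>U\<^esub>" if X: "X \<in> carrier U" and Y: "Y \<in> carrier U" for X Y
    proof -
      obtain x y where "x \<in> ?C" "X = cls x" "y \<in> ?C" "Y = cls y" using obt[OF X] obt[OF Y] by blast
      moreover have "\<parallel>cls (\<lambda>n. x n - y n)\<parallel>\<^bsub>U\<^esub> = \<parallel>cls (\<lambda>n. y n - x n)\<parallel>\<^bsub>U\<^esub>" 
        using calculation univ_norm_tendsto[OF cauchy_diff[of x y]] univ_norm_tendsto[OF cauchy_diff[of y x]]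
        by (simp add: N_commute[of "x _"] LIMSEQ_unique)
      ultimately show ?thesis by (simp add: univ_minus)
    qed
    have tri: "\<parallel>X \<ominus>\<^bsub>U\<^esub> Z\<parallel>\<^bsub>U\<^esub> \<le> \<parallel>X \<ominus>\<^bsub>U\<^esub> Y\<parallel>\<^bsub>U\<^esub> + \<parallel>Y \<ominus>\<^bsub>U\<^esub> Z\<parallel>\<^bsub>U\<^esub>"
      if "X \<in> carrier U" "Y \<in> carrier U" "Z \<in> carrier U" for X Y Z
    proof -
      have "X \<ominus>\<^bsub>U\<^esub> Z = (X \<ominus>\<^bsub>U\<^esub> Y) \<oplus>\<^bsub>U\<^esub> (Y \<ominus>\<^bsub>U\<^esub> Z)" using that by algebra
      then show ?thesis using that triangle[of "X \<ominus>\<^bsub>U\<^esub> Y" "Y \<ominus>\<^bsub>U\<^esub> Z"] by simp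
    qed
    have cC: "c \<in> ?C"
      unfolding cauchy_iff
    proof (intro allI impI)
      fix e :: real assume e: "e > 0"
      then have e3: "e / 3 > 0" by simp
      obtain M where M: "\<And>m n. m \<ge> M \<Longrightarrow> n \<ge> M \<Longrightarrow> \<parallel>s m \<ominus>\<^bsub>U\<^esub> s n\<parallel>\<^bsub>U\<^esub> < e / 3"
        using cauchy e3 by meson
      obtain M' where M': "1 / real (Suc M') < e / 3" using e3 nat_approx_posE by blast
      have "N (c m - c n) < e" if mn: "m \<ge> max M M'" "n \<ge> max M M'" for m n
      proof -
        have small: "1 / real (Suc k) < e / 3" if "k \<ge> M'" for k
        proof -
          have "1 / real (Suc k) \<le> 1 / real (Suc M')" using that by (simp add: frac_le)
          then show ?thesis using M' by simp
        qed
        have "N (c m - c n) = \<parallel>?c m \<ominus>\<^bsub>U\<^esub> ?c n\<parallel>\<^bsub>U\<^esub>" by (simp add: univ_minus univ_norm_const)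
        also have "\<dots> \<le> \<parallel>?c m \<ominus>\<^bsub>U\<^esub> s m\<parallel>\<^bsub>U\<^esub> + (\<parallel>s m \<ominus>\<^bsub>U\<^esub> s n\<parallel>\<^bsub>U\<^esub> + \<parallel>s n \<ominus>\<^bsub>U\<^esub> ?c n\<parallel>\<^bsub>U\<^esub>)"
          using tri[OF cc[of m] sc[of m] cc[of n]] tri[OF sc[of m] sc[of n] cc[of n]] by linarith
        also have "\<dots> < e"
          using c[of m] c[of n] small[of m] small[of n] M[of m n] mn neg[OF cc[of m] sc[of m]] by simp
        finally show ?thesis .
      qed
      then show "\<exists>M. \<forall>m\<ge>M. \<forall>n\<ge>M. N (c m - c n) < e" by blast
    qed
    have "(\<lambda>k. \<parallel>s k \<ominus>\<^bsub>U\<^esub> cls c\<parallel>\<^bsub>U\<^esub>) \<longlonglongrightarrow> 0"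
    proof (rule null_comparison)
      show "(\<lambda>k. 1 / real (Suc k) + \<parallel>?c k \<ominus>\<^bsub>U\<^esub> cls c\<parallel>\<^bsub>U\<^esub>) \<longlonglongrightarrow> 0"
        using tendsto_add[OF LIMSEQ_Suc[OF lim_1_over_n] univ_norm_diff_const[OF cC]] by simp
      show "\<bar>\<parallel>s k \<ominus>\<^bsub>U\<^esub> cls c\<parallel>\<^bsub>U\<^esub>\<bar> \<le> 1 / real (Suc k) + \<parallel>?c k \<ominus>\<^bsub>U\<^esub> cls c\<parallel>\<^bsub>U\<^esub>" for k
      proof -
        obtain t where t: "t \<in> ?C" "s k \<ominus>\<^bsub>U\<^esub> cls c = cls t"
          using obt[of "s k \<ominus>\<^bsub>U\<^esub> cls c"] sc[of k] cC by auto
        have "\<parallel>cls t\<parallel>\<^bsub>U\<^esub> \<ge> 0" by (rule LIMSEQ_le_const[OF univ_norm_tendsto[OF t(1)]]) auto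
        then show ?thesis using tri[OF sc[of k] cc[of k], of "cls c"] c[of k] cC t by simp
      qed
    qed
    then show ?thesis using cC by (intro bexI[of _ "cls c"]) auto
  qed
qed (auto simp: carrier_univ univ_add univ_mult univ_scale univ_adj cauchy_add cauchy_mult cauchy_scale
    cauchy_adj poly_scale_add poly_scale_add_left poly_scale_scale poly_scale_mult_left
    poly_scale_mult_right poly_adj_add poly_adj_scale poly_adj_mult)

end


subsection \<open>The universal property\<close>

fun letter_eval :: "'d cstar \<Rightarrow> ('g \<Rightarrow> 'd) \<Rightarrow> 'g letter \<Rightarrow> 'd" where
  "letter_eval D f (Gen g) = f g"
| "letter_eval D f (Gen_adj g) = (f g)\<^sup>\<star>\<^bsub>D\<^esub>"

definition word_eval :: "'d cstar \<Rightarrow> ('g \<Rightarrow> 'd) \<Rightarrow> 'g word \<Rightarrow> 'd" where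
  "word_eval D f w = foldr (\<lambda>l u. letter_eval D f l \<otimes>\<^bsub>D\<^esub> u) (letters w) \<one>\<^bsub>D\<^esub>"

definition poly_eval :: "'d cstar \<Rightarrow> ('g \<Rightarrow> 'd) \<Rightarrow> 'g star_poly \<Rightarrow> 'd" where
  "poly_eval D f x =
     (\<Oplus>\<^bsub>D\<^esub>w\<in>Poly_Mapping.keys x. Poly_Mapping.lookup x w *\<^sub>C\<^bsub>D\<^esub> word_eval D f w)"

context unital_cstar_algebra
begin

context
  fixes f :: "'g \<Rightarrow> 'a"
  assumes f: "\<And>g. f g \<in> carrier A"
begin

lemma letter_eval_closed: "letter_eval A f l \<in> carrier A"
  by (cases l) (simp_all add: f adj_closed)

lemma word_eval_closed: "word_eval A f w \<in> carrier A"
proof -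
  have "foldr (\<lambda>l u. letter_eval A f l \<otimes> u) ls \<one> \<in> carrier A" for ls
    by (induction ls) (simp_all add: letter_eval_closed)
  then show ?thesis by (simp add: word_eval_def)
qed

lemma word_eval_zero: "word_eval A f 0 = \<one>" by (simp add: word_eval_def zero_word_def)

lemma word_eval_add: "word_eval A f (v + w) = word_eval A f v \<otimes> word_eval A f w"
proof -
  have cl: "foldr (\<lambda>l u. letter_eval A f l \<otimes> u) ls \<one> \<in> carrier A" for ls
    by (induction ls) (simp_all add: letter_eval_closed)
  have "foldr (\<lambda>l u. letter_eval A f l \<otimes> u) (ls @ ms) \<one> =
      foldr (\<lambda>l u. letter_eval A f l \<otimes> u) ls \<one> \<otimes> foldr (\<lambda>l u. letter_eval A f l \<otimes> u) ms \<one>" for ls ms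
    by (induction ls) (simp_all add: cl letter_eval_closed m_assoc del: foldr_append)
  then show ?thesis by (simp add: word_eval_def plus_word_def del: foldr_append)
qed

lemma word_eval_adj: "word_eval A f (word_adj w) = (word_eval A f w)\<^sup>\<star>"
proof -
  have l: "letter_eval A f (letter_adj l) = (letter_eval A f l)\<^sup>\<star>" for l
    by (cases l) (simp_all add: adj_adj f)
  have "word_eval A f (word_adj (Word ls)) = (word_eval A f (Word ls))\<^sup>\<star>" for ls
  proof (induction ls)
    case Nil then show ?case by (simp add: word_adj_def word_eval_def)
  next
    case (Cons m ls)
    have "word_adj (Word (m # ls)) = word_adj (Word ls) + Word [letter_adj m]"
      by (simp add: word_adj_def plus_word_def)
    then have "word_eval A f (word_adj (Word (m # ls))) = (word_eval A f (Word ls))\<^sup>\<star> \<otimes> (letter_eval A f m)\<^sup>\<star>"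
      using Cons by (simp add: word_eval_add) (simp add: word_eval_def l letter_eval_closed adj_closed)
    also have "\<dots> = (letter_eval A f m \<otimes> word_eval A f (Word ls))\<^sup>\<star>"
      by (simp add: adj_mult letter_eval_closed word_eval_closed)
    finally show ?case by (simp add: word_eval_def)
  qed
  from this[of "letters w"] show ?thesis by simp
qed

lemma poly_eval_superset:
  assumes "finite K" "Poly_Mapping.keys x \<subseteq> K"
  shows "poly_eval A f x = (\<Oplus>w\<in>K. Poly_Mapping.lookup x w *\<^sub>C word_eval A f w)"
  unfolding poly_eval_def
  by (rule add.finprod_mono_neutral_cong_left)
    (use assms in \<open>auto simp: in_keys_iff scale_zero_left scale_closed word_eval_closed\<close>)

lemma poly_eval_closed: "poly_eval A f x \<in> carrier A"
  unfolding poly_eval_def by (rule finsum_closed) (auto simp: scale_closed word_eval_closed)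

lemma poly_eval_single: "poly_eval A f (Poly_Mapping.single w c) = c *\<^sub>C word_eval A f w"
  by (subst poly_eval_superset[of "{w}"]) (auto simp: scale_closed word_eval_closed)

lemma poly_eval_add: "poly_eval A f (x + y) = poly_eval A f x \<oplus> poly_eval A f y"
proof -
  let ?K = "Poly_Mapping.keys x \<union> Poly_Mapping.keys y"
  have "poly_eval A f (x + y) = (\<Oplus>w\<in>?K. Poly_Mapping.lookup x w *\<^sub>C word_eval A f w
      \<oplus> Poly_Mapping.lookup y w *\<^sub>C word_eval A f w)"
    by (subst poly_eval_superset[of ?K])
      (auto simp: lookup_add scale_left_distrib word_eval_closed dest: subsetD[OF Poly_Mapping.keys_add])
  also have "\<dots> = poly_eval A f x \<oplus> poly_eval A f y"
    by (subst finsum_addf) (auto simp: scale_closed word_eval_closed poly_eval_superset[of ?K])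
  finally show ?thesis .
qed

lemma poly_eval_one: "poly_eval A f 1 = \<one>"
  using poly_eval_single[of 0 1] by (simp add: word_eval_zero scale_one)

lemma poly_eval_scale: "poly_eval A f (poly_scale c x) = c *\<^sub>C poly_eval A f x"
  by (induction x rule: poly_induct)
    (simp_all add: poly_scale_single poly_scale_add poly_eval_single poly_eval_add scale_scale
      scale_right_distrib word_eval_closed poly_eval_closed)

lemma poly_eval_mult: "poly_eval A f (x * y) = poly_eval A f x \<otimes> poly_eval A f y"
proof (induction x rule: poly_induct)
  case (single w c)
  show ?case
    by (induction y rule: poly_induct)
      (simp_all add: mult_single poly_eval_single poly_eval_add word_eval_add distrib_left r_distr
        mult_scale_left mult_scale_right scale_scale scale_closed word_eval_closed poly_eval_closed
        mult.commute)
qed (simp add: distrib_right poly_eval_add l_distr poly_eval_closed)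

lemma poly_eval_adj: "poly_eval A f (poly_adj x) = (poly_eval A f x)\<^sup>\<star>"
  by (induction x rule: poly_induct)
    (simp_all add: poly_adj_single poly_adj_add poly_eval_single poly_eval_add word_eval_adj
      adj_scale adj_add word_eval_closed poly_eval_closed)

lemma poly_eval_diff: "poly_eval A f (x - y) = poly_eval A f x \<ominus> poly_eval A f y"
proof -
  have "x - y = x + poly_scale (- 1) y" by (simp add: poly_scale_minus_one)
  then show ?thesis
    by (simp only: poly_eval_add poly_eval_scale minus_eq_scale[OF poly_eval_closed poly_eval_closed])
qed

lemma poly_eval_gen: "poly_eval A f (gen g) = f g"
  by (simp add: gen_def poly_eval_single) (simp add: word_eval_def f scale_one)

lemma poly_eval_seminorm: "cstar_seminorm (\<lambda>x. \<parallel>poly_eval A f x\<parallel>)"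
  by (simp add: cstar_seminorm_def poly_eval_add poly_eval_scale poly_eval_mult poly_eval_adj
      poly_eval_closed norm_triangle norm_scale norm_mult cstar_identity)

end

end

context admissible_relations
begin

lemma univ_gen_closed: "univ_gen R g \<in> carrier U" by (simp add: univ_gen_def)

lemma poly_eval_univ: "poly_eval U (univ_gen R) x = cls (\<lambda>n. x)"
proof (induction x rule: poly_induct)
  interpret U: unital_cstar_algebra U by (rule univ_cstar_algebra)
  note g = univ_gen_closed
  case (add x y) then show ?case by (simp add: U.poly_eval_add g univ_add)
next
  interpret U: unital_cstar_algebra U by (rule univ_cstar_algebra)
  note g = univ_gen_closed
  case (single w c)
  have letter: "letter_eval U (univ_gen R) l = cls (\<lambda>n. Poly_Mapping.single (Word [l]) 1)" for l
    by (cases l) (simp_all add: univ_gen_def univ_adj gen_adj, simp add: gen_def)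
  have "word_eval U (univ_gen R) (Word ls) = cls (\<lambda>n. Poly_Mapping.single (Word ls) 1)" for ls
  proof (induction ls)
    case Nil
    have "Poly_Mapping.single (Word []) 1 = (1 :: 'g star_poly)" by (metis zero_word_def single_one)
    then show ?case by (simp add: word_eval_def univ_one)
  next
    case (Cons l ls)
    have "word_eval U (univ_gen R) (Word (l # ls)) =
        letter_eval U (univ_gen R) l \<otimes>\<^bsub>U\<^esub> word_eval U (univ_gen R) (Word ls)" by (simp add: word_eval_def)
    then show ?case unfolding Cons letter single_Word_Cons[of l ls] by (simp add: univ_mult)
  qed
  from this[of "letters w"] show ?case
    by (simp add: U.poly_eval_single g univ_scale poly_scale_single)
qed

theorem univ_relations:
  assumes "r \<in> R" shows "poly_eval U (univ_gen R) r = \<zero>\<^bsub>U\<^esub>"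
proof -
  have "N r = 0" using univ_norm_rel_seminorms[OF admissible] assms by (simp add: rel_seminorms_def)
  then show ?thesis by (simp add: poly_eval_univ univ_zero cls_eq_iff null_def)
qed

theorem univ_property:
  fixes D :: "'d cstar"
  assumes D: "unital_cstar_algebra D" and f: "\<And>g. f g \<in> carrier D"
    and rel: "\<And>r. r \<in> R \<Longrightarrow> poly_eval D f r = \<zero>\<^bsub>D\<^esub>"
  shows "\<exists>\<phi>. star_hom U D \<phi> \<and> \<phi> \<one>\<^bsub>U\<^esub> = \<one>\<^bsub>D\<^esub> \<and> (\<forall>g. \<phi> (univ_gen R g) = f g)"
    and "star_hom U D \<phi> \<Longrightarrow> \<phi> \<one>\<^bsub>U\<^esub> = \<one>\<^bsub>D\<^esub> \<Longrightarrow> (\<And>g. \<phi> (univ_gen R g) = f g) \<Longrightarrow>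
      star_hom U D \<psi> \<Longrightarrow> \<psi> \<one>\<^bsub>U\<^esub> = \<one>\<^bsub>D\<^esub> \<Longrightarrow> (\<And>g. \<psi> (univ_gen R g) = f g) \<Longrightarrow>
      X \<in> carrier U \<Longrightarrow> \<phi> X = \<psi> X"
proof -
  interpret U: unital_cstar_algebra U by (rule univ_cstar_algebra)
  interpret D: unital_cstar_algebra D by (rule D)
  let ?C = "cauchy_seqs R"
  let ?ev = "poly_eval D f"
  note ev_simps = D.poly_eval_add[OF f] D.poly_eval_mult[OF f] D.poly_eval_scale[OF f]
    D.poly_eval_adj[OF f] D.poly_eval_diff[OF f] D.poly_eval_one[OF f] D.poly_eval_gen[OF f]
  have ev [simp]: "?ev x \<in> carrier D" for x by (rule D.poly_eval_closed[OF f])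
  have le: "\<parallel>?ev x\<parallel>\<^bsub>D\<^esub> \<le> N x" for x
  proof (rule univ_norm_upper[OF admissible, of "\<lambda>x. \<parallel>?ev x\<parallel>\<^bsub>D\<^esub>"])
    show "(\<lambda>x. \<parallel>?ev x\<parallel>\<^bsub>D\<^esub>) \<in> rel_seminorms R"
      using D.poly_eval_seminorm[OF f] rel by (simp add: rel_seminorms_def)
  qed
  define L where "L x l \<longleftrightarrow> l \<in> carrier D \<and> (\<lambda>n. \<parallel>?ev (x n) \<ominus>\<^bsub>D\<^esub> l\<parallel>\<^bsub>D\<^esub>) \<longlonglongrightarrow> 0" for x l
  have L_ex: "\<exists>l. L x l" if x: "x \<in> ?C" for x
  proof -
    have "\<exists>l\<in>carrier D. (\<lambda>n. \<parallel>?ev (x n) \<ominus>\<^bsub>D\<^esub> l\<parallel>\<^bsub>D\<^esub>) \<longlonglongrightarrow> 0"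
    proof (rule D.complete)
      show "\<forall>e>0. \<exists>M. \<forall>m\<ge>M. \<forall>n\<ge>M. \<parallel>?ev (x m) \<ominus>\<^bsub>D\<^esub> ?ev (x n)\<parallel>\<^bsub>D\<^esub> < e"
      proof (intro allI impI)
        fix e :: real assume "e > 0"
        then obtain M where M: "\<And>m n. m \<ge> M \<Longrightarrow> n \<ge> M \<Longrightarrow> N (x m - x n) < e"
          using x unfolding cauchy_iff by meson
        have "\<parallel>?ev (x m) \<ominus>\<^bsub>D\<^esub> ?ev (x n)\<parallel>\<^bsub>D\<^esub> < e" if "m \<ge> M" "n \<ge> M" for m n
          using M[OF that] le[of "x m - x n"] by (simp add: ev_simps)
        then show "\<exists>M. \<forall>m\<ge>M. \<forall>n\<ge>M. \<parallel>?ev (x m) \<ominus>\<^bsub>D\<^esub> ?ev (x n)\<parallel>\<^bsub>D\<^esub> < e" by blast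
      qed
    qed auto
    then show ?thesis by (auto simp: L_def)
  qed
  have L_unique: "l = m" if "L x l" "L x m" for x l m
    using that D.limit_unique[of "\<lambda>n. ?ev (x n)" l m] by (auto simp: L_def image_subset_iff)
  have L_null: "L y l" if xl: "L x l" and xy: "null x y" for x y l
    unfolding L_def
  proof
    show l: "l \<in> carrier D" using xl by (simp add: L_def)
    show "(\<lambda>n. \<parallel>?ev (y n) \<ominus>\<^bsub>D\<^esub> l\<parallel>\<^bsub>D\<^esub>) \<longlonglongrightarrow> 0"
    proof (rule null_comparison)
      show "(\<lambda>n. N (y n - x n) + \<parallel>?ev (x n) \<ominus>\<^bsub>D\<^esub> l\<parallel>\<^bsub>D\<^esub>) \<longlonglongrightarrow> 0"
        using tendsto_add[OF null_sym[OF xy, unfolded null_def]] xl by (fastforce simp: L_def)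
      show "\<bar>\<parallel>?ev (y n) \<ominus>\<^bsub>D\<^esub> l\<parallel>\<^bsub>D\<^esub>\<bar> \<le> N (y n - x n) + \<parallel>?ev (x n) \<ominus>\<^bsub>D\<^esub> l\<parallel>\<^bsub>D\<^esub>" for n
        using D.norm_diff_triangle[of "?ev (y n)" "?ev (x n)" l] l le[of "y n - x n"]
          D.norm_nonneg[of "?ev (y n) \<ominus>\<^bsub>D\<^esub> l"] by (simp add: ev_simps)
    qed
  qed
  have L_const: "L (\<lambda>n. c) (?ev c)" for c by (simp add: L_def D.minus_eq D.r_neg)
  have L_add: "L (\<lambda>n. x n + y n) (l \<oplus>\<^bsub>D\<^esub> m)" if "L x l" "L y m" for x y l m
    unfolding L_def
  proof
    have lm: "l \<in> carrier D" "m \<in> carrier D" using that by (simp_all add: L_def)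
    then show "l \<oplus>\<^bsub>D\<^esub> m \<in> carrier D" by simp
    show "(\<lambda>n. \<parallel>?ev (x n + y n) \<ominus>\<^bsub>D\<^esub> (l \<oplus>\<^bsub>D\<^esub> m)\<parallel>\<^bsub>D\<^esub>) \<longlonglongrightarrow> 0"
    proof (rule null_comparison)
      show "(\<lambda>n. \<parallel>?ev (x n) \<ominus>\<^bsub>D\<^esub> l\<parallel>\<^bsub>D\<^esub> + \<parallel>?ev (y n) \<ominus>\<^bsub>D\<^esub> m\<parallel>\<^bsub>D\<^esub>) \<longlonglongrightarrow> 0"
        using that unfolding L_def by (auto intro: tendsto_add_zero)
      show "\<bar>\<parallel>?ev (x n + y n) \<ominus>\<^bsub>D\<^esub> (l \<oplus>\<^bsub>D\<^esub> m)\<parallel>\<^bsub>D\<^esub>\<bar>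
          \<le> \<parallel>?ev (x n) \<ominus>\<^bsub>D\<^esub> l\<parallel>\<^bsub>D\<^esub> + \<parallel>?ev (y n) \<ominus>\<^bsub>D\<^esub> m\<parallel>\<^bsub>D\<^esub>" for n
      proof -
        have "?ev (x n + y n) \<ominus>\<^bsub>D\<^esub> (l \<oplus>\<^bsub>D\<^esub> m) = (?ev (x n) \<ominus>\<^bsub>D\<^esub> l) \<oplus>\<^bsub>D\<^esub> (?ev (y n) \<ominus>\<^bsub>D\<^esub> m)"
          unfolding ev_simps using lm ev[of "x n"] ev[of "y n"] by algebra
        then show ?thesis using lm D.norm_triangle[of "?ev (x n) \<ominus>\<^bsub>D\<^esub> l" "?ev (y n) \<ominus>\<^bsub>D\<^esub> m"]
          by (simp add: D.norm_nonneg)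
      qed
    qed
  qed
  have L_scale: "L (\<lambda>n. poly_scale c (x n)) (c *\<^sub>C\<^bsub>D\<^esub> l)" if "L x l" for c x l
    unfolding L_def
  proof
    have l: "l \<in> carrier D" using that by (simp add: L_def)
    then show "c *\<^sub>C\<^bsub>D\<^esub> l \<in> carrier D" by (rule D.scale_closed)
    have "\<parallel>?ev (poly_scale c (x n)) \<ominus>\<^bsub>D\<^esub> c *\<^sub>C\<^bsub>D\<^esub> l\<parallel>\<^bsub>D\<^esub> = cmod c * \<parallel>?ev (x n) \<ominus>\<^bsub>D\<^esub> l\<parallel>\<^bsub>D\<^esub>" for n
      using l by (simp add: ev_simps D.norm_scale flip: D.scale_diff)
    then show "(\<lambda>n. \<parallel>?ev (poly_scale c (x n)) \<ominus>\<^bsub>D\<^esub> c *\<^sub>C\<^bsub>D\<^esub> l\<parallel>\<^bsub>D\<^esub>) \<longlonglongrightarrow> 0"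
      using that by (simp add: L_def tendsto_mult_right_zero)
  qed
  have L_adj: "L (\<lambda>n. poly_adj (x n)) (l\<^sup>\<star>\<^bsub>D\<^esub>)" if "L x l" for x l
    unfolding L_def
  proof
    have l: "l \<in> carrier D" using that by (simp add: L_def)
    then show "l\<^sup>\<star>\<^bsub>D\<^esub> \<in> carrier D" by (rule D.adj_closed)
    have "\<parallel>?ev (poly_adj (x n)) \<ominus>\<^bsub>D\<^esub> l\<^sup>\<star>\<^bsub>D\<^esub>\<parallel>\<^bsub>D\<^esub> = \<parallel>?ev (x n) \<ominus>\<^bsub>D\<^esub> l\<parallel>\<^bsub>D\<^esub>" for n
      using l by (simp add: ev_simps D.norm_adj flip: D.adj_diff)
    then show "(\<lambda>n. \<parallel>?ev (poly_adj (x n)) \<ominus>\<^bsub>D\<^esub> l\<^sup>\<star>\<^bsub>D\<^esub>\<parallel>\<^bsub>D\<^esub>) \<longlonglongrightarrow> 0"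
      using that by (simp add: L_def)
  qed
  have L_mult: "L (\<lambda>n. x n * y n) (l \<otimes>\<^bsub>D\<^esub> m)" if xl: "L x l" and ym: "L y m" and x: "x \<in> ?C" for x y l m
    unfolding L_def
  proof
    have lm: "l \<in> carrier D" "m \<in> carrier D" using xl ym by (simp_all add: L_def)
    then show "l \<otimes>\<^bsub>D\<^esub> m \<in> carrier D" by simp
    obtain K where K: "\<And>n. N (x n) \<le> K" using cauchy_bounded[OF x] by metis
    show "(\<lambda>n. \<parallel>?ev (x n * y n) \<ominus>\<^bsub>D\<^esub> (l \<otimes>\<^bsub>D\<^esub> m)\<parallel>\<^bsub>D\<^esub>) \<longlonglongrightarrow> 0"
    proof (rule null_comparison)
      show "(\<lambda>n. K * \<parallel>?ev (y n) \<ominus>\<^bsub>D\<^esub> m\<parallel>\<^bsub>D\<^esub> + \<parallel>?ev (x n) \<ominus>\<^bsub>D\<^esub> l\<parallel>\<^bsub>D\<^esub> * \<parallel>m\<parallel>\<^bsub>D\<^esub>) \<longlonglongrightarrow> 0"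
        using xl ym unfolding L_def by (auto intro!: tendsto_add_zero tendsto_mult_right_zero tendsto_mult_left_zero)
      show "\<bar>\<parallel>?ev (x n * y n) \<ominus>\<^bsub>D\<^esub> (l \<otimes>\<^bsub>D\<^esub> m)\<parallel>\<^bsub>D\<^esub>\<bar>
          \<le> K * \<parallel>?ev (y n) \<ominus>\<^bsub>D\<^esub> m\<parallel>\<^bsub>D\<^esub> + \<parallel>?ev (x n) \<ominus>\<^bsub>D\<^esub> l\<parallel>\<^bsub>D\<^esub> * \<parallel>m\<parallel>\<^bsub>D\<^esub>" for n
      proof -
        let ?x = "?ev (x n)" and ?y = "?ev (y n)"
        have "?ev (x n * y n) \<ominus>\<^bsub>D\<^esub> (l \<otimes>\<^bsub>D\<^esub> m) = ?x \<otimes>\<^bsub>D\<^esub> (?y \<ominus>\<^bsub>D\<^esub> m) \<oplus>\<^bsub>D\<^esub> (?x \<ominus>\<^bsub>D\<^esub> l) \<otimes>\<^bsub>D\<^esub> m"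
          unfolding ev_simps using lm ev[of "x n"] ev[of "y n"] by algebra
        moreover have "\<parallel>?x \<otimes>\<^bsub>D\<^esub> (?y \<ominus>\<^bsub>D\<^esub> m) \<oplus>\<^bsub>D\<^esub> (?x \<ominus>\<^bsub>D\<^esub> l) \<otimes>\<^bsub>D\<^esub> m\<parallel>\<^bsub>D\<^esub>
            \<le> \<parallel>?x \<otimes>\<^bsub>D\<^esub> (?y \<ominus>\<^bsub>D\<^esub> m)\<parallel>\<^bsub>D\<^esub> + \<parallel>(?x \<ominus>\<^bsub>D\<^esub> l) \<otimes>\<^bsub>D\<^esub> m\<parallel>\<^bsub>D\<^esub>"
          using lm by (intro D.norm_triangle) simp_all
        moreover have "\<parallel>?x \<otimes>\<^bsub>D\<^esub> (?y \<ominus>\<^bsub>D\<^esub> m)\<parallel>\<^bsub>D\<^esub> \<le> K * \<parallel>?y \<ominus>\<^bsub>D\<^esub> m\<parallel>\<^bsub>D\<^esub>"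
          using lm order_trans[OF le[of "x n"] K[of n]]
          by (intro order_trans[OF D.norm_mult mult_right_mono]) (simp_all add: D.norm_nonneg)
        moreover have "\<parallel>(?x \<ominus>\<^bsub>D\<^esub> l) \<otimes>\<^bsub>D\<^esub> m\<parallel>\<^bsub>D\<^esub> \<le> \<parallel>?x \<ominus>\<^bsub>D\<^esub> l\<parallel>\<^bsub>D\<^esub> * \<parallel>m\<parallel>\<^bsub>D\<^esub>"
          using lm by (intro D.norm_mult) simp_all
        ultimately show ?thesis using lm by (simp add: D.norm_nonneg ev_simps)
      qed
    qed
  qed
  define \<rho> where "\<rho> X = (SOME l. L (rep X) l)" for X
  have \<rho>_L: "L x (\<rho> (cls x))" if x: "x \<in> ?C" for x
  proof -
    have "L (rep (cls x)) (\<rho> (cls x))" unfolding \<rho>_def by (rule someI_ex, rule L_ex, rule rep_cls[OF x])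
    then show ?thesis by (rule L_null[OF _ rep_cls(2)[OF x]])
  qed
  have \<rho>_eq: "\<rho> (cls x) = l" if "x \<in> ?C" "L x l" for x l using L_unique \<rho>_L that by blast
  have "star_hom U D \<rho>"
    unfolding star_hom_def
  proof (intro conjI ballI allI funcsetI)
    fix X assume "X \<in> carrier U"
    then obtain x where x: "x \<in> ?C" "X = cls x" by (auto simp: carrier_univ)
    show "\<rho> X \<in> carrier D" using \<rho>_L[OF x(1)] x(2) by (simp add: L_def)
    show "\<rho> (c *\<^sub>C\<^bsub>U\<^esub> X) = c *\<^sub>C\<^bsub>D\<^esub> \<rho> X" for c
      using x by (simp add: univ_scale) (intro \<rho>_eq cauchy_scale L_scale \<rho>_L)
    show "\<rho> (X\<^sup>\<star>\<^bsub>U\<^esub>) = (\<rho> X)\<^sup>\<star>\<^bsub>D\<^esub>" using x by (simp add: univ_adj) (intro \<rho>_eq cauchy_adj L_adj \<rho>_L)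
    fix Y assume "Y \<in> carrier U"
    then obtain y where y: "y \<in> ?C" "Y = cls y" by (auto simp: carrier_univ)
    show "\<rho> (X \<oplus>\<^bsub>U\<^esub> Y) = \<rho> X \<oplus>\<^bsub>D\<^esub> \<rho> Y" 
      using x y by (simp add: univ_add) (intro \<rho>_eq cauchy_add L_add \<rho>_L)
    show "\<rho> (X \<otimes>\<^bsub>U\<^esub> Y) = \<rho> X \<otimes>\<^bsub>D\<^esub> \<rho> Y"
      using x y by (simp add: univ_mult) (intro \<rho>_eq cauchy_mult L_mult \<rho>_L)
  qed
  moreover have "\<rho> \<one>\<^bsub>U\<^esub> = \<one>\<^bsub>D\<^esub>" "\<rho> (univ_gen R g) = f g" for g
    using L_const[of 1] L_const[of "gen g"] by (simp_all add: univ_one univ_gen_def \<rho>_eq ev_simps)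
  ultimately show "\<exists>\<phi>. star_hom U D \<phi> \<and> \<phi> \<one>\<^bsub>U\<^esub> = \<one>\<^bsub>D\<^esub> \<and> (\<forall>g. \<phi> (univ_gen R g) = f g)" by blast

  have on_polys: "h (cls (\<lambda>n. x)) = ?ev x"
    if h: "star_hom U D h" "h \<one>\<^bsub>U\<^esub> = \<one>\<^bsub>D\<^esub>" "\<And>g. h (univ_gen R g) = f g" for h x
  proof (induction x rule: poly_induct)
    case (single w c)
    have word: "h (cls (\<lambda>n. Poly_Mapping.single (Word ls) 1)) = word_eval D f (Word ls)" for ls
    proof (induction ls)
      case Nil
      have "Poly_Mapping.single (Word []) 1 = (1 :: 'g star_poly)" by (metis zero_word_def single_one)
      then show ?case using h by (simp add: word_eval_def univ_one)
    next
      case (Cons l ls)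
      have "h (cls (\<lambda>n. Poly_Mapping.single (Word [l]) 1)) = letter_eval D f l"
      proof (cases l)
        case (Gen g) then show ?thesis using h(3)[of g] by (simp add: univ_gen_def gen_def)
      next
        case (Gen_adj g)
        have "h ((univ_gen R g)\<^sup>\<star>\<^bsub>U\<^esub>) = (f g)\<^sup>\<star>\<^bsub>D\<^esub>"
          using h univ_gen_closed by (simp add: star_hom_def)
        then show ?thesis using Gen_adj by (simp add: univ_gen_def univ_adj gen_adj)
      qed
      then have "h (cls (\<lambda>n. Poly_Mapping.single (Word [l]) 1) \<otimes>\<^bsub>U\<^esub> cls (\<lambda>n. Poly_Mapping.single (Word ls) 1))
          = letter_eval D f l \<otimes>\<^bsub>D\<^esub> word_eval D f (Word ls)"
        using h(1) Cons by (simp add: star_hom_def)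
      then show ?case by (simp add: univ_mult word_eval_def flip: single_Word_Cons)
    qed
    have "h (c *\<^sub>C\<^bsub>U\<^esub> cls (\<lambda>n. Poly_Mapping.single w 1)) = c *\<^sub>C\<^bsub>D\<^esub> word_eval D f w"
      using h(1) word[of "letters w"] by (simp add: star_hom_def)
    then show ?case by (simp add: univ_scale poly_scale_single D.poly_eval_single[OF f])
  next
    case (add x y)
    have "h (cls (\<lambda>n. x) \<oplus>\<^bsub>U\<^esub> cls (\<lambda>n. y)) = ?ev (x + y)"
      using h(1) add by (simp add: star_hom_def ev_simps)
    then show ?case by (simp add: univ_add)
  qed
  have h_lim: "L x (h (cls x))"
    if h: "star_hom U D h" "h \<one>\<^bsub>U\<^esub> = \<one>\<^bsub>D\<^esub>" "\<And>g. h (univ_gen R g) = f g" and x: "x \<in> ?C" for h x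
    unfolding L_def
  proof
    have hc: "h Y \<in> carrier D" if "Y \<in> carrier U" for Y using h(1) that by (auto simp: star_hom_def)
    show hx: "h (cls x) \<in> carrier D" using hc x by simp
    show "(\<lambda>n. \<parallel>?ev (x n) \<ominus>\<^bsub>D\<^esub> h (cls x)\<parallel>\<^bsub>D\<^esub>) \<longlonglongrightarrow> 0"
    proof (rule null_comparison[OF _ univ_norm_diff_const[OF x]])
      fix k
      let ?c = "cls (\<lambda>n. x k)"
      have "h (?c \<ominus>\<^bsub>U\<^esub> cls x) = h ?c \<ominus>\<^bsub>D\<^esub> h (cls x)"
        using h(1) x hc by (simp add: star_hom_def U.minus_eq_scale D.minus_eq_scale U.scale_closed)
      then have "?ev (x k) \<ominus>\<^bsub>D\<^esub> h (cls x) = h (?c \<ominus>\<^bsub>U\<^esub> cls x)" by (simp add: on_polys[OF h])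
      then show "\<bar>\<parallel>?ev (x k) \<ominus>\<^bsub>D\<^esub> h (cls x)\<parallel>\<^bsub>D\<^esub>\<bar> \<le> \<parallel>?c \<ominus>\<^bsub>U\<^esub> cls x\<parallel>\<^bsub>U\<^esub>"
        using star_hom_contractive[OF univ_cstar_algebra D h(1), of "?c \<ominus>\<^bsub>U\<^esub> cls x"] x
          D.norm_nonneg[OF hc[of "?c \<ominus>\<^bsub>U\<^esub> cls x"]] hx by simp
    qed
  qed
  show "\<phi> X = \<psi> X"
    if "star_hom U D \<phi>" "\<phi> \<one>\<^bsub>U\<^esub> = \<one>\<^bsub>D\<^esub>" "\<And>g. \<phi> (univ_gen R g) = f g"
      "star_hom U D \<psi>" "\<psi> \<one>\<^bsub>U\<^esub> = \<one>\<^bsub>D\<^esub>" "\<And>g. \<psi> (univ_gen R g) = f g" and X: "X \<in> carrier U"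
  proof -
    obtain x where x: "x \<in> ?C" "X = cls x" using X by (auto simp: carrier_univ)
    show ?thesis using L_unique[OF h_lim[of \<phi> x] h_lim[of \<psi> x]] that x by simp
  qed
qed

end


subsection \<open>The universal properties of \<open>\<U>(A,\<delta>)\<close> and \<open>A \<times>\<^sub>\<delta> \<int>\<close>\<close>

definition unital_star_hom :: "'a cstar \<Rightarrow> 'b cstar \<Rightarrow> ('a \<Rightarrow> 'b) \<Rightarrow> bool" where
  "unital_star_hom A B f \<longleftrightarrow> star_hom A B f \<and> f \<one>\<^bsub>A\<^esub> = \<one>\<^bsub>B\<^esub>"

definition isometry_rep :: "'a cstar \<Rightarrow> ('a \<Rightarrow> 'a) \<Rightarrow> 'd cstar \<Rightarrow> ('a \<Rightarrow> 'd) \<Rightarrow> 'd \<Rightarrow> bool" where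
  "isometry_rep A \<delta> D \<pi> t \<longleftrightarrow> unital_star_hom A D \<pi> \<and> t \<in> carrier D \<and>
     t\<^sup>\<star>\<^bsub>D\<^esub> \<otimes>\<^bsub>D\<^esub> t = \<one>\<^bsub>D\<^esub> \<and>
     (\<forall>a\<in>carrier A. \<pi> (\<delta> a) = t \<otimes>\<^bsub>D\<^esub> \<pi> a \<otimes>\<^bsub>D\<^esub> t\<^sup>\<star>\<^bsub>D\<^esub>)"

definition crossed_rep ::
    "'a cstar \<Rightarrow> ('a \<Rightarrow> 'a) \<Rightarrow> ('a \<Rightarrow> 'a) \<Rightarrow> 'd cstar \<Rightarrow> ('a \<Rightarrow> 'd) \<Rightarrow> 'd \<Rightarrow> bool" where
  "crossed_rep A \<delta> \<tau> D \<pi> u \<longleftrightarrow> unital_star_hom A D \<pi> \<and> u \<in> carrier D \<and>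
     u \<otimes>\<^bsub>D\<^esub> u\<^sup>\<star>\<^bsub>D\<^esub> \<otimes>\<^bsub>D\<^esub> u = u \<and>
     (\<forall>a\<in>carrier A. \<pi> (\<delta> a) = u \<otimes>\<^bsub>D\<^esub> \<pi> a \<otimes>\<^bsub>D\<^esub> u\<^sup>\<star>\<^bsub>D\<^esub>) \<and>
     (\<forall>a\<in>carrier A. \<pi> (\<tau> a) = u\<^sup>\<star>\<^bsub>D\<^esub> \<otimes>\<^bsub>D\<^esub> \<pi> a \<otimes>\<^bsub>D\<^esub> u)"

lemma seminorm_diff_zero:
  assumes "cstar_seminorm p" "p (x - y) = 0" shows "p x = p y"
  using seminorm_reverse[OF assms(1), of x y] unfolding assms(2) by linarith

lemma coeff_relationsI:
  assumes "a \<in> carrier A"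
  shows "b \<in> carrier A \<Longrightarrow> coeff (a \<oplus>\<^bsub>A\<^esub> b) - (coeff a + coeff b) \<in> coeff_relations A"
    and "coeff (c *\<^sub>C\<^bsub>A\<^esub> a) - poly_scale c (coeff a) \<in> coeff_relations A"
    and "b \<in> carrier A \<Longrightarrow> coeff (a \<otimes>\<^bsub>A\<^esub> b) - coeff a * coeff b \<in> coeff_relations A"
    and "coeff (a\<^sup>\<star>\<^bsub>A\<^esub>) - poly_adj (coeff a) \<in> coeff_relations A"
  using assms unfolding coeff_relations_def by blast+

lemma coeff_relations_one: "coeff \<one>\<^bsub>A\<^esub> - 1 \<in> coeff_relations A"
  unfolding coeff_relations_def by blast

lemma coeff_relations_outside: "a \<notin> carrier A \<Longrightarrow> coeff a \<in> coeff_relations A"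
  unfolding coeff_relations_def by blast

lemma coeff_seminorm_le:
  assumes A: "unital_cstar_algebra A" and R: "coeff_relations A \<subseteq> R"
    and p: "p \<in> rel_seminorms R" and a: "a \<in> carrier A"
  shows "p (coeff a) \<le> \<parallel>a\<parallel>\<^bsub>A\<^esub>"
proof -
  interpret A: unital_cstar_algebra A by (rule A)
  have sp: "cstar_seminorm p" and p0: "\<And>r. r \<in> coeff_relations A \<Longrightarrow> p r = 0"
    using p R by (auto simp: rel_seminorms_def)
  note eq = seminorm_diff_zero[OF sp p0]
  show ?thesis
  proof (rule A.seminorm_le_norm[where q = "\<lambda>a. p (coeff a)", OF _ _ _ _ a])
    fix x y assume xy: "x \<in> carrier A" "y \<in> carrier A"
    have "p (coeff (x \<oplus>\<^bsub>A\<^esub> y)) = p (coeff x + coeff y)"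
      using xy by (intro eq coeff_relationsI)
    then show "p (coeff (x \<oplus>\<^bsub>A\<^esub> y)) \<le> p (coeff x) + p (coeff y)" by (simp add: seminorm_add[OF sp])
    have "p (coeff (x \<otimes>\<^bsub>A\<^esub> y)) = p (coeff x * coeff y)"
      using xy by (intro eq coeff_relationsI)
    then show "p (coeff (x \<otimes>\<^bsub>A\<^esub> y)) \<le> p (coeff x) * p (coeff y)" by (simp add: seminorm_mult[OF sp])
  next
    fix x assume x: "x \<in> carrier A"
    have "p (coeff (c *\<^sub>C\<^bsub>A\<^esub> x)) = p (poly_scale c (coeff x))" for c
      using x by (intro eq coeff_relationsI)
    then show "p (coeff (c *\<^sub>C\<^bsub>A\<^esub> x)) = cmod c * p (coeff x)" for c by (simp add: seminorm_scale[OF sp])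
    have 1: "p (coeff (x\<^sup>\<star>\<^bsub>A\<^esub> \<otimes>\<^bsub>A\<^esub> x)) = p (coeff (x\<^sup>\<star>\<^bsub>A\<^esub>) * coeff x)"
      using x A.adj_closed[OF x] by (intro eq coeff_relationsI)
    have "p (coeff (x\<^sup>\<star>\<^bsub>A\<^esub>) - poly_adj (coeff x)) = 0"
      using x by (intro p0 coeff_relationsI)
    then have "p ((coeff (x\<^sup>\<star>\<^bsub>A\<^esub>) - poly_adj (coeff x)) * coeff x) = 0"
      using seminorm_mult[OF sp, of "coeff (x\<^sup>\<star>\<^bsub>A\<^esub>) - poly_adj (coeff x)" "coeff x"]
        seminorm_nonneg[OF sp, of "(coeff (x\<^sup>\<star>\<^bsub>A\<^esub>) - poly_adj (coeff x)) * coeff x"] by simp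
    then have "p (coeff (x\<^sup>\<star>\<^bsub>A\<^esub>) * coeff x) = p (poly_adj (coeff x) * coeff x)"
      by (intro seminorm_diff_zero[OF sp]) (simp add: left_diff_distrib)
    then show "p (coeff (x\<^sup>\<star>\<^bsub>A\<^esub> \<otimes>\<^bsub>A\<^esub> x)) = (p (coeff x))\<^sup>2" using 1 by (simp add: seminorm_adj_mult[OF sp])
  qed
qed

lemma extra_seminorm_le:
  assumes p: "p \<in> rel_seminorms R" and rel: "extra * poly_adj extra * extra - extra \<in> R"
  shows "p (extra :: 'a generator star_poly) \<le> 1"
proof -
  let ?t = "extra :: 'a generator star_poly"
  let ?q = "poly_adj ?t * ?t"
  have sp: "cstar_seminorm p" and p0: "p (?t * poly_adj ?t * ?t - ?t) = 0"
    using p rel by (auto simp: rel_seminorms_def)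
  have "p ?q = p (?q * ?q)"
  proof -
    have "p (poly_adj ?t * (?t * poly_adj ?t * ?t - ?t)) = 0"
      using seminorm_mult[OF sp, of "poly_adj ?t" "?t * poly_adj ?t * ?t - ?t"] p0
        seminorm_nonneg[OF sp, of "poly_adj ?t * (?t * poly_adj ?t * ?t - ?t)"] by simp
    then have "p (?q * ?q - ?q) = 0" by (simp add: right_diff_distrib mult.assoc)
    then show ?thesis using seminorm_diff_zero[OF sp, of "?q * ?q" ?q] by simp
  qed
  also have "\<dots> = (p ?q)\<^sup>2"
    using seminorm_adj_mult[OF sp, of ?q] by (simp add: poly_adj_mult)
  finally have "p ?q = 0 \<or> p ?q = 1" by (simp add: power2_eq_square)
  then have "(p ?t)\<^sup>2 \<le> 1" using seminorm_adj_mult[OF sp, of ?t] by auto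
  then show ?thesis by (simp add: abs_square_le_1)
qed

lemma isometry_partial:
  assumes p: "p \<in> rel_seminorms R" and rel: "poly_adj extra * extra - 1 \<in> R"
  shows "p (extra :: 'a generator star_poly) \<le> 1"
proof -
  let ?t = "extra :: 'a generator star_poly"
  have sp: "cstar_seminorm p" using p by (simp add: rel_seminorms_def)
  have "p (poly_adj ?t * ?t - 1) = 0" using p rel by (auto simp: rel_seminorms_def)
  then have "p (poly_adj ?t * ?t) = p 1" by (rule seminorm_diff_zero[OF sp])
  then have "(p ?t)\<^sup>2 \<le> 1" using seminorm_adj_mult[OF sp, of ?t] seminorm_one[OF sp] by simp
  then show ?thesis by (simp add: abs_square_le_1)
qed

lemma admissible_coeff:
  assumes A: "unital_cstar_algebra A" and R: "coeff_relations A \<subseteq> R"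
    and extra: "\<And>p. p \<in> rel_seminorms R \<Longrightarrow> p extra \<le> 1"
  shows "admissible R"
  unfolding admissible_def
proof
  fix g :: "'a generator"
  show "\<exists>K. \<forall>p\<in>rel_seminorms R. p (gen g) \<le> K"
  proof (cases g)
    case Extra then show ?thesis using extra by blast
  next
    case (Coeff a)
    show ?thesis
    proof (cases "a \<in> carrier A")
      case True then show ?thesis using Coeff coeff_seminorm_le[OF A R] by blast
    next
      case False
      then have mem: "gen g \<in> R" unfolding Coeff by (intro subsetD[OF R] coeff_relations_outside)
      show ?thesis
      proof (intro exI ballI)
        fix p assume "p \<in> rel_seminorms R"
        then show "p (gen g) \<le> 0" using mem by (simp add: rel_seminorms_def)
      qed
    qed
  qed
qed

lemma admissible_isometry:
  assumes "unital_cstar_algebra A"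
  shows "admissible (coeff_relations A \<union> isometry_relations A \<delta>)"
  using assms
proof (rule admissible_coeff)
  show "p extra \<le> 1" if "p \<in> rel_seminorms (coeff_relations A \<union> isometry_relations A \<delta>)" for p
    using that by (rule isometry_partial) (unfold isometry_relations_def, blast)
qed blast

lemma admissible_crossed:
  assumes "unital_cstar_algebra A"
  shows "admissible (coeff_relations A \<union> crossed_relations A \<delta> \<tau>)"
  using assms
proof (rule admissible_coeff)
  show "p extra \<le> 1" if "p \<in> rel_seminorms (coeff_relations A \<union> crossed_relations A \<delta> \<tau>)" for p
    using that by (rule extra_seminorm_le) (simp only: crossed_relations_def Un_iff singleton_iff simp_thms)
qed blast

lemma ball_setcompr2: "(\<forall>r\<in>{h a b |a b. P a b}. Q r) \<longleftrightarrow> (\<forall>a b. P a b \<longrightarrow> Q (h a b))"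
  by auto

lemma ball_setcompr1: "(\<forall>r\<in>{h a |a. P a}. Q r) \<longleftrightarrow> (\<forall>a. P a \<longrightarrow> Q (h a))"
  by auto

text \<open>An assignment satisfies the relations iff it is a representation.\<close>

context
  fixes A :: "'a cstar" and D :: "'d cstar" and f :: "'a generator \<Rightarrow> 'd"
  assumes A: "unital_cstar_algebra A" and D: "unital_cstar_algebra D"
    and f: "\<And>g. f g \<in> carrier D"
begin

interpretation A: unital_cstar_algebra A by (rule A)
interpretation D: unital_cstar_algebra D by (rule D)

lemmas ev_simps = D.poly_eval_add[where f = f, OF f] D.poly_eval_mult[where f = f, OF f] D.poly_eval_scale[where f = f, OF f]
    D.poly_eval_adj[where f = f, OF f] D.poly_eval_diff[where f = f, OF f] D.poly_eval_one[where f = f, OF f] D.poly_eval_gen[where f = f, OF f]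

lemma diff_eq_zero: "x \<in> carrier D \<Longrightarrow> y \<in> carrier D \<Longrightarrow> x \<ominus>\<^bsub>D\<^esub> y = \<zero>\<^bsub>D\<^esub> \<longleftrightarrow> x = y"
proof
  assume xy: "x \<in> carrier D" "y \<in> carrier D" and "x \<ominus>\<^bsub>D\<^esub> y = \<zero>\<^bsub>D\<^esub>"
  moreover have "x = (x \<ominus>\<^bsub>D\<^esub> y) \<oplus>\<^bsub>D\<^esub> y" using xy by algebra
  ultimately show "x = y" by simp
qed (simp add: D.minus_eq D.r_neg)

lemma coeff_relations_eval:
  "(\<forall>r\<in>coeff_relations A. poly_eval D f r = \<zero>\<^bsub>D\<^esub>) \<longleftrightarrow>
     unital_star_hom A D (\<lambda>a. f (Coeff a)) \<and> (\<forall>a. a \<notin> carrier A \<longrightarrow> f (Coeff a) = \<zero>\<^bsub>D\<^esub>)"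
  unfolding coeff_relations_def unital_star_hom_def star_hom_def ball_Un ball_setcompr1 ball_setcompr2 ev_simps
  by (simp add: diff_eq_zero f D.scale_closed D.adj_closed ev_simps Ball_def imp_conjL)

lemma isometry_relations_eval:
  "(\<forall>r\<in>coeff_relations A \<union> isometry_relations A \<delta>. poly_eval D f r = \<zero>\<^bsub>D\<^esub>) \<longleftrightarrow>
     isometry_rep A \<delta> D (\<lambda>a. f (Coeff a)) (f Extra) \<and> (\<forall>a. a \<notin> carrier A \<longrightarrow> f (Coeff a) = \<zero>\<^bsub>D\<^esub>)"
  unfolding ball_Un coeff_relations_eval isometry_rep_def isometry_relations_def ball_setcompr1 ball_setcompr2 ev_simps
  by (simp add: diff_eq_zero f D.adj_closed ev_simps Ball_def imp_conjL conj_ac)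

lemma crossed_relations_eval:
  "(\<forall>r\<in>coeff_relations A \<union> crossed_relations A \<delta> \<tau>. poly_eval D f r = \<zero>\<^bsub>D\<^esub>) \<longleftrightarrow>
     crossed_rep A \<delta> \<tau> D (\<lambda>a. f (Coeff a)) (f Extra) \<and> (\<forall>a. a \<notin> carrier A \<longrightarrow> f (Coeff a) = \<zero>\<^bsub>D\<^esub>)"
  unfolding ball_Un coeff_relations_eval crossed_rep_def crossed_relations_def ball_setcompr1 ball_setcompr2 ev_simps
  by (simp add: diff_eq_zero f D.adj_closed ev_simps Ball_def imp_conjL conj_ac)

end

lemma rep_cong:
  assumes "\<And>a. a \<in> carrier A \<Longrightarrow> \<pi> a = \<pi>' a" "unital_cstar_algebra A"
  shows "\<delta> \<in> carrier A \<rightarrow> carrier A \<Longrightarrow> isometry_rep A \<delta> D \<pi> t \<longleftrightarrow> isometry_rep A \<delta> D \<pi>' t"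
    and "\<delta> \<in> carrier A \<rightarrow> carrier A \<Longrightarrow> \<tau> \<in> carrier A \<rightarrow> carrier A \<Longrightarrow>
      crossed_rep A \<delta> \<tau> D \<pi> t \<longleftrightarrow> crossed_rep A \<delta> \<tau> D \<pi>' t"
proof -
  interpret A: unital_cstar_algebra A by (rule assms(2))
  have "unital_star_hom A D \<pi> \<longleftrightarrow> unital_star_hom A D \<pi>'"
    by (simp add: unital_star_hom_def star_hom_def assms(1) Pi_iff A.scale_closed A.adj_closed)
  then show "\<delta> \<in> carrier A \<rightarrow> carrier A \<Longrightarrow> isometry_rep A \<delta> D \<pi> t \<longleftrightarrow> isometry_rep A \<delta> D \<pi>' t"
    "\<delta> \<in> carrier A \<rightarrow> carrier A \<Longrightarrow> \<tau> \<in> carrier A \<rightarrow> carrier A \<Longrightarrow>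
      crossed_rep A \<delta> \<tau> D \<pi> t \<longleftrightarrow> crossed_rep A \<delta> \<tau> D \<pi>' t"
    by (auto simp: isometry_rep_def crossed_rep_def assms(1) Pi_iff)
qed

lemma univ_rep_universal:
  fixes A :: "'a cstar" and D :: "'d cstar"
  assumes A: "unital_cstar_algebra A" and D: "unital_cstar_algebra D"
    and adm: "admissible R" and R: "coeff_relations A \<subseteq> R"
    and \<pi>: "unital_star_hom A D \<pi>" and t: "t \<in> carrier D"
    and rel: "\<And>r. r \<in> R \<Longrightarrow>
      poly_eval D (case_generator (\<lambda>a. if a \<in> carrier A then \<pi> a else \<zero>\<^bsub>D\<^esub>) t) r = \<zero>\<^bsub>D\<^esub>"
  shows "\<exists>!\<phi>. \<phi> \<in> extensional (carrier (univ_cstar R)) \<and> star_hom (univ_cstar R) D \<phi> \<and>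
    \<phi> (univ_gen R Extra) = t \<and> (\<forall>a\<in>carrier A. \<phi> (univ_gen R (Coeff a)) = \<pi> a)"
proof -
  interpret admissible_relations R by standard (rule adm)
  interpret A: unital_cstar_algebra A by (rule A)
  interpret D: unital_cstar_algebra D by (rule D)
  interpret U: unital_cstar_algebra U by (rule univ_cstar_algebra)
  let ?f = "case_generator (\<lambda>a. if a \<in> carrier A then \<pi> a else \<zero>\<^bsub>D\<^esub>) t"
  have f: "?f g \<in> carrier D" for g
    using \<pi> t by (auto simp: unital_star_hom_def star_hom_def split: generator.split)
  note univ = univ_property[OF D f rel]
  have one: "univ_gen R (Coeff \<one>\<^bsub>A\<^esub>) = \<one>\<^bsub>U\<^esub>"
    using univ_relations[OF subsetD[OF R coeff_relations_one]]
    by (simp add: poly_eval_univ univ_gen_def univ_one univ_zero cls_eq_iff null_def)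
  have out: "univ_gen R (Coeff a) = \<zero>\<^bsub>U\<^esub>" if "a \<notin> carrier A" for a
    using univ_relations[OF subsetD[OF R coeff_relations_outside[OF that]]]
    by (simp add: poly_eval_univ univ_gen_def)
  obtain \<phi> where \<phi>: "star_hom U D \<phi>" "\<phi> \<one>\<^bsub>U\<^esub> = \<one>\<^bsub>D\<^esub>" "\<And>g. \<phi> (univ_gen R g) = ?f g"
    using univ(1) by blast
  have hom_zero: "\<psi> \<zero>\<^bsub>U\<^esub> = \<zero>\<^bsub>D\<^esub>" if "star_hom U D \<psi>" for \<psi>
  proof -
    have "\<psi> \<zero>\<^bsub>U\<^esub> = \<psi> (0 *\<^sub>C\<^bsub>U\<^esub> \<zero>\<^bsub>U\<^esub>)" by (simp add: U.scale_zero_left)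
    also have "\<dots> = 0 *\<^sub>C\<^bsub>D\<^esub> \<psi> \<zero>\<^bsub>U\<^esub>" using that by (simp add: star_hom_def)
    also have "\<dots> = \<zero>\<^bsub>D\<^esub>" using that by (intro D.scale_zero_left) (auto simp: star_hom_def)
    finally show ?thesis .
  qed
  have gens: "\<psi> \<one>\<^bsub>U\<^esub> = \<one>\<^bsub>D\<^esub> \<and> (\<forall>g. \<psi> (univ_gen R g) = ?f g)"
    if "star_hom U D \<psi>" "\<psi> (univ_gen R Extra) = t" "\<forall>a\<in>carrier A. \<psi> (univ_gen R (Coeff a)) = \<pi> a" for \<psi>
  proof
    show "\<psi> \<one>\<^bsub>U\<^esub> = \<one>\<^bsub>D\<^esub>" using that(3) one \<pi> A.one_closed by (metis unital_star_hom_def)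
    show "\<forall>g. \<psi> (univ_gen R g) = ?f g"
      using that out hom_zero[OF that(1)] by (auto split: generator.split)
  qed
  let ?\<phi> = "restrict \<phi> (carrier U)"
  have r: "star_hom U D ?\<phi>"
    using \<phi>(1) by (auto simp: star_hom_def U.scale_closed U.adj_closed)
  show ?thesis
  proof (rule ex1I[of _ ?\<phi>])
    show "?\<phi> \<in> extensional (carrier U) \<and> star_hom U D ?\<phi> \<and>
        ?\<phi> (univ_gen R Extra) = t \<and> (\<forall>a\<in>carrier A. ?\<phi> (univ_gen R (Coeff a)) = \<pi> a)"
      using r \<phi>(3) univ_gen_closed by simp
    fix \<psi>
    assume \<psi>: "\<psi> \<in> extensional (carrier U) \<and> star_hom U D \<psi> \<and>
        \<psi> (univ_gen R Extra) = t \<and> (\<forall>a\<in>carrier A. \<psi> (univ_gen R (Coeff a)) = \<pi> a)"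
    show "\<psi> = ?\<phi>"
    proof (rule extensionalityI[of _ "carrier U"])
      fix X assume X: "X \<in> carrier U"
      then show "\<psi> X = ?\<phi> X" using univ(2)[of \<psi> \<phi> X] gens[of \<psi>] \<psi> \<phi> by simp
    qed (use \<psi> in auto)
  qed
qed

text \<open>\<open>\<U>(A,\<delta>)\<close> is a unital C*-algebra in which the relations hold, and it is universal with this
  property: the target \<open>D\<close> below is an arbitrary unital C*-algebra, on an arbitrary type.\<close>

theorem isometry_algebra_rep:
  assumes A: "unital_cstar_algebra A"
  shows "unital_cstar_algebra (isometry_algebra A \<delta>)"
    and "isometry_rep A \<delta> (isometry_algebra A \<delta>) (isometry_algebra_coeff A \<delta>) (isometry_algebra_T A \<delta>)"
proof -
  let ?R = "coeff_relations A \<union> isometry_relations A \<delta>"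
  interpret admissible_relations ?R by standard (rule admissible_isometry[OF A])
  show "unital_cstar_algebra (isometry_algebra A \<delta>)"
    unfolding isometry_algebra_def by (rule univ_cstar_algebra)
  show "isometry_rep A \<delta> (isometry_algebra A \<delta>) (isometry_algebra_coeff A \<delta>) (isometry_algebra_T A \<delta>)"
    using isometry_relations_eval[where f = "univ_gen ?R", OF A univ_cstar_algebra univ_gen_closed, of \<delta>] univ_relations
    unfolding isometry_algebra_def isometry_algebra_coeff_def[abs_def] isometry_algebra_T_def by blast
qed

theorem isometry_algebra_universal:
  assumes A: "unital_cstar_algebra A" and \<delta>: "\<delta> \<in> carrier A \<rightarrow> carrier A"
    and D: "unital_cstar_algebra D" and rep: "isometry_rep A \<delta> D \<pi> t"
  shows "\<exists>!\<phi>. \<phi> \<in> extensional (carrier (isometry_algebra A \<delta>)) \<and> star_hom (isometry_algebra A \<delta>) D \<phi> \<and>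
    \<phi> (isometry_algebra_T A \<delta>) = t \<and> (\<forall>a\<in>carrier A. \<phi> (isometry_algebra_coeff A \<delta> a) = \<pi> a)"
proof -
  interpret D: unital_cstar_algebra D by (rule D)
  let ?f = "case_generator (\<lambda>a. if a \<in> carrier A then \<pi> a else \<zero>\<^bsub>D\<^esub>) t"
  have f: "?f g \<in> carrier D" for g
    using rep by (auto simp: isometry_rep_def unital_star_hom_def star_hom_def split: generator.split)
  have "isometry_rep A \<delta> D (\<lambda>a. ?f (Coeff a)) (?f Extra)"
    using rep rep_cong(1)[OF _ A \<delta>, of \<pi> "\<lambda>a. ?f (Coeff a)" D t] by simp
  then have rel: "\<forall>r\<in>coeff_relations A \<union> isometry_relations A \<delta>. poly_eval D ?f r = \<zero>\<^bsub>D\<^esub>"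
    using isometry_relations_eval[OF A D, of ?f \<delta>] f by auto
  show ?thesis
    unfolding isometry_algebra_def isometry_algebra_T_def isometry_algebra_coeff_def
    by (rule univ_rep_universal[OF A D admissible_isometry[OF A]])
      (use rep rel in \<open>auto simp: isometry_rep_def\<close>)
qed

theorem crossed_product_rep:
  assumes A: "unital_cstar_algebra A"
  shows "unital_cstar_algebra (crossed_product A \<delta>)"
    and "crossed_rep A \<delta> (the_complete_transfer A \<delta>) (crossed_product A \<delta>)
      (crossed_product_coeff A \<delta>) (crossed_product_U A \<delta>)"
proof -
  let ?R = "crossed_product_relations A \<delta>"
  interpret admissible_relations ?R
    unfolding crossed_product_relations_def by standard (rule admissible_crossed[OF A])
  show "unital_cstar_algebra (crossed_product A \<delta>)"
    unfolding crossed_product_def by (rule univ_cstar_algebra)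
  show "crossed_rep A \<delta> (the_complete_transfer A \<delta>) (crossed_product A \<delta>)
      (crossed_product_coeff A \<delta>) (crossed_product_U A \<delta>)"
    using crossed_relations_eval[where f = "univ_gen ?R" and \<delta> = \<delta> and \<tau> = "the_complete_transfer A \<delta>",
        OF A univ_cstar_algebra univ_gen_closed]
      univ_relations
    unfolding crossed_product_def crossed_product_coeff_def[abs_def] crossed_product_U_def
      crossed_product_relations_def by blast
qed

theorem crossed_product_universal:
  assumes A: "unital_cstar_algebra A" and \<delta>: "\<delta> \<in> carrier A \<rightarrow> carrier A"
    and ex: "complete_transfer_operator A \<delta> \<tau>"
    and D: "unital_cstar_algebra D" and rep: "crossed_rep A \<delta> (the_complete_transfer A \<delta>) D \<pi> u"
  shows "\<exists>!\<phi>. \<phi> \<in> extensional (carrier (crossed_product A \<delta>)) \<and> star_hom (crossed_product A \<delta>) D \<phi> \<and>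
    \<phi> (crossed_product_U A \<delta>) = u \<and> (\<forall>a\<in>carrier A. \<phi> (crossed_product_coeff A \<delta> a) = \<pi> a)"
proof -
  interpret D: unital_cstar_algebra D by (rule D)
  let ?\<tau> = "the_complete_transfer A \<delta>"
  have "complete_transfer_operator A \<delta> ?\<tau>" 
    unfolding the_complete_transfer_def by (rule someI[of "complete_transfer_operator A \<delta>" \<tau>, OF ex])
  then have \<tau>: "?\<tau> \<in> carrier A \<rightarrow> carrier A"
    by (simp add: complete_transfer_operator_def transfer_operator_def)
  let ?f = "case_generator (\<lambda>a. if a \<in> carrier A then \<pi> a else \<zero>\<^bsub>D\<^esub>) u"
  have f: "?f g \<in> carrier D" for g
    using rep by (auto simp: crossed_rep_def unital_star_hom_def star_hom_def split: generator.split)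
  have "crossed_rep A \<delta> ?\<tau> D (\<lambda>a. ?f (Coeff a)) (?f Extra)"
    using rep rep_cong(2)[OF _ A \<delta> \<tau>, of \<pi> "\<lambda>a. ?f (Coeff a)" D u] by simp
  then have rel: "\<forall>r\<in>coeff_relations A \<union> crossed_relations A \<delta> ?\<tau>. poly_eval D ?f r = \<zero>\<^bsub>D\<^esub>"
    using crossed_relations_eval[OF A D, of ?f \<delta> ?\<tau>] f by auto
  show ?thesis
    unfolding crossed_product_def crossed_product_U_def crossed_product_coeff_def crossed_product_relations_def
    by (rule univ_rep_universal[OF A D admissible_crossed[OF A]])
      (use rep rel in \<open>auto simp: crossed_rep_def\<close>)
qed


end

theory Submission
  imports Defs
begin

text \<open>Both algebras are universal, so it suffices that their defining relations have the same
  solutions \<open>(\<pi>, t)\<close> in every unital C*-algebra. Write \<open>p = \<delta>(1)\<close>, and let \<open>\<tau>\<close> be a complete transfer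
  operator, so that \<open>\<delta>(\<tau>(a)) = p a p\<close>.

  If \<open>t\<close> is an isometry with \<open>\<pi>(\<delta>(a)) = t \<pi>(a) t\<^sup>\<star>\<close>, then \<open>\<pi>(p) = t t\<^sup>\<star>\<close>, and cancelling \<open>t\<^sup>\<star> t = 1\<close> gives
  \<open>\<pi>(\<tau>(a)) = t\<^sup>\<star> \<pi>(\<delta>(\<tau>(a))) t = t\<^sup>\<star> (t t\<^sup>\<star>) \<pi>(a) (t t\<^sup>\<star>) t = t\<^sup>\<star> \<pi>(a) t\<close>. Conversely
  \<open>\<delta>(\<tau>(1)) = p = \<delta>(1)\<close> and injectivity give \<open>\<tau>(1) = 1\<close>, so the relation \<open>\<pi>(\<tau>(1)) = t\<^sup>\<star> \<pi>(1) t\<close> says that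
  \<open>t\<close> is an isometry (lemma \<open>isometry_rep_iff_crossed_rep\<close>).

  What remains is that \<open>\<tau>\<close> exists, and this is where the hereditary range enters. If \<open>a\<close> is positive, then
  \<open>0 \<le> p a p \<le> \<parallel>a\<parallel> p\<close> with \<open>p\<close> in the range of \<open>\<delta>\<close>, so \<open>p a p\<close> is in the range; by linearity \<open>\<delta>\<close> maps
  onto the corner \<open>p A p\<close> (lemma \<open>compress_range\<close>), and \<open>\<tau>(a) = \<delta>\<^sup>-\<^sup>1(p a p)\<close> makes sense. Its
  algebraic properties are immediate. Positivity holds because the square root of an element of the corner
  commutes with \<open>p\<close>, so that the root can be compressed back into the range of \<open>\<delta>\<close>
  (lemma \<open>reflects_nonneg\<close>). Continuity follows, since a homomorphism which
  reflects the order does not decrease norms (lemma \<open>norm_le_\<delta>\<close>).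

  These arguments use the order of a C*-algebra, in particular Kaplansky's theorem that \<open>y\<^sup>\<star> y\<close> has a
  positive square root (theorem \<open>nonneg_adj_mult\<close>). It is derived here without spectral theory: positivity
  is encoded by a norm estimate, for which square roots come from the iteration behind
  \<open>sqrt_one_minus\<close>.\<close>


section \<open>The positive cone of a unital C*-algebra\<close>

context unital_cstar_algebra
begin

text \<open>The norm condition says that the spectrum of the self-adjoint \<open>a\<close> lies in \<open>[0, 2K]\<close>. In this form, closure
  under addition is the triangle inequality.\<close>

definition nonneg :: "'a \<Rightarrow> bool" where
  "nonneg a \<longleftrightarrow> a \<in> carrier A \<and> a\<^sup>\<star> = a \<and> (\<exists>K\<ge>0. \<parallel>complex_of_real K *\<^sub>C \<one> \<ominus> a\<parallel> \<le> K)"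

lemma nonneg_closed: "nonneg a \<Longrightarrow> a \<in> carrier A"
  and nonneg_adj: "nonneg a \<Longrightarrow> a\<^sup>\<star> = a"
  by (simp_all add: nonneg_def)

lemma nonneg_zero: "nonneg \<zero>"
  by (auto simp: nonneg_def scale_zero_left minus_eq intro!: exI[of _ 0])

lemma scale_one_mult: "x \<in> carrier A \<Longrightarrow> (c *\<^sub>C \<one>) \<otimes> x = c *\<^sub>C x"
  and mult_scale_one: "x \<in> carrier A \<Longrightarrow> x \<otimes> (c *\<^sub>C \<one>) = c *\<^sub>C x"
  by (simp_all add: mult_scale_left mult_scale_right)

lemma norm_scale_one_le: "K \<ge> 0 \<Longrightarrow> \<parallel>complex_of_real K *\<^sub>C \<one>\<parallel> \<le> K"
  using mult_left_mono[OF norm_one_le, of K] by (simp add: norm_scale)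

lemma nonneg_add:
  assumes "nonneg a" "nonneg b" shows "nonneg (a \<oplus> b)"
proof -
  obtain K L where K: "K \<ge> 0" "\<parallel>complex_of_real K *\<^sub>C \<one> \<ominus> a\<parallel> \<le> K"
    and L: "L \<ge> 0" "\<parallel>complex_of_real L *\<^sub>C \<one> \<ominus> b\<parallel> \<le> L" using assms by (auto simp: nonneg_def)
  have c: "a \<in> carrier A" "b \<in> carrier A" "complex_of_real K *\<^sub>C \<one> \<in> carrier A" "complex_of_real L *\<^sub>C \<one> \<in> carrier A"
    using assms by (simp_all add: nonneg_closed cl)
  have "complex_of_real (K + L) *\<^sub>C \<one> \<ominus> (a \<oplus> b) =
      (complex_of_real K *\<^sub>C \<one> \<ominus> a) \<oplus> (complex_of_real L *\<^sub>C \<one> \<ominus> b)"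
    using c unfolding of_real_add scale_left_distrib[OF one_closed] by algebra
  then have "\<parallel>complex_of_real (K + L) *\<^sub>C \<one> \<ominus> (a \<oplus> b)\<parallel> \<le> K + L"
    using norm_triangle[of "complex_of_real K *\<^sub>C \<one> \<ominus> a" "complex_of_real L *\<^sub>C \<one> \<ominus> b"] K L c by simp
  then show ?thesis using K L c assms
    unfolding nonneg_def by (auto simp: adj_add intro!: exI[of _ "K + L"])
qed

lemma nonneg_scale:
  assumes "nonneg a" "r \<ge> 0" shows "nonneg (complex_of_real r *\<^sub>C a)"
proof -
  obtain K where K: "K \<ge> 0" "\<parallel>complex_of_real K *\<^sub>C \<one> \<ominus> a\<parallel> \<le> K" using assms by (auto simp: nonneg_def)
  have a: "a \<in> carrier A" "a\<^sup>\<star> = a" using assms by (simp_all add: nonneg_def)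
  have "complex_of_real (r * K) *\<^sub>C \<one> \<ominus> complex_of_real r *\<^sub>C a = complex_of_real r *\<^sub>C (complex_of_real K *\<^sub>C \<one> \<ominus> a)"
    using a by (simp add: scale_diff cl scale_scale)
  then have "\<parallel>complex_of_real (r * K) *\<^sub>C \<one> \<ominus> complex_of_real r *\<^sub>C a\<parallel> \<le> r * K"
    using K a assms(2) by (simp add: norm_scale cl mult_left_mono)
  then show ?thesis using K a assms(2)
    unfolding nonneg_def by (auto simp: adj_scale cl intro!: exI[of _ "r * K"])
qed

lemma nonneg_const_minus:
  assumes "a \<in> carrier A" "a\<^sup>\<star> = a" "\<parallel>a\<parallel> \<le> K" shows "nonneg (complex_of_real K *\<^sub>C \<one> \<ominus> a)"
proof -
  have "complex_of_real K *\<^sub>C \<one> \<ominus> (complex_of_real K *\<^sub>C \<one> \<ominus> a) = a"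
    using assms(1) scale_closed[OF one_closed, of "complex_of_real K"] by algebra
  moreover have "K \<ge> 0" using norm_nonneg[OF assms(1)] assms(3) by linarith
  ultimately show ?thesis using assms
    unfolding nonneg_def by (auto simp: adj_diff adj_scale cl intro!: exI[of _ K])
qed

text \<open>After scaling, \<open>a = K(1 - x)\<close> with \<open>\<parallel>x\<parallel> \<le> 1\<close>, and the iteration for \<open>1 - x\<close> produces a root
  \<open>1 - z\<close> with \<open>\<parallel>z\<parallel> \<le> 1\<close>; hence the root is itself nonnegative. Commutation with everything that commutes
  with \<open>a\<close> replaces functional calculus below.\<close>

lemma nonneg_root:
  assumes "nonneg a"
  obtains s where "nonneg s" "s \<otimes> s = a" "\<And>c. c \<in> carrier A \<Longrightarrow> c \<otimes> a = a \<otimes> c \<Longrightarrow> c \<otimes> s = s \<otimes> c"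
proof -
  obtain K where K: "K \<ge> 0" "\<parallel>complex_of_real K *\<^sub>C \<one> \<ominus> a\<parallel> \<le> K" using assms by (auto simp: nonneg_def)
  have a: "a \<in> carrier A" "a\<^sup>\<star> = a" using assms by (simp_all add: nonneg_def)
  show thesis
  proof (cases "K = 0")
    case True
    then have "\<parallel>a\<parallel> = 0" using K a norm_minus[OF a(1)] norm_nonneg[OF a(1)] by (simp add: scale_zero_left minus_eq)
    then have "a = \<zero>" using a norm_eq_zero by simp
    then show thesis using that[of \<zero>] nonneg_zero by simp
  next
    case False
    then have K0: "K > 0" using K by simp
    define x where "x = complex_of_real (1 / K) *\<^sub>C (complex_of_real K *\<^sub>C \<one> \<ominus> a)"
    have x: "x \<in> carrier A" "x\<^sup>\<star> = x" "\<parallel>x\<parallel> \<le> 1"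
      using K K0 a by (simp_all add: x_def cl adj_scale adj_diff norm_scale norm_divide field_simps)
    obtain z where z: "z \<in> carrier A" "z\<^sup>\<star> = z" "\<parallel>z\<parallel> \<le> 1" "2 *\<^sub>C z = x \<oplus> z \<otimes> z"
      and zc: "\<And>c. c \<in> carrier A \<Longrightarrow> c \<otimes> x = x \<otimes> c \<Longrightarrow> c \<otimes> z = z \<otimes> c"
      using sqrt_one_minus[OF x] by metis
    let ?s = "complex_of_real (sqrt K) *\<^sub>C (\<one> \<ominus> z)"
    have x1: "x = \<one> \<ominus> complex_of_real (1 / K) *\<^sub>C a"
      unfolding x_def using a K0 by (simp add: scale_diff cl scale_scale scale_one)
    have zz: "z \<oplus> z = x \<oplus> z \<otimes> z" using z scale_left_distrib[of z 1 1] by (simp add: scale_one)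
    have "(\<one> \<ominus> z) \<otimes> (\<one> \<ominus> z) = (\<one> \<oplus> z \<otimes> z) \<ominus> (z \<oplus> z)" using z(1) by (simp add: ring_simprules)
    also have "\<dots> = \<one> \<ominus> x" unfolding zz using z(1) x(1) by algebra
    also have "\<dots> = complex_of_real (1 / K) *\<^sub>C a"
      unfolding x1 using scale_closed[OF a(1), of "complex_of_real (1 / K)"] by algebra
    finally have sq: "(\<one> \<ominus> z) \<otimes> (\<one> \<ominus> z) = complex_of_real (1 / K) *\<^sub>C a" .
    have "?s \<otimes> ?s = complex_of_real (sqrt K * sqrt K) *\<^sub>C ((\<one> \<ominus> z) \<otimes> (\<one> \<ominus> z))"
      using z(1) by (simp add: mult_scale_left mult_scale_right cl scale_scale del: real_sqrt_mult_self)
    also have "\<dots> = a" using K0 a unfolding sq by (simp add: scale_scale scale_one)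
    finally have s2: "?s \<otimes> ?s = a" .
    have "nonneg (complex_of_real 1 *\<^sub>C \<one> \<ominus> z)" by (rule nonneg_const_minus) (use z in auto)
    then have "nonneg ?s" using K0 by (intro nonneg_scale) (simp_all add: scale_one)
    moreover have "c \<otimes> ?s = ?s \<otimes> c" if c: "c \<in> carrier A" "c \<otimes> a = a \<otimes> c" for c
    proof -
      have "c \<otimes> x = x \<otimes> c"
        unfolding x1 minus_eq_scale[OF one_closed scale_closed[OF a(1)]] using c a z(1)
        by (simp add: r_distr l_distr cl mult_scale_left mult_scale_right)
      then have "c \<otimes> z = z \<otimes> c" using zc c by simp
      then show ?thesis
        unfolding minus_eq_scale[OF one_closed z(1)] using c a z(1)
        by (simp add: r_distr l_distr cl mult_scale_left mult_scale_right)
    qed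
    ultimately show thesis using that s2 by blast
  qed
qed

text \<open>If \<open>h\<close> and \<open>k\<close> are commuting and self-adjoint, both \<open>u = h \<plusminus> i k\<close> satisfy
  \<open>u\<^sup>\<star> u = h\<^sup>2 + k\<^sup>2\<close>, and \<open>h\<close> is their mean.\<close>

lemma norm_commuting_squares:
  assumes h: "h \<in> carrier A" "h\<^sup>\<star> = h" and k: "k \<in> carrier A" "k\<^sup>\<star> = k"
    and hk: "h \<otimes> k = k \<otimes> h" and sum: "h \<otimes> h \<oplus> k \<otimes> k = c" and c: "\<parallel>c\<parallel> \<le> K"
  shows "\<parallel>h \<otimes> h\<parallel> \<le> K"
proof -
  have unit: "\<parallel>h \<oplus> e *\<^sub>C k\<parallel> \<le> sqrt K" if e: "cnj e = - e" "e * e = - 1" for e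
  proof -
    let ?w = "e *\<^sub>C k"
    have w: "?w \<in> carrier A" using k by (simp add: cl)
    have ws: "?w\<^sup>\<star> = \<ominus> ?w"
      using k e by (simp add: adj_scale scale_scale cl flip: scale_minus_one)
    have ww: "?w \<otimes> ?w = \<ominus> (k \<otimes> k)"
      using k e by (simp add: mult_scale_left mult_scale_right scale_scale cl flip: scale_minus_one)
    have hw: "h \<otimes> ?w = ?w \<otimes> h" using h k hk by (simp add: mult_scale_left mult_scale_right)
    have "(h \<oplus> ?w)\<^sup>\<star> \<otimes> (h \<oplus> ?w) = (h \<ominus> ?w) \<otimes> (h \<oplus> ?w)"
      using h w ws by (simp add: adj_add minus_eq)
    also have "\<dots> = (h \<otimes> h \<ominus> ?w \<otimes> ?w) \<oplus> (h \<otimes> ?w \<ominus> ?w \<otimes> h)" using h w by algebra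
    also have "\<dots> = h \<otimes> h \<oplus> k \<otimes> k" unfolding hw ww using h k w by algebra
    finally have "\<parallel>h \<oplus> ?w\<parallel>\<^sup>2 \<le> K" using cstar_identity[of "h \<oplus> ?w"] sum c h w by simp
    then show ?thesis by (rule real_le_rsqrt)
  qed
  have "2 *\<^sub>C h = (h \<oplus> \<i> *\<^sub>C k) \<oplus> (h \<oplus> (- \<i>) *\<^sub>C k)"
  proof -
    have "(h \<oplus> \<i> *\<^sub>C k) \<oplus> (h \<oplus> (- \<i>) *\<^sub>C k) = (h \<oplus> h) \<oplus> (\<i> *\<^sub>C k \<oplus> (- \<i>) *\<^sub>C k)"
      using h k scale_closed[of k \<i>] scale_closed[of k "- \<i>"] by algebra
    also have "\<i> *\<^sub>C k \<oplus> (- \<i>) *\<^sub>C k = \<zero>"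
      using k by (simp add: scale_zero_left flip: scale_left_distrib)
    finally show ?thesis using h scale_left_distrib[of h 1 1] by (simp add: scale_one)
  qed
  then have "2 * \<parallel>h\<parallel> \<le> \<parallel>h \<oplus> \<i> *\<^sub>C k\<parallel> + \<parallel>h \<oplus> (- \<i>) *\<^sub>C k\<parallel>"
    using norm_triangle[of "h \<oplus> \<i> *\<^sub>C k" "h \<oplus> (- \<i>) *\<^sub>C k"] norm_scale[of h 2] h k by (simp add: cl)
  then have "\<parallel>h\<parallel> \<le> sqrt K" using unit[of \<i>] unit[of "- \<i>"] by simp
  then have "\<parallel>h\<parallel>\<^sup>2 \<le> K"
    using norm_nonneg[OF h(1)] by (metis real_sqrt_ge_0_iff order_trans real_sqrt_pow2 power_mono)
  then show ?thesis using cstar_identity[of h] h by simp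
qed

text \<open>Let \<open>m\<close> be the root of \<open>K - s\<^sup>2\<close>; then \<open>s\<^sup>2 + m\<^sup>2 = K\<close> and the previous lemma bounds both
  summands.\<close>

lemma square_le_const:
  assumes s: "s \<in> carrier A" "s\<^sup>\<star> = s" and K: "K \<ge> 0"
    and le: "nonneg (complex_of_real K *\<^sub>C \<one> \<ominus> s \<otimes> s)"
  shows "\<parallel>s \<otimes> s\<parallel> \<le> K" and "\<parallel>complex_of_real K *\<^sub>C \<one> \<ominus> s \<otimes> s\<parallel> \<le> K"
proof -
  let ?c = "complex_of_real K *\<^sub>C \<one>"
  have c: "?c \<in> carrier A" by (simp add: cl)
  obtain m where m: "nonneg m" "m \<otimes> m = ?c \<ominus> s \<otimes> s"
    and comm: "\<And>x. x \<in> carrier A \<Longrightarrow> x \<otimes> (?c \<ominus> s \<otimes> s) = (?c \<ominus> s \<otimes> s) \<otimes> x \<Longrightarrow> x \<otimes> m = m \<otimes> x"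
    using nonneg_root[OF le] by metis
  have "s \<otimes> ?c = ?c \<otimes> s" using s by (simp add: scale_one_mult mult_scale_one)
  then have "s \<otimes> (?c \<ominus> s \<otimes> s) = (?c \<ominus> s \<otimes> s) \<otimes> s"
    using s(1) c by (simp add: minus_eq r_distr l_distr r_minus l_minus m_assoc)
  from comm[OF s(1) this] have sm: "s \<otimes> m = m \<otimes> s" .
  have sum: "s \<otimes> s \<oplus> m \<otimes> m = ?c" unfolding m(2) using s(1) c by algebra
  note mc = nonneg_closed[OF m(1)] nonneg_adj[OF m(1)]
  show "\<parallel>s \<otimes> s\<parallel> \<le> K"
    by (rule norm_commuting_squares[OF s mc sm sum norm_scale_one_le[OF K]])
  have sum': "m \<otimes> m \<oplus> s \<otimes> s = ?c" using sum s(1) mc(1) by (simp add: a_comm)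
  show "\<parallel>?c \<ominus> s \<otimes> s\<parallel> \<le> K"
    using norm_commuting_squares[OF mc s sm[symmetric] sum' norm_scale_one_le[OF K]] by (simp add: m(2))
qed

lemma nonneg_square:
  assumes s: "s \<in> carrier A" "s\<^sup>\<star> = s" shows "nonneg (s \<otimes> s)"
proof -
  have a: "s \<otimes> s \<in> carrier A" "(s \<otimes> s)\<^sup>\<star> = s \<otimes> s" using s by (simp_all add: adj_mult)
  from square_le_const(2)[OF s norm_nonneg[OF a(1)] nonneg_const_minus[OF a order_refl]]
  show ?thesis unfolding nonneg_def using a norm_nonneg[OF a(1)] by blast
qed

text \<open>With \<open>K = \<parallel>a + b\<parallel>\<close>, also \<open>K - a = (K - (a + b)) + b\<close> is nonnegative.\<close>

lemma norm_mono:
  assumes "nonneg a" "nonneg b" shows "\<parallel>a\<parallel> \<le> \<parallel>a \<oplus> b\<parallel>"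
proof -
  let ?K = "\<parallel>a \<oplus> b\<parallel>"
  let ?c = "complex_of_real ?K *\<^sub>C \<one>"
  have a: "a \<in> carrier A" "b \<in> carrier A" using assms by (simp_all add: nonneg_closed)
  have c: "?c \<in> carrier A" by (simp add: cl)
  have "nonneg ((?c \<ominus> (a \<oplus> b)) \<oplus> b)"
    using assms nonneg_add[OF assms] by (intro nonneg_add nonneg_const_minus) (simp_all add: nonneg_closed nonneg_adj)
  also have "(?c \<ominus> (a \<oplus> b)) \<oplus> b = ?c \<ominus> a" using a c by algebra
  finally have ca: "nonneg (?c \<ominus> a)" .
  obtain s where s: "nonneg s" "s \<otimes> s = a" using nonneg_root[OF assms(1)] by metis
  have "\<parallel>s \<otimes> s\<parallel> \<le> ?K"
    by (rule square_le_const(1)) (use s ca a in \<open>simp_all add: nonneg_closed nonneg_adj norm_nonneg\<close>)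
  then show ?thesis using s by simp
qed

lemma imaginary_part_adj:
  assumes v: "v \<in> carrier A" shows "(\<i> *\<^sub>C (v \<ominus> v\<^sup>\<star>))\<^sup>\<star> = \<i> *\<^sub>C (v \<ominus> v\<^sup>\<star>)"
proof -
  have vs: "v\<^sup>\<star> \<in> carrier A" using v by (rule adj_closed)
  have "(\<i> *\<^sub>C (v \<ominus> v\<^sup>\<star>))\<^sup>\<star> = (- \<i>) *\<^sub>C (v\<^sup>\<star> \<ominus> v)" using v vs by (simp add: adj_scale adj_diff adj_adj)
  also have "\<dots> = \<i> *\<^sub>C (v \<ominus> v\<^sup>\<star>)" using v vs scale_minus_one[of "v\<^sup>\<star> \<ominus> v"]
      scale_scale[of "v\<^sup>\<star> \<ominus> v" \<i> "- 1"] by (simp add: minus_eq minus_add a_comm)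
  finally show ?thesis .
qed

text \<open>Scale \<open>w\<close> to an element \<open>v\<close> of norm one, and let \<open>b = - v\<^sup>\<star> v\<close> and \<open>q = v v\<^sup>\<star>\<close>. Since
  \<open>v\<^sup>\<star> v + v v\<^sup>\<star>\<close> is a sum of squares of self-adjoint elements, \<open>b \<ge> 0\<close> forces \<open>q \<ge> 0\<close>. Usually one then
  compares the spectra of \<open>v\<^sup>\<star> v\<close> and \<open>v v\<^sup>\<star>\<close>. A norm estimate replaces this: the identity
  \<open>(1 - q) v = v (1 + b)\<close> holds, where the left side has norm at most \<open>1\<close>, while the right side has
  squared norm \<open>\<parallel>(1 + b) b (1 + b)\<parallel> = \<parallel>b + 2 b\<^sup>2 + b\<^sup>3\<parallel> \<ge> 2 \<parallel>b\<parallel>\<^sup>2 = 2\<close>.\<close>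

lemma adj_mult_nonpos:
  assumes w: "w \<in> carrier A" and neg: "nonneg (\<ominus> (w\<^sup>\<star> \<otimes> w))"
  shows "w = \<zero>"
proof (rule ccontr)
  assume "w \<noteq> \<zero>"
  then have pos: "\<parallel>w\<parallel> > 0" using norm_eq_zero[OF w] norm_nonneg[OF w] by linarith
  define e where "e = complex_of_real (1 / \<parallel>w\<parallel>)"
  define v where "v = e *\<^sub>C w"
  define b where "b = \<ominus> (v\<^sup>\<star> \<otimes> v)"
  define q where "q = v \<otimes> v\<^sup>\<star>"
  have v: "v \<in> carrier A" and vs: "v\<^sup>\<star> \<in> carrier A" and nv: "\<parallel>v\<parallel> = 1"
    using w pos by (simp_all add: v_def e_def cl norm_scale norm_divide)
  have vv: "v\<^sup>\<star> \<otimes> v = \<ominus> b" using v vs by (simp add: b_def)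
  have bc: "b \<in> carrier A" and qc: "q \<in> carrier A" using v vs by (simp_all add: b_def q_def)
  have "b = complex_of_real ((1 / \<parallel>w\<parallel>) * (1 / \<parallel>w\<parallel>)) *\<^sub>C (\<ominus> (w\<^sup>\<star> \<otimes> w))"
    unfolding b_def v_def e_def of_real_mult using w
    by (simp add: adj_scale mult_scale_left mult_scale_right scale_scale cl mult.commute flip: scale_minus_one)
  then have b: "nonneg b" using nonneg_scale[OF neg, of "(1 / \<parallel>w\<parallel>) * (1 / \<parallel>w\<parallel>)"] by simp
  have nb: "\<parallel>b\<parallel> = 1" using cstar_identity[OF v] nv norm_minus[OF bc] by (simp add: vv)
  have nq: "\<parallel>q\<parallel> = 1" using cstar_identity[OF vs] nv norm_adj[OF v] v by (simp add: q_def adj_adj)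
  have q: "nonneg q"
  proof -
    let ?g = "v \<oplus> v\<^sup>\<star>" and ?h = "\<i> *\<^sub>C (v \<ominus> v\<^sup>\<star>)"
    have g: "nonneg (?g \<otimes> ?g)"
      by (rule nonneg_square) (use v vs in \<open>simp_all add: adj_add adj_adj a_comm\<close>)
    have h: "nonneg (?h \<otimes> ?h)"
      by (rule nonneg_square) (use v vs in \<open>simp_all add: cl imaginary_part_adj\<close>)
    have "?h \<otimes> ?h = \<ominus> ((v \<ominus> v\<^sup>\<star>) \<otimes> (v \<ominus> v\<^sup>\<star>))"
      using v vs by (simp add: mult_scale_left mult_scale_right scale_scale cl flip: scale_minus_one)
    then have "?g \<otimes> ?g \<oplus> ?h \<otimes> ?h \<oplus> (b \<oplus> b) = (v \<oplus> v\<^sup>\<star>) \<otimes> (v \<oplus> v\<^sup>\<star>) \<ominus> (v \<ominus> v\<^sup>\<star>) \<otimes> (v \<ominus> v\<^sup>\<star>) \<ominus> (v\<^sup>\<star> \<otimes> v \<oplus> v\<^sup>\<star> \<otimes> v)"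
      using v vs by (simp add: b_def minus_eq minus_add)
    also have "\<dots> = q \<oplus> q" unfolding q_def using v vs by algebra
    also have "\<dots> = 2 *\<^sub>C q" using scale_left_distrib[OF qc, of 1 1] qc by (simp add: scale_one)
    finally have "nonneg (2 *\<^sub>C q)" using nonneg_add[OF nonneg_add[OF g h] nonneg_add[OF b b]] by simp
    from nonneg_scale[OF this, of "1/2"] show ?thesis using qc by (simp add: scale_scale scale_one)
  qed
  have "\<parallel>\<one> \<ominus> q\<parallel> \<le> 1"
  proof -
    have "nonneg (complex_of_real 1 *\<^sub>C \<one> \<ominus> q)"
      by (rule nonneg_const_minus) (use q nq in \<open>simp_all add: nonneg_closed nonneg_adj\<close>)
    then have "\<parallel>\<one> \<ominus> q\<parallel> \<le> \<parallel>(\<one> \<ominus> q) \<oplus> q\<parallel>" by (intro norm_mono q) (simp add: scale_one)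
    also have "(\<one> \<ominus> q) \<oplus> q = \<one>" using qc by algebra
    finally show ?thesis using norm_one_le by simp
  qed
  then have le: "\<parallel>(\<one> \<ominus> q) \<otimes> v\<parallel> \<le> 1"
    using norm_mult[of "\<one> \<ominus> q" v] qc v nv by simp
  have "(\<one> \<ominus> q) \<otimes> v = v \<ominus> v \<otimes> (v\<^sup>\<star> \<otimes> v)"
    unfolding q_def using v vs by (simp add: minus_eq l_distr l_minus m_assoc)
  also have "\<dots> = v \<otimes> (\<one> \<oplus> b)" unfolding vv using v bc by (simp add: minus_eq r_distr r_minus)
  finally have eq: "(\<one> \<ominus> q) \<otimes> v = v \<otimes> (\<one> \<oplus> b)" .
  have "(v \<otimes> (\<one> \<oplus> b))\<^sup>\<star> \<otimes> (v \<otimes> (\<one> \<oplus> b)) = (\<one> \<oplus> b) \<otimes> (v\<^sup>\<star> \<otimes> v) \<otimes> (\<one> \<oplus> b)"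
    using v vs bc b by (simp add: adj_mult adj_add nonneg_adj m_assoc)
  also have "\<dots> = \<ominus> (b \<oplus> (b \<otimes> b \<oplus> b \<otimes> b) \<oplus> b \<otimes> b \<otimes> b)"
    unfolding vv using bc by (simp add: ring_simprules)
  finally have "\<parallel>b \<oplus> (b \<otimes> b \<oplus> b \<otimes> b) \<oplus> b \<otimes> b \<otimes> b\<parallel> = \<parallel>v \<otimes> (\<one> \<oplus> b)\<parallel>\<^sup>2"
    using cstar_identity[of "v \<otimes> (\<one> \<oplus> b)"] v bc by (simp add: norm_minus)
  then have up: "\<parallel>b \<oplus> (b \<otimes> b \<oplus> b \<otimes> b) \<oplus> b \<otimes> b \<otimes> b\<parallel> \<le> 1"
    using le norm_nonneg[of "v \<otimes> (\<one> \<oplus> b)"] v bc by (simp add: eq power_le_one)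
  obtain s where s: "nonneg s" "s \<otimes> s = b" using nonneg_root[OF b] by metis
  note sc = nonneg_closed[OF s(1)]
  have "nonneg ((s \<otimes> b) \<otimes> (s \<otimes> b))"
    by (rule nonneg_square) (use s sc in \<open>simp_all add: adj_mult nonneg_adj m_assoc flip: s(2)\<close>)
  also have "(s \<otimes> b) \<otimes> (s \<otimes> b) = b \<otimes> b \<otimes> b" unfolding s(2)[symmetric] using sc by (simp add: m_assoc)
  finally have b3: "nonneg (b \<otimes> b \<otimes> b)" .
  have b2: "nonneg (b \<otimes> b)" using b by (intro nonneg_square) (simp_all add: nonneg_closed nonneg_adj)
  have "\<parallel>b \<otimes> b \<oplus> b \<otimes> b\<parallel> \<le> \<parallel>(b \<otimes> b \<oplus> b \<otimes> b) \<oplus> (b \<oplus> b \<otimes> b \<otimes> b)\<parallel>"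
    by (intro norm_mono nonneg_add b b2 b3)
  also have "(b \<otimes> b \<oplus> b \<otimes> b) \<oplus> (b \<oplus> b \<otimes> b \<otimes> b) = b \<oplus> (b \<otimes> b \<oplus> b \<otimes> b) \<oplus> b \<otimes> b \<otimes> b"
    using bc by algebra
  also have "\<parallel>\<dots>\<parallel> \<le> 1" by (rule up)
  finally have "\<parallel>2 *\<^sub>C (b \<otimes> b)\<parallel> \<le> 1"
    using scale_left_distrib[of "b \<otimes> b" 1 1] bc by (simp add: scale_one)
  moreover have "\<parallel>b \<otimes> b\<parallel> = 1" using cstar_identity[OF bc] nb b by (simp add: nonneg_adj)
  ultimately show False using bc by (simp add: norm_scale)
qed

text \<open>Put \<open>a = y\<^sup>\<star> y\<close> and let \<open>s = \<bar>a\<bar>\<close> be the nonnegative root of \<open>a\<^sup>2\<close>. Then \<open>n = s - a\<close> is twice the negative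
  part of \<open>a\<close>, so \<open>n a = - n s\<close>. Hence \<open>(y n)\<^sup>\<star> (y n) = n a n = - n s n\<close> is nonpositive, and
  the previous lemma gives \<open>y n = 0\<close>. It follows that \<open>n = 0\<close>, that is, \<open>a = s\<close>.\<close>

theorem nonneg_adj_mult:
  assumes y: "y \<in> carrier A" shows "nonneg (y\<^sup>\<star> \<otimes> y)"
proof -
  define a where "a = y\<^sup>\<star> \<otimes> y"
  have a: "a \<in> carrier A" "a\<^sup>\<star> = a" using y by (simp_all add: a_def adj_mult adj_adj cl)
  obtain s where s: "nonneg s" "s \<otimes> s = a \<otimes> a"
    and scomm: "\<And>c. c \<in> carrier A \<Longrightarrow> c \<otimes> (a \<otimes> a) = (a \<otimes> a) \<otimes> c \<Longrightarrow> c \<otimes> s = s \<otimes> c"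
    using nonneg_root[OF nonneg_square[OF a]] by metis
  note sc = nonneg_closed[OF s(1)]
  have as: "a \<otimes> s = s \<otimes> a" using scomm[OF a(1)] a by (simp add: m_assoc)
  \<comment> \<open>The root \<open>r\<close> of \<open>s\<close> exhibits \<open>n s n\<close> as the square of the self-adjoint element \<open>n r\<close>.\<close>
  obtain r where r: "nonneg r" "r \<otimes> r = s"
    and rcomm: "\<And>c. c \<in> carrier A \<Longrightarrow> c \<otimes> s = s \<otimes> c \<Longrightarrow> c \<otimes> r = r \<otimes> c"
    using nonneg_root[OF s(1)] by metis
  note rc = nonneg_closed[OF r(1)]
  define n where "n = s \<ominus> a"
  have n: "n \<in> carrier A" "n\<^sup>\<star> = n" using a s sc by (simp_all add: n_def adj_diff nonneg_adj)
  have "n \<otimes> s = s \<otimes> n" unfolding n_def using a(1) sc as by (simp add: minus_eq l_distr r_distr l_minus r_minus)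
  then have nr: "n \<otimes> r = r \<otimes> n" using rcomm n by simp
  have "n \<otimes> a = s \<otimes> a \<ominus> a \<otimes> a" unfolding n_def using a(1) sc by (simp add: minus_eq l_distr l_minus)
  also have "\<dots> = \<ominus> (n \<otimes> s)" unfolding n_def using a(1) sc as s(2) by (simp add: minus_eq l_distr l_minus minus_add a_comm)
  finally have na: "n \<otimes> a = \<ominus> (n \<otimes> s)" .
  have an: "a \<otimes> n = n \<otimes> a" unfolding n_def using a(1) sc as by (simp add: minus_eq l_distr r_distr l_minus r_minus)
  have "(y \<otimes> n)\<^sup>\<star> \<otimes> (y \<otimes> n) = n \<otimes> (a \<otimes> n)"
    using y n by (simp add: a_def adj_mult m_assoc cl)
  also have "\<dots> = \<ominus> (n \<otimes> (n \<otimes> s))" using an na n sc by (simp add: r_minus)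
  also have "n \<otimes> (n \<otimes> s) = (n \<otimes> r) \<otimes> (n \<otimes> r)"
    unfolding r(2)[symmetric] using n rc nr by (metis m_assoc m_closed)
  finally have w: "(y \<otimes> n)\<^sup>\<star> \<otimes> (y \<otimes> n) = \<ominus> ((n \<otimes> r) \<otimes> (n \<otimes> r))" .
  have sa: "(n \<otimes> r)\<^sup>\<star> = n \<otimes> r" using n r rc nr by (simp add: adj_mult nonneg_adj)
  have "nonneg (\<ominus> ((y \<otimes> n)\<^sup>\<star> \<otimes> (y \<otimes> n)))"
    unfolding w using nonneg_square[OF _ sa] n rc by simp
  then have "y \<otimes> n = \<zero>" using adj_mult_nonpos[of "y \<otimes> n"] y n by simp
  then have "(n \<otimes> r) \<otimes> (n \<otimes> r) = \<zero>" using w n rc by (metis adj_zero l_null m_closed minus_zero minus_minus zero_closed)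
  then have "\<parallel>n \<otimes> r\<parallel> = 0" using cstar_identity[of "n \<otimes> r"] sa n rc by simp
  then have "n \<otimes> r = \<zero>" using norm_eq_zero n rc by simp
  then have ns: "n \<otimes> s = \<zero>" using n rc by (metis r(2) l_null m_assoc)
  have "n \<otimes> n = n \<otimes> s \<ominus> n \<otimes> a" using n(1) a(1) sc unfolding n_def by (simp add: minus_eq r_distr r_minus)
  also have "\<dots> = \<zero>" using na ns by (simp add: minus_eq)
  finally have "\<parallel>n\<parallel> = 0" using cstar_identity[OF n(1)] n by simp
  then have "n = \<zero>" using norm_eq_zero n by simp
  moreover have "s = n \<oplus> a" unfolding n_def using a(1) sc by algebra
  ultimately show ?thesis using s(1) a by (simp add: a_def)
qed

lemma positive_iff_nonneg: "positive A a \<longleftrightarrow> nonneg a"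
proof
  assume "nonneg a"
  then obtain s where "nonneg s" "s \<otimes> s = a" using nonneg_root by metis
  then show "positive A a" unfolding positive_def by (metis nonneg_adj nonneg_closed)
qed (auto simp: positive_def nonneg_adj_mult)

lemma nonneg_conj:
  assumes "nonneg a" "x \<in> carrier A" shows "nonneg (x\<^sup>\<star> \<otimes> a \<otimes> x)"
proof -
  obtain s where s: "nonneg s" "s \<otimes> s = a" using nonneg_root[OF assms(1)] by metis
  note sc = nonneg_closed[OF s(1)] nonneg_adj[OF s(1)]
  have "(s \<otimes> x)\<^sup>\<star> \<otimes> (s \<otimes> x) = x\<^sup>\<star> \<otimes> a \<otimes> x"
    using sc assms(2) by (simp add: adj_mult m_assoc cl flip: s(2))
  then show ?thesis using nonneg_adj_mult[of "s \<otimes> x"] sc assms(2) by simp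
qed

end


section \<open>The complete transfer operator of a monomorphism with hereditary range\<close>

locale hereditary_monomorphism = unital_cstar_algebra A for A :: "'a cstar" (structure) +
  fixes \<delta> :: "'a \<Rightarrow> 'a"
  assumes mono: "monomorphism A \<delta>"
    and hereditary: "hereditary_subalgebra (\<delta> ` carrier A) A"
begin

abbreviation p :: 'a where "p \<equiv> \<delta> \<one>"

lemma \<delta>_closed: "x \<in> carrier A \<Longrightarrow> \<delta> x \<in> carrier A"
  and \<delta>_add: "x \<in> carrier A \<Longrightarrow> y \<in> carrier A \<Longrightarrow> \<delta> (x \<oplus> y) = \<delta> x \<oplus> \<delta> y"
  and \<delta>_scale: "x \<in> carrier A \<Longrightarrow> \<delta> (c *\<^sub>C x) = c *\<^sub>C \<delta> x"
  and \<delta>_mult: "x \<in> carrier A \<Longrightarrow> y \<in> carrier A \<Longrightarrow> \<delta> (x \<otimes> y) = \<delta> x \<otimes> \<delta> y"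
  and \<delta>_adj: "x \<in> carrier A \<Longrightarrow> \<delta> (x\<^sup>\<star>) = (\<delta> x)\<^sup>\<star>"
  and \<delta>_inj: "x \<in> carrier A \<Longrightarrow> y \<in> carrier A \<Longrightarrow> \<delta> x = \<delta> y \<Longrightarrow> x = y"
  using mono by (auto simp: monomorphism_def star_hom_def inj_on_def)

lemma \<delta>_diff: "x \<in> carrier A \<Longrightarrow> y \<in> carrier A \<Longrightarrow> \<delta> (x \<ominus> y) = \<delta> x \<ominus> \<delta> y"
  by (simp add: minus_eq_scale \<delta>_add \<delta>_scale \<delta>_closed cl)

lemma p_closed: "p \<in> carrier A"
  and p_adj: "p\<^sup>\<star> = p"
  and p_p: "p \<otimes> p = p"
  by (simp_all add: \<delta>_closed flip: \<delta>_adj \<delta>_mult)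

lemma p_\<delta>: "x \<in> carrier A \<Longrightarrow> p \<otimes> \<delta> x = \<delta> x"
  and \<delta>_p: "x \<in> carrier A \<Longrightarrow> \<delta> x \<otimes> p = \<delta> x"
  by (simp_all flip: \<delta>_mult)

lemma compress_scalar_minus:
  assumes "a \<in> carrier A"
  shows "p \<otimes> (c *\<^sub>C \<one> \<ominus> a) \<otimes> p = c *\<^sub>C p \<ominus> p \<otimes> a \<otimes> p"
proof -
  have "p \<otimes> (c *\<^sub>C \<one> \<ominus> a) \<otimes> p = p \<otimes> (c *\<^sub>C \<one>) \<otimes> p \<ominus> p \<otimes> a \<otimes> p"
    using p_closed assms by (simp add: cl minus_eq r_distr l_distr r_minus l_minus)
  then show ?thesis using p_closed by (simp add: mult_scale_one mult_scale_left p_p)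
qed

text \<open>Both \<open>p a p\<close> and \<open>\<parallel>a\<parallel> p - p a p = p (\<parallel>a\<parallel> - a) p\<close> are positive, and \<open>\<parallel>a\<parallel> p\<close> is in the range.\<close>

lemma compress_range_nonneg:
  assumes "nonneg a" shows "p \<otimes> a \<otimes> p \<in> \<delta> ` carrier A"
proof -
  let ?K = "complex_of_real \<parallel>a\<parallel>"
  note a = nonneg_closed[OF assms] nonneg_adj[OF assms]
  have 1: "nonneg (p \<otimes> a \<otimes> p)" using nonneg_conj[OF assms p_closed] by (simp add: p_adj)
  have "nonneg (p \<otimes> (?K *\<^sub>C \<one> \<ominus> a) \<otimes> p)"
    using nonneg_conj[OF nonneg_const_minus[OF a order_refl] p_closed] by (simp add: p_adj)
  then have 2: "nonneg (?K *\<^sub>C p \<ominus> p \<otimes> a \<otimes> p)" by (simp add: compress_scalar_minus a)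
  have "?K *\<^sub>C p \<in> \<delta> ` carrier A" using \<delta>_scale[of \<one> ?K] by (metis image_eqI one_closed scale_closed)
  with 1 2 hereditary a p_closed show ?thesis
    unfolding hereditary_subalgebra_def positive_iff_nonneg by blast
qed

text \<open>A self-adjoint \<open>h\<close> is the difference of the nonnegative elements \<open>\<parallel>h\<parallel>\<close> and \<open>\<parallel>h\<parallel> - h\<close>; a general element
  is a combination of its real and imaginary parts.\<close>

lemma compress_range:
  assumes a: "a \<in> carrier A" shows "p \<otimes> a \<otimes> p \<in> \<delta> ` carrier A"
proof -
  have sa: "p \<otimes> h \<otimes> p \<in> \<delta> ` carrier A" if h: "h \<in> carrier A" "h\<^sup>\<star> = h" for h
  proof -
    let ?c = "complex_of_real \<parallel>h\<parallel>"
    obtain x where x: "x \<in> carrier A" "p \<otimes> (?c *\<^sub>C \<one> \<ominus> h) \<otimes> p = \<delta> x"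
      using compress_range_nonneg[OF nonneg_const_minus[OF h order_refl]] by blast
    have "p \<otimes> h \<otimes> p = ?c *\<^sub>C p \<ominus> (?c *\<^sub>C p \<ominus> p \<otimes> h \<otimes> p)"
      using p_closed h(1) scale_closed[OF p_closed, of ?c] by algebra
    also have "\<dots> = \<delta> (?c *\<^sub>C \<one> \<ominus> x)"
      using x h by (simp add: \<delta>_diff \<delta>_scale cl compress_scalar_minus)
    finally show ?thesis using x(1) by (simp add: cl)
  qed
  let ?g = "a \<oplus> a\<^sup>\<star>" and ?h = "\<i> *\<^sub>C (a \<ominus> a\<^sup>\<star>)"
  have as: "a\<^sup>\<star> \<in> carrier A" using a by (rule adj_closed)
  have hs: "?h\<^sup>\<star> = ?h" by (rule imaginary_part_adj[OF a])
  have gs: "?g\<^sup>\<star> = ?g" using a as by (simp add: adj_add adj_adj a_comm)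
  obtain x y where x: "x \<in> carrier A" "p \<otimes> ?g \<otimes> p = \<delta> x" and y: "y \<in> carrier A" "p \<otimes> ?h \<otimes> p = \<delta> y"
    using sa[OF _ gs] sa[OF _ hs] a as by (auto simp: cl)
  have "(- \<i>) *\<^sub>C ?h = a \<ominus> a\<^sup>\<star>" using a as by (simp add: scale_scale scale_one)
  then have "?g \<oplus> (- \<i>) *\<^sub>C ?h = a \<oplus> a" using a as by (simp add: ring_simprules)
  also have "\<dots> = 2 *\<^sub>C a" using a scale_left_distrib[of a 1 1] by (simp add: scale_one)
  finally have "a = (1/2) *\<^sub>C (?g \<oplus> (- \<i>) *\<^sub>C ?h)" using a by (simp add: scale_scale scale_one)
  then have "p \<otimes> a \<otimes> p = p \<otimes> ((1/2) *\<^sub>C (?g \<oplus> (- \<i>) *\<^sub>C ?h)) \<otimes> p" by simp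
  also have "\<dots> = (1/2) *\<^sub>C (p \<otimes> ?g \<otimes> p \<oplus> (- \<i>) *\<^sub>C (p \<otimes> ?h \<otimes> p))"
    using a as p_closed scale_closed[of "a \<ominus> a\<^sup>\<star>" \<i>]
    by (simp add: mult_scale_left mult_scale_right cl r_distr l_distr del: scale_scale)
  also have "\<dots> = \<delta> ((1/2) *\<^sub>C (x \<oplus> (- \<i>) *\<^sub>C y))"
    using x y by (simp add: \<delta>_scale \<delta>_add cl)
  finally show ?thesis using x(1) y(1) by (simp add: cl)
qed

text \<open>The root \<open>s\<close> of \<open>\<delta>(c)\<close> commutes with \<open>p\<close>, because \<open>p \<delta>(c) = \<delta>(c) = \<delta>(c) p\<close>. Its compression
  \<open>p s p = \<delta>(w)\<close> is therefore still a root of \<open>\<delta>(c)\<close>, and \<open>c = w\<^sup>2\<close>.\<close>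

lemma reflects_nonneg:
  assumes c: "c \<in> carrier A" and "nonneg (\<delta> c)" shows "nonneg c"
proof -
  obtain s where s: "nonneg s" "s \<otimes> s = \<delta> c"
    and comm: "\<And>x. x \<in> carrier A \<Longrightarrow> x \<otimes> \<delta> c = \<delta> c \<otimes> x \<Longrightarrow> x \<otimes> s = s \<otimes> x"
    using nonneg_root[OF assms(2)] by metis
  note sc = nonneg_closed[OF s(1)] nonneg_adj[OF s(1)]
  have ps: "p \<otimes> s = s \<otimes> p" using comm[OF p_closed] c by (simp add: p_\<delta> \<delta>_p)
  obtain w where w: "w \<in> carrier A" "p \<otimes> s \<otimes> p = \<delta> w" using compress_range[OF sc(1)] by blast
  have "\<delta> (w\<^sup>\<star>) = \<delta> w"
    using p_closed sc by (simp add: \<delta>_adj w(1) adj_mult p_adj m_assoc flip: w(2))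
  then have ws: "w\<^sup>\<star> = w" using \<delta>_inj w by (simp add: cl)
  have "\<delta> (w \<otimes> w) = p \<otimes> (s \<otimes> s) \<otimes> p"
    unfolding \<delta>_mult[OF w(1) w(1)] w(2)[symmetric] using sc(1) p_closed ps p_p
    by (metis m_assoc m_closed)
  also have "\<dots> = \<delta> c" using c by (simp add: s(2) p_\<delta> \<delta>_p)
  finally have "w \<otimes> w = c" using \<delta>_inj w c by simp
  then show ?thesis using nonneg_square[OF w(1) ws] by simp
qed

text \<open>By the C*-identity it is enough to compare the norms of \<open>d = c\<^sup>\<star> c\<close> and \<open>\<delta>(d)\<close>. Compressing
  \<open>\<parallel>\<delta>(d)\<parallel> - \<delta>(d) \<ge> 0\<close> by \<open>p\<close> gives \<open>\<delta>(\<parallel>\<delta>(d)\<parallel> - d) \<ge> 0\<close>, so \<open>0 \<le> d \<le> \<parallel>\<delta>(d)\<parallel>\<close>.\<close>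

lemma norm_le_\<delta>:
  assumes c: "c \<in> carrier A" shows "\<parallel>c\<parallel> \<le> \<parallel>\<delta> c\<parallel>"
proof -
  let ?d = "c\<^sup>\<star> \<otimes> c"
  let ?K = "\<parallel>\<delta> ?d\<parallel>"
  let ?e = "complex_of_real ?K *\<^sub>C \<one>"
  have d: "nonneg ?d" using c by (rule nonneg_adj_mult)
  note dc = nonneg_closed[OF d] nonneg_adj[OF d]
  have sa: "(\<delta> ?d)\<^sup>\<star> = \<delta> ?d" using \<delta>_adj[OF dc(1)] by (simp add: dc)
  have "nonneg (p \<otimes> (?e \<ominus> \<delta> ?d) \<otimes> p)"
    using nonneg_conj[OF nonneg_const_minus[OF \<delta>_closed[OF dc(1)] sa order_refl] p_closed] by (simp add: p_adj)
  also have "p \<otimes> (?e \<ominus> \<delta> ?d) \<otimes> p = \<delta> (?e \<ominus> ?d)"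
    using dc(1) by (simp add: compress_scalar_minus \<delta>_closed p_\<delta> \<delta>_p \<delta>_diff \<delta>_scale cl del: m_assoc)
  finally have "nonneg (?e \<ominus> ?d)" by (rule reflects_nonneg[rotated]) (use dc in \<open>simp add: cl\<close>)
  from norm_mono[OF d this] have "\<parallel>?d\<parallel> \<le> \<parallel>?d \<oplus> (?e \<ominus> ?d)\<parallel>" .
  also have "?d \<oplus> (?e \<ominus> ?d) = ?e" using dc(1) scale_closed[OF one_closed, of "complex_of_real ?K"] by algebra
  also have "\<parallel>?e\<parallel> \<le> ?K" by (rule norm_scale_one_le) (use dc in \<open>simp add: norm_nonneg \<delta>_closed\<close>)
  finally have "\<parallel>c\<parallel>\<^sup>2 \<le> \<parallel>\<delta> c\<parallel>\<^sup>2"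
    using c cstar_identity[OF c] cstar_identity[OF \<delta>_closed[OF c]] by (simp add: \<delta>_mult \<delta>_adj cl)
  then show ?thesis by (rule power2_le_imp_le) (use c in \<open>simp add: norm_nonneg \<delta>_closed\<close>)
qed

definition compress_back :: "'a \<Rightarrow> 'a" where
  "compress_back a = inv_into (carrier A) \<delta> (p \<otimes> a \<otimes> p)"

lemma compress_back_closed: "a \<in> carrier A \<Longrightarrow> compress_back a \<in> carrier A"
  and \<delta>_compress_back: "a \<in> carrier A \<Longrightarrow> \<delta> (compress_back a) = p \<otimes> a \<otimes> p"
  unfolding compress_back_def by (simp_all add: inv_into_into f_inv_into_f compress_range)

lemma compress_back_eqI:
  "a \<in> carrier A \<Longrightarrow> x \<in> carrier A \<Longrightarrow> \<delta> x = p \<otimes> a \<otimes> p \<Longrightarrow> compress_back a = x"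
  by (rule \<delta>_inj) (simp_all add: compress_back_closed \<delta>_compress_back)

lemma compress_back_add:
  "a \<in> carrier A \<Longrightarrow> b \<in> carrier A \<Longrightarrow> compress_back (a \<oplus> b) = compress_back a \<oplus> compress_back b"
  by (rule compress_back_eqI)
    (simp_all add: compress_back_closed \<delta>_add \<delta>_compress_back p_closed r_distr l_distr)

lemma compress_back_scale:
  "a \<in> carrier A \<Longrightarrow> compress_back (c *\<^sub>C a) = c *\<^sub>C compress_back a"
  by (rule compress_back_eqI)
    (simp_all add: compress_back_closed \<delta>_scale \<delta>_compress_back p_closed mult_scale_left mult_scale_right cl)

lemma compress_back_\<delta>_mult:
  assumes a: "a \<in> carrier A" and b: "b \<in> carrier A"
  shows "compress_back (\<delta> a \<otimes> b) = a \<otimes> compress_back b"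
proof (rule compress_back_eqI)
  have "\<delta> (a \<otimes> compress_back b) = (\<delta> a \<otimes> p) \<otimes> b \<otimes> p"
    using a b p_closed by (simp add: \<delta>_mult compress_back_closed \<delta>_compress_back \<delta>_closed m_assoc del: one_closed)
  also have "\<dots> = (p \<otimes> \<delta> a) \<otimes> b \<otimes> p" by (simp only: \<delta>_p[OF a] p_\<delta>[OF a])
  finally show "\<delta> (a \<otimes> compress_back b) = p \<otimes> (\<delta> a \<otimes> b) \<otimes> p"
    using a b p_closed by (simp add: \<delta>_closed m_assoc)
qed (use a b in \<open>simp_all add: compress_back_closed \<delta>_closed\<close>)

lemma norm_compress_back_le:
  assumes a: "a \<in> carrier A" shows "\<parallel>compress_back a\<parallel> \<le> \<parallel>a\<parallel>"
proof -
  have p1: "\<parallel>p\<parallel> \<le> 1"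
    using star_hom_contractive[OF unital_cstar_algebra_axioms unital_cstar_algebra_axioms _ one_closed]
      mono norm_one_le by (fastforce simp: monomorphism_def)
  have "\<parallel>compress_back a\<parallel> \<le> \<parallel>p \<otimes> a \<otimes> p\<parallel>"
    using norm_le_\<delta>[OF compress_back_closed[OF a]] by (simp add: \<delta>_compress_back a)
  also have "\<dots> \<le> \<parallel>p \<otimes> a\<parallel> * \<parallel>p\<parallel>" by (rule norm_mult) (simp_all add: a p_closed)
  also have "\<dots> \<le> \<parallel>p \<otimes> a\<parallel> * 1" by (rule mult_left_mono) (simp_all add: p1 norm_nonneg a p_closed)
  also have "\<dots> \<le> \<parallel>p\<parallel> * \<parallel>a\<parallel>" using norm_mult[OF p_closed a] by simp
  also have "\<dots> \<le> 1 * \<parallel>a\<parallel>" by (rule mult_right_mono) (simp_all add: p1 norm_nonneg a)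
  finally show ?thesis by simp
qed

lemma compress_back_positive:
  assumes a: "a \<in> carrier A" and "positive A a" shows "positive A (compress_back a)"
proof -
  have "nonneg (\<delta> (compress_back a))"
    using nonneg_conj[of a p] assms(2) p_closed by (simp add: positive_iff_nonneg p_adj \<delta>_compress_back[OF a])
  then show ?thesis unfolding positive_iff_nonneg by (rule reflects_nonneg[OF compress_back_closed[OF a]])
qed

theorem complete_transfer_compress_back: "complete_transfer_operator A \<delta> compress_back"
proof -
  have "\<exists>d>0. \<forall>y\<in>carrier A. \<parallel>y \<ominus> x\<parallel> < d \<longrightarrow> \<parallel>compress_back y \<ominus> compress_back x\<parallel> < e"
    if "x \<in> carrier A" "e > 0" for x e
  proof (intro exI[of _ e] conjI ballI impI)
    fix y assume y: "y \<in> carrier A" "\<parallel>y \<ominus> x\<parallel> < e"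
    have "compress_back y \<ominus> compress_back x = compress_back (y \<ominus> x)"
      using y that by (simp add: minus_eq_scale compress_back_closed compress_back_add compress_back_scale cl)
    then show "\<parallel>compress_back y \<ominus> compress_back x\<parallel> < e"
      using norm_compress_back_le[of "y \<ominus> x"] y that by simp
  qed (rule that)
  then show ?thesis
    unfolding complete_transfer_operator_def transfer_operator_def
    by (auto simp: compress_back_closed compress_back_add compress_back_scale compress_back_positive
        compress_back_\<delta>_mult \<delta>_compress_back)
qed

lemma the_complete_transfer_complete:
  "complete_transfer_operator A \<delta> (the_complete_transfer A \<delta>)"
  unfolding the_complete_transfer_def by (rule someI[of "complete_transfer_operator A \<delta>", OF complete_transfer_compress_back])

lemma isometry_rep_iff_crossed_rep:
  assumes D: "unital_cstar_algebra D"
  shows "isometry_rep A \<delta> D \<pi> t \<longleftrightarrow> crossed_rep A \<delta> (the_complete_transfer A \<delta>) D \<pi> t"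
proof -
  interpret D: unital_cstar_algebra D by (rule D)
  let ?\<tau> = "the_complete_transfer A \<delta>"
  have \<tau>c: "?\<tau> a \<in> carrier A" and \<tau>: "\<delta> (?\<tau> a) = p \<otimes> a \<otimes> p" if "a \<in> carrier A" for a
    using the_complete_transfer_complete that
    unfolding complete_transfer_operator_def transfer_operator_def by blast+
  show ?thesis
  proof
    assume rep: "isometry_rep A \<delta> D \<pi> t"
    let ?s = "t\<^sup>\<star>\<^bsub>D\<^esub>"
    have t: "t \<in> carrier D" "?s \<in> carrier D" and iso: "?s \<otimes>\<^bsub>D\<^esub> t = \<one>\<^bsub>D\<^esub>"
      and cov: "\<And>a. a \<in> carrier A \<Longrightarrow> \<pi> (\<delta> a) = t \<otimes>\<^bsub>D\<^esub> \<pi> a \<otimes>\<^bsub>D\<^esub> ?s"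
      and \<pi>: "\<And>a. a \<in> carrier A \<Longrightarrow> \<pi> a \<in> carrier D" "\<pi> \<one> = \<one>\<^bsub>D\<^esub>"
        "\<And>a b. a \<in> carrier A \<Longrightarrow> b \<in> carrier A \<Longrightarrow> \<pi> (a \<otimes> b) = \<pi> a \<otimes>\<^bsub>D\<^esub> \<pi> b"
      using rep D.adj_closed unfolding isometry_rep_def unital_star_hom_def star_hom_def by blast+
    have cancel: "?s \<otimes>\<^bsub>D\<^esub> (t \<otimes>\<^bsub>D\<^esub> x) = x" if "x \<in> carrier D" for x
      using that t iso by (simp flip: D.m_assoc)
    have unit: "\<pi> p = t \<otimes>\<^bsub>D\<^esub> ?s" using cov[of \<one>] \<pi>(2) t by simp
    have "\<pi> (?\<tau> a) = ?s \<otimes>\<^bsub>D\<^esub> \<pi> a \<otimes>\<^bsub>D\<^esub> t" if a: "a \<in> carrier A" for a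
    proof -
      have "\<pi> (?\<tau> a) = ?s \<otimes>\<^bsub>D\<^esub> \<pi> (\<delta> (?\<tau> a)) \<otimes>\<^bsub>D\<^esub> t"
        using cov[OF \<tau>c[OF a]] t \<pi>(1)[OF \<tau>c[OF a]] cancel iso by (simp add: D.m_assoc)
      also have "\<dots> = ?s \<otimes>\<^bsub>D\<^esub> \<pi> a \<otimes>\<^bsub>D\<^esub> t"
        unfolding \<tau>[OF a] using a \<pi>(1)[OF a] t cancel iso p_closed by (simp add: \<pi>(3) unit D.m_assoc)
      finally show ?thesis .
    qed
    then show "crossed_rep A \<delta> ?\<tau> D \<pi> t"
      using rep t iso by (simp add: crossed_rep_def isometry_rep_def D.m_assoc)
  next
    assume rep: "crossed_rep A \<delta> ?\<tau> D \<pi> t"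
    have "?\<tau> \<one> = \<one>" by (rule \<delta>_inj) (simp_all add: \<tau>c \<tau> p_closed p_p)
    moreover have "\<pi> (?\<tau> \<one>) = t\<^sup>\<star>\<^bsub>D\<^esub> \<otimes>\<^bsub>D\<^esub> \<pi> \<one> \<otimes>\<^bsub>D\<^esub> t" using rep one_closed by (auto simp: crossed_rep_def)
    ultimately have "t\<^sup>\<star>\<^bsub>D\<^esub> \<otimes>\<^bsub>D\<^esub> t = \<one>\<^bsub>D\<^esub>"
      using rep D.adj_closed by (simp add: crossed_rep_def unital_star_hom_def)
    then show "isometry_rep A \<delta> D \<pi> t" using rep unfolding crossed_rep_def isometry_rep_def by blast
  qed
qed

end


section \<open>Comparing universal algebras\<close>

lemma star_hom_restrict:
  assumes "unital_cstar_algebra A" "star_hom A B f"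
  shows "star_hom A B (restrict f (carrier A))"
proof -
  interpret unital_cstar_algebra A by (rule assms(1))
  show ?thesis using assms(2) by (auto simp: star_hom_def cl)
qed

lemma star_hom_compose:
  assumes "star_hom A B f" "star_hom B C g" shows "star_hom A C (g \<circ> f)"
  using assms unfolding star_hom_def by (auto simp: Pi_iff)

lemma star_hom_id: "star_hom A A id"
  by (simp add: star_hom_def)

text \<open>The universal property has a unique witness among functions that are \<open>undefined\<close> outside the
  carrier; for arbitrary homomorphisms this determines the values on the carrier.\<close>

lemma star_hom_unique_apply:
  assumes B: "unital_cstar_algebra B"
    and ex: "\<exists>!\<chi>. \<chi> \<in> extensional (carrier B) \<and> star_hom B E \<chi> \<and> \<chi> b = e \<and> (\<forall>a\<in>S. \<chi> (k a) = l a)"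
    and b: "b \<in> carrier B" "\<And>a. a \<in> S \<Longrightarrow> k a \<in> carrier B"
    and f: "star_hom B E f" "f b = e" "\<And>a. a \<in> S \<Longrightarrow> f (k a) = l a"
    and g: "star_hom B E g" "g b = e" "\<And>a. a \<in> S \<Longrightarrow> g (k a) = l a"
    and x: "x \<in> carrier B"
  shows "f x = g x"
proof -
  let ?P = "\<lambda>\<chi>. \<chi> \<in> extensional (carrier B) \<and> star_hom B E \<chi> \<and> \<chi> b = e \<and> (\<forall>a\<in>S. \<chi> (k a) = l a)"
  have "?P (restrict f (carrier B))" "?P (restrict g (carrier B))"
    using b f g by (simp_all add: star_hom_restrict B)
  then have "restrict f (carrier B) = restrict g (carrier B)" using ex by blast
  then show ?thesis using x by (metis restrict_apply')
qed

text \<open>The usual argument: the homomorphisms in the two directions compose to endomorphisms which fix the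
  generators, hence are identities. The four hypotheses on unique existence are the universal properties
  of \<open>I\<close> and \<open>C\<close>, each for the targets \<open>I\<close> and \<open>C\<close>.\<close>

lemma star_iso_by_universality:
  fixes I :: "'b cstar" and C :: "'c cstar"
  assumes I: "unital_cstar_algebra I" and C: "unital_cstar_algebra C"
    and II: "\<exists>!\<phi>. \<phi> \<in> extensional (carrier I) \<and> star_hom I I \<phi> \<and> \<phi> t = t \<and> (\<forall>a\<in>S. \<phi> (i a) = i a)"
    and IC: "\<exists>!\<phi>. \<phi> \<in> extensional (carrier I) \<and> star_hom I C \<phi> \<and> \<phi> t = u \<and> (\<forall>a\<in>S. \<phi> (i a) = j a)"
    and CI: "\<exists>!\<phi>. \<phi> \<in> extensional (carrier C) \<and> star_hom C I \<phi> \<and> \<phi> u = t \<and> (\<forall>a\<in>S. \<phi> (j a) = i a)"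
    and CC: "\<exists>!\<phi>. \<phi> \<in> extensional (carrier C) \<and> star_hom C C \<phi> \<and> \<phi> u = u \<and> (\<forall>a\<in>S. \<phi> (j a) = j a)"
    and t: "t \<in> carrier I" "\<And>a. a \<in> S \<Longrightarrow> i a \<in> carrier I"
    and u: "u \<in> carrier C" "\<And>a. a \<in> S \<Longrightarrow> j a \<in> carrier C"
  shows "\<exists>\<phi>. star_iso I C \<phi> \<and> \<phi> t = u \<and> (\<forall>a\<in>S. \<phi> (i a) = j a) \<and>
    (\<forall>\<psi>. star_hom I C \<psi> \<and> \<psi> t = u \<and> (\<forall>a\<in>S. \<psi> (i a) = j a) \<longrightarrow> (\<forall>x\<in>carrier I. \<psi> x = \<phi> x))"
proof -
  obtain \<phi> where \<phi>: "star_hom I C \<phi>" "\<phi> t = u" "\<And>a. a \<in> S \<Longrightarrow> \<phi> (i a) = j a" using IC by blast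
  obtain \<psi> where \<psi>: "star_hom C I \<psi>" "\<psi> u = t" "\<And>a. a \<in> S \<Longrightarrow> \<psi> (j a) = i a" using CI by blast
  have "(\<psi> \<circ> \<phi>) x = id x" if "x \<in> carrier I" for x
    by (rule star_hom_unique_apply[OF I II t star_hom_compose[OF \<phi>(1) \<psi>(1)] _ _ star_hom_id _ _ that])
      (simp_all add: \<phi> \<psi>)
  moreover have "(\<phi> \<circ> \<psi>) x = id x" if "x \<in> carrier C" for x
    by (rule star_hom_unique_apply[OF C CC u star_hom_compose[OF \<psi>(1) \<phi>(1)] _ _ star_hom_id _ _ that])
      (simp_all add: \<phi> \<psi>)
  ultimately have "bij_betw \<phi> (carrier I) (carrier C)"
    using \<phi>(1) \<psi>(1) by (intro bij_betw_byWitness[where f' = \<psi>]) (auto simp: star_hom_def)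
  then have "star_iso I C \<phi>" using \<phi>(1) by (simp add: star_iso_def)
  moreover have "\<chi> x = \<phi> x"
    if "star_hom I C \<chi> \<and> \<chi> t = u \<and> (\<forall>a\<in>S. \<chi> (i a) = j a)" "x \<in> carrier I" for \<chi> x
    using star_hom_unique_apply[OF I IC t _ _ _ \<phi> that(2), of \<chi>] that(1) by blast
  ultimately show ?thesis using \<phi>(2,3) by blast
qed


theorem proposition4p1:
  fixes A :: "'a cstar" and \<delta> :: "'a \<Rightarrow> 'a"
  assumes "unital_cstar_algebra A"
    and "monomorphism A \<delta>"
    and "hereditary_subalgebra (\<delta> ` carrier A) A"
  shows "\<exists>\<phi>. star_iso (isometry_algebra A \<delta>) (crossed_product A \<delta>) \<phi> \<and>
      \<phi> (isometry_algebra_T A \<delta>) = crossed_product_U A \<delta> \<and>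
      (\<forall>a\<in>carrier A. \<phi> (isometry_algebra_coeff A \<delta> a) = crossed_product_coeff A \<delta> a) \<and>
      (\<forall>\<psi>. star_hom (isometry_algebra A \<delta>) (crossed_product A \<delta>) \<psi> \<and>
         \<psi> (isometry_algebra_T A \<delta>) = crossed_product_U A \<delta> \<and>
         (\<forall>a\<in>carrier A. \<psi> (isometry_algebra_coeff A \<delta> a) = crossed_product_coeff A \<delta> a)
         \<longrightarrow> (\<forall>x\<in>carrier (isometry_algebra A \<delta>). \<psi> x = \<phi> x))"
proof -
  interpret hereditary_monomorphism A \<delta>
    by (intro hereditary_monomorphism.intro hereditary_monomorphism_axioms.intro assms)
  let ?I = "isometry_algebra A \<delta>" and ?C = "crossed_product A \<delta>"
  have d: "\<delta> \<in> carrier A \<rightarrow> carrier A" by (simp add: \<delta>_closed)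
  note I = isometry_algebra_rep[OF assms(1), of \<delta>]
  note C = crossed_product_rep[OF assms(1), of \<delta>]
  note CI = I(2)[unfolded isometry_rep_iff_crossed_rep[OF I(1)]]
  note IC = C(2)[folded isometry_rep_iff_crossed_rep[OF C(1)]]
  note univ_I = isometry_algebra_universal[OF assms(1) d]
  note univ_C = crossed_product_universal[OF assms(1) d complete_transfer_compress_back]
  show ?thesis
    by (rule star_iso_by_universality[OF I(1) C(1) univ_I[OF I] univ_I[OF C(1) IC]
          univ_C[OF I(1) CI] univ_C[OF C]])
      (use I(2) C(2) in \<open>auto simp: isometry_rep_def crossed_rep_def unital_star_hom_def star_hom_def\<close>)
qed

end
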